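(* Let $\Omega=\left([0,1]|_{\{0,1\}}\right)^2$ be the two-dimensional flat torus, $T>0$, let $a>0$ be a constant, and let $\gamma\ge0$ and $\mathbf{f}$ (with values in $\mathbb{R}^2$) be given smooth functions of $x\in\Omega$. Let $[h,\mathbf{u},\mathbf{B}_{\mathbf{u}}]$ be a dissipative weak solution in $(0,T)\times\Omega$ of the Savage-Hutter system $$\partial_t h+\mathrm{div}_x(h\mathbf{u})=0,\qquad \partial_t(h\mathbf{u})+\mathrm{div}_x(h\mathbf{u}\otimes\mathbf{u})+\nabla_x(ah^2)=h\left(-\gamma\frac{\mathbf{u}}{|\mathbf{u}|}+\mathbf{f}\right)$$ with initial data $h(0,\cdot)=h_0$, $\mathbf{u}(0,\cdot)=\mathbf{u}_0$. Let $[H,\mathbf{U},\mathbf{B}_{\mathbf{U}}]$, with $H>0$ in $[0,T]\times\Omega$, be a globally Lipschitz (strong) solution of the same problem, with $$h_0=H(0,\cdot),\qquad \mathbf{u}_0=\mathbf{U}(0,\cdot).$$ Then $$h=H,\qquad \mathbf{u}=\mathbf{U}\qquad\text{a.e. in}\ (0,T)\times\Omega .$$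
   Context: The unknowns are the flow height $h=h(t,x)\ge0$ and the depth-averaged velocity $\mathbf{u}=\mathbf{u}(t,x)\in\mathbb{R}^2$; $|\cdot|$ is the Euclidean norm. Working on the flat torus $\Omega$ means that periodic boundary conditions are imposed. The term $\mathbf{u}/|\mathbf{u}|$ is understood as a multi-valued mapping: it takes the value $\mathbf{u}/|\mathbf{u}|$ if $\mathbf{u}\neq0$, and values in the whole closed unit ball if $\mathbf{u}=0$. A weak solution is a triplet $[h,\mathbf{u},\mathbf{B}_{\mathbf{u}}]$ of measurable functions, for which all integrals below are well defined, such that: (1) $\displaystyle\int_0^T\int_\Omega\left(h\,\partial_t\varphi+h\mathbf{u}\cdot\nabla_x\varphi\right)dx\,dt=-\int_\Omega h_0\,\varphi(0,\cdot)\,dx$ for every compactly supported $\varphi\in C^1([0,T)\times\Omega)$; (2) $\displaystyle\int_0^T\int_\Omega\left(h\mathbf{u}\cdot\partial_t\Phi+h\mathbf{u}\otimes\mathbf{u}:\nabla_x\Phi+ah^2\,\mathrm{div}_x\Phi\right)dx\,dt=\int_0^T\int_\Omega h(\gamma\mathbf{B}_{\mathbf{u}}-\mathbf{f})\cdot\Phi\,dx\,dt-\int_\Omega h_0\mathbf{u}_0\cdot\Phi(0,\cdot)\,dx$ for every compactly supported $\Phi\in C^1([0,T)\times\Omega;\mathbb{R}^2)$; (3) $\mathbf{B}_{\mathbf{u}}(t,x)=\dfrac{\mathbf{u}(t,x)}{|\mathbf{u}(t,x)|}$ if $\mathbf{u}(t,x)\ne0$, and $\mathbf{B}_{\mathbf{u}}(t,x)\in\overline{B_1(0)}$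 if $\mathbf{u}(t,x)=0$, where $B_1(0)$ is the Euclidean unit ball in $\mathbb{R}^2$. Here compact support in $[0,T)\times\Omega$ means that the test function vanishes for $t$ near $T$ (it need not vanish at $t=0$). A weak solution $[h,\mathbf{u},\mathbf{B}_{\mathbf{u}}]$ is called a dissipative weak solution if, in addition, the energy inequality $$\int_\Omega\left[\tfrac12h|\mathbf{u}|^2+ah^2\right](\tau,\cdot)\,dx+\int_0^\tau\int_\Omega h\gamma\,\mathbf{B}_{\mathbf{u}}\cdot\mathbf{u}\,dx\,dt\le\int_\Omega\left[\tfrac12h_0|\mathbf{u}_0|^2+ah_0^2\right]dx+\int_0^\tau\int_\Omega h\mathbf{f}\cdot\mathbf{u}\,dx\,dt$$ holds for a.a. $\tau\in(0,T)$. A globally Lipschitz (strong) solution $[H,\mathbf{U},\mathbf{B}_{\mathbf{U}}]$ is one for which $H$ and $\mathbf{U}$ are Lipschitz continuous on $[0,T]\times\Omega$, $\mathbf{B}_{\mathbf{U}}$ is a measurable selection related to $\mathbf{U}$ as in (3), and the equations $\partial_tH+\mathrm{div}_x(H\mathbf{U})=0$ and $\partial_t(H\mathbf{U})+\mathrm{div}_x(H\mathbf{U}\otimes\mathbf{U})+\nabla_x(aH^2)=H(-\gamma\mathbf{B}_{\mathbf{U}}+\mathbf{f})$ hold a.e. in $(0,T)\times\Omega$. *)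

theory Defs
  imports "HOL-Analysis.Analysis"
begin

text \<open>Functions on the two-dimensional flat torus are represented by functions on the plane that
  have period 1 in each coordinate. Integrals, measurability and almost-everywhere statements
  refer to the fundamental domain, the closed unit square (opposite sides are identified, and the
  boundary is a null set).\<close>

definition periodic :: "(real^2 \<Rightarrow> 'b) \<Rightarrow> bool" where
  "periodic F \<longleftrightarrow> (\<forall>x i. F (x + axis i 1) = F x)"

definition unit_square :: "(real^2) set" where
  "unit_square = {x. \<forall>i. 0 \<le> x $ i \<and> x $ i \<le> 1}"

definition torus :: "(real^2) measure" where
  "torus = lebesgue_on unit_square"

definition cylinder :: "real \<Rightarrow> (real \<times> (real^2)) measure" where
  "cylinder T = lebesgue_on ({0<..<T} \<times> unit_square)"

definition dt :: "(real \<Rightarrow> real^2 \<Rightarrow> 'b::real_normed_vector) \<Rightarrow> real \<Rightarrow> real^2 \<Rightarrow> 'b" where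
  "dt F t x = vector_derivative (\<lambda>s. F s x) (at t)"

definition dx :: "2 \<Rightarrow> (real^2 \<Rightarrow> 'b::real_normed_vector) \<Rightarrow> real^2 \<Rightarrow> 'b" where
  "dx i F x = frechet_derivative F (at x) (axis i 1)"

definition grad :: "(real^2 \<Rightarrow> real) \<Rightarrow> real^2 \<Rightarrow> real^2" where
  "grad F x = (\<chi> i. dx i F x)"

definition vgrad :: "(real^2 \<Rightarrow> real^2) \<Rightarrow> real^2 \<Rightarrow> real^2^2" where
  "vgrad F x = (\<chi> i j. dx j (\<lambda>y. F y $ i) x)"

definition dvg :: "(real^2 \<Rightarrow> real^2) \<Rightarrow> real^2 \<Rightarrow> real" where
  "dvg F x = (\<Sum>j\<in>UNIV. dx j (\<lambda>y. F y $ j) x)"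

definition tensor_dvg :: "(real^2 \<Rightarrow> real^2^2) \<Rightarrow> real^2 \<Rightarrow> real^2" where
  "tensor_dvg M x = (\<chi> i. dvg (\<lambda>y. M y $ i) x)"

definition tensor :: "real^2 \<Rightarrow> real^2 \<Rightarrow> real^2^2" where
  "tensor v w = (\<chi> i j. v $ i * w $ j)"

primrec Ck :: "nat \<Rightarrow> (real^2 \<Rightarrow> 'b::real_normed_vector) \<Rightarrow> bool" where
  "Ck 0 F \<longleftrightarrow> continuous_on UNIV F"
| "Ck (Suc k) F \<longleftrightarrow> (\<forall>x. F differentiable (at x)) \<and> (\<forall>i. Ck k (dx i F))"

definition smooth_on_torus :: "(real^2 \<Rightarrow> 'b::real_normed_vector) \<Rightarrow> bool" where
  "smooth_on_torus F \<longleftrightarrow> periodic F \<and> (\<forall>k. Ck k F)"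

text \<open>Compactly supported functions of class C1 on [0,T) times the torus. The derivative at
  time 0 is one-sided, and since the torus is compact, compact support means vanishing for all
  times close to T.\<close>

definition test_function ::
    "real \<Rightarrow> (real \<Rightarrow> real^2 \<Rightarrow> 'b::real_normed_vector) \<Rightarrow> bool" where
  "test_function T \<phi> \<longleftrightarrow>
     (\<forall>t\<in>{0..<T}. periodic (\<phi> t)) \<and>
     (\<exists>D :: real \<times> (real^2) \<Rightarrow> (real \<times> (real^2)) \<Rightarrow>\<^sub>L 'b.
        continuous_on ({0..<T} \<times> UNIV) D \<and>
        (\<forall>z\<in>{0..<T} \<times> UNIV.
           ((\<lambda>(t, x). \<phi> t x) has_derivative blinfun_apply (D z)) (at z within {0..<T} \<times> UNIV))) \<and>
     (\<exists>t0<T. \<forall>t x. t0 \<le> t \<longrightarrow> 0 \<le> t \<longrightarrow> t < T \<longrightarrow> \<phi> t x = 0)"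

text \<open>Pointwise conditions on measurable functions are understood almost everywhere.\<close>

definition friction_selection ::
    "real \<Rightarrow> (real \<Rightarrow> real^2 \<Rightarrow> real^2) \<Rightarrow> (real \<Rightarrow> real^2 \<Rightarrow> real^2) \<Rightarrow> bool" where
  "friction_selection T u B \<longleftrightarrow>
     (\<forall>t\<in>{0<..<T}. periodic (B t)) \<and>
     (\<lambda>(t, x). B t x) \<in> borel_measurable (cylinder T) \<and>
     (AE (t, x) in cylinder T.
        (u t x \<noteq> 0 \<longrightarrow> B t x = (1 / norm (u t x)) *\<^sub>R u t x) \<and>
        (u t x = 0 \<longrightarrow> B t x \<in> cball 0 1))"

text \<open>All integrals being well defined is rendered by integrability of the integrands.\<close>

definition weak_continuity_eq ::
    "real \<Rightarrow> (real^2 \<Rightarrow> real) \<Rightarrow> (real \<Rightarrow> real^2 \<Rightarrow> real) \<Rightarrow> (real \<Rightarrow> real^2 \<Rightarrow> real^2) \<Rightarrow> bool" where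
  "weak_continuity_eq T h0 h u \<longleftrightarrow>
     (\<forall>\<phi> :: real \<Rightarrow> real^2 \<Rightarrow> real. test_function T \<phi> \<longrightarrow>
        (let I = (\<lambda>(t, x). h t x * dt \<phi> t x + (h t x *\<^sub>R u t x) \<bullet> grad (\<phi> t) x);
             I0 = (\<lambda>x. h0 x * \<phi> 0 x)
         in integrable (cylinder T) I \<and> integrable torus I0 \<and>
            integral\<^sup>L (cylinder T) I = - integral\<^sup>L torus I0))"

definition weak_momentum_eq ::
    "real \<Rightarrow> real \<Rightarrow> (real^2 \<Rightarrow> real) \<Rightarrow> (real^2 \<Rightarrow> real^2) \<Rightarrow>
     (real^2 \<Rightarrow> real) \<Rightarrow> (real^2 \<Rightarrow> real^2) \<Rightarrow>
     (real \<Rightarrow> real^2 \<Rightarrow> real) \<Rightarrow> (real \<Rightarrow> real^2 \<Rightarrow> real^2) \<Rightarrow> (real \<Rightarrow> real^2 \<Rightarrow> real^2) \<Rightarrow> bool" where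
  "weak_momentum_eq T a \<gamma> f h0 u0 h u B \<longleftrightarrow>
     (\<forall>\<Phi> :: real \<Rightarrow> real^2 \<Rightarrow> real^2. test_function T \<Phi> \<longrightarrow>
        (let I = (\<lambda>(t, x). (h t x *\<^sub>R u t x) \<bullet> dt \<Phi> t x
                     + (h t x *\<^sub>R tensor (u t x) (u t x)) \<bullet> vgrad (\<Phi> t) x
                     + a * (h t x)\<^sup>2 * dvg (\<Phi> t) x);
             J = (\<lambda>(t, x). (h t x *\<^sub>R (\<gamma> x *\<^sub>R B t x - f x)) \<bullet> \<Phi> t x);
             I0 = (\<lambda>x. (h0 x *\<^sub>R u0 x) \<bullet> \<Phi> 0 x)
         in integrable (cylinder T) I \<and> integrable (cylinder T) J \<and> integrable torus I0 \<and>
            integral\<^sup>L (cylinder T) I = integral\<^sup>L (cylinder T) J - integral\<^sup>L torus I0))"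

definition weak_solution ::
    "real \<Rightarrow> real \<Rightarrow> (real^2 \<Rightarrow> real) \<Rightarrow> (real^2 \<Rightarrow> real^2) \<Rightarrow>
     (real^2 \<Rightarrow> real) \<Rightarrow> (real^2 \<Rightarrow> real^2) \<Rightarrow>
     (real \<Rightarrow> real^2 \<Rightarrow> real) \<Rightarrow> (real \<Rightarrow> real^2 \<Rightarrow> real^2) \<Rightarrow> (real \<Rightarrow> real^2 \<Rightarrow> real^2) \<Rightarrow> bool" where
  "weak_solution T a \<gamma> f h0 u0 h u B \<longleftrightarrow>
     (\<forall>t\<in>{0<..<T}. periodic (h t) \<and> periodic (u t)) \<and>
     (\<lambda>(t, x). h t x) \<in> borel_measurable (cylinder T) \<and>
     (\<lambda>(t, x). u t x) \<in> borel_measurable (cylinder T) \<and>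
     (AE (t, x) in cylinder T. 0 \<le> h t x) \<and>
     friction_selection T u B \<and>
     weak_continuity_eq T h0 h u \<and>
     weak_momentum_eq T a \<gamma> f h0 u0 h u B"

definition energy_density :: "real \<Rightarrow> real \<Rightarrow> real^2 \<Rightarrow> real" where
  "energy_density a \<eta> v = 1/2 * \<eta> * (norm v)\<^sup>2 + a * \<eta>\<^sup>2"

definition energy_inequality ::
    "real \<Rightarrow> real \<Rightarrow> (real^2 \<Rightarrow> real) \<Rightarrow> (real^2 \<Rightarrow> real^2) \<Rightarrow>
     (real^2 \<Rightarrow> real) \<Rightarrow> (real^2 \<Rightarrow> real^2) \<Rightarrow>
     (real \<Rightarrow> real^2 \<Rightarrow> real) \<Rightarrow> (real \<Rightarrow> real^2 \<Rightarrow> real^2) \<Rightarrow> (real \<Rightarrow> real^2 \<Rightarrow> real^2) \<Rightarrow> bool" where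
  "energy_inequality T a \<gamma> f h0 u0 h u B \<longleftrightarrow>
     (AE \<tau> in lebesgue_on {0<..<T}.
        (let E = (\<lambda>x. energy_density a (h \<tau> x) (u \<tau> x));
             E0 = (\<lambda>x. energy_density a (h0 x) (u0 x));
             D = (\<lambda>(t, x). h t x * \<gamma> x * (B t x \<bullet> u t x));
             W = (\<lambda>(t, x). h t x * (f x \<bullet> u t x))
         in integrable torus E \<and> integrable torus E0 \<and>
            integrable (cylinder \<tau>) D \<and> integrable (cylinder \<tau>) W \<and>
            integral\<^sup>L torus E + integral\<^sup>L (cylinder \<tau>) D
              \<le> integral\<^sup>L torus E0 + integral\<^sup>L (cylinder \<tau>) W))"

definition dissipative_weak_solution ::
    "real \<Rightarrow> real \<Rightarrow> (real^2 \<Rightarrow> real) \<Rightarrow> (real^2 \<Rightarrow> real^2) \<Rightarrow>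
     (real^2 \<Rightarrow> real) \<Rightarrow> (real^2 \<Rightarrow> real^2) \<Rightarrow>
     (real \<Rightarrow> real^2 \<Rightarrow> real) \<Rightarrow> (real \<Rightarrow> real^2 \<Rightarrow> real^2) \<Rightarrow> (real \<Rightarrow> real^2 \<Rightarrow> real^2) \<Rightarrow> bool" where
  "dissipative_weak_solution T a \<gamma> f h0 u0 h u B \<longleftrightarrow>
     weak_solution T a \<gamma> f h0 u0 h u B \<and> energy_inequality T a \<gamma> f h0 u0 h u B"

text \<open>For the differential equations to hold at a point, the derivatives occurring in them have
  to exist there; hence the differentiability clauses (which are satisfied almost everywhere by
  Lipschitz functions, by Rademacher's theorem).\<close>

definition strong_solution ::
    "real \<Rightarrow> real \<Rightarrow> (real^2 \<Rightarrow> real) \<Rightarrow> (real^2 \<Rightarrow> real^2) \<Rightarrow>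
     (real \<Rightarrow> real^2 \<Rightarrow> real) \<Rightarrow> (real \<Rightarrow> real^2 \<Rightarrow> real^2) \<Rightarrow> (real \<Rightarrow> real^2 \<Rightarrow> real^2) \<Rightarrow> bool" where
  "strong_solution T a \<gamma> f H U B \<longleftrightarrow>
     (\<forall>t\<in>{0..T}. periodic (H t) \<and> periodic (U t)) \<and>
     (\<exists>L. L-lipschitz_on ({0..T} \<times> UNIV) (\<lambda>(t, x). H t x)) \<and>
     (\<exists>L. L-lipschitz_on ({0..T} \<times> UNIV) (\<lambda>(t, x). U t x)) \<and>
     friction_selection T U B \<and>
     (AE (t, x) in cylinder T.
        (\<lambda>(s, y). H s y) differentiable (at (t, x)) \<and>
        (\<lambda>(s, y). U s y) differentiable (at (t, x)) \<and>
        dt H t x + dvg (\<lambda>y. H t y *\<^sub>R U t y) x = 0 \<and>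
        dt (\<lambda>s y. H s y *\<^sub>R U s y) t x
          + tensor_dvg (\<lambda>y. H t y *\<^sub>R tensor (U t y) (U t y)) x
          + grad (\<lambda>y. a * (H t y)\<^sup>2) x
          = H t x *\<^sub>R (- (\<gamma> x *\<^sub>R B t x) + f x))"

end

theory Submission
  imports Defs
begin

text \<open>The proof is a relative energy argument for
  $e = \frac12 h|u-U|^2 + a(h-H)^2$. The weak continuity equation is tested with
  $\psi(\frac12|U|^2 - 2aH)$ and the weak momentum equation with $\psi U$, where $\psi(t)$ is a
  decreasing weight; combined with the energy inequality integrated against $-\psi'$ and with the
  equations of the strong solution this gives $\int (-\psi')\,e \le \int \psi R$. The friction
  terms in $R$ have a sign because $u \mapsto u/|u|$ is monotone, and the remaining terms are bounded
  by $4Le$, where $L$ is a Lipschitz constant of $U$. For $\psi(t) = \max(0,s-t)^n$ with $n$ large one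
  has $-\psi' > 4L\psi$ on $[0,s)$, so $e = 0$ before time $s$; no Gronwall lemma and no
  differentiation of $\tau \mapsto \int e(\tau,\cdot)\,dx$ is needed.

  The test functions are only Lipschitz. Mollification makes them $C^1$; the mollified gradients are
  bounded and converge at every point of differentiability, hence almost everywhere.\<close>

section \<open>Mollification of Lipschitz functions\<close>

text \<open>Expanding squares, e = (h|u|^2/2 + a h^2) - h u.U + h(|U|^2/2 - 2aH) + a H^2. The
  bracket is the energy, and the next two terms are linear in hu and h, which dictates the test
  functions. The last term contains the strong solution only; its balance, and the vanishing
  integral of div(a H^2 U), are obtained by treating constant space-time fields as weak balance
  laws, so that one mollification lemma also yields the fundamental theorem of calculus and the
  divergence theorem for Lipschitz functions. The constant 4L: a 2x2 matrix with entries at most L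
  has a quadratic form of size at most 2L|w|^2, and e carries h|w|^2 with the factor 1/2. The
  obstacle is integrability. The weak formulation asserts it for whole integrands only, and the
  energy inequality holds for almost every time before T. The argument therefore runs on (0,T') with
  T' < T, where the energy makes each flux integrable by itself, and the weight vanishes from a time
  s < T' on, which leaves room for mollification in time. Where h = 0, e does not see u; since H >
  0, this case is excluded as soon as h = H is known.\<close>

lemma has_real_derivative_max0_power:
  fixes s :: real
  shows "((\<lambda>s. (max 0 s) ^ Suc (Suc n)) has_real_derivative real (Suc (Suc n)) * (max 0 s) ^ Suc n) (at s)"
proof -
  consider "s < 0" | "s = 0" | "0 < s" by linarith
  then show ?thesis
  proof cases
    case 1
    have "((\<lambda>s. 0) has_real_derivative 0) (at s)" by simp
    then have "((\<lambda>s. (max 0 s) ^ Suc (Suc n)) has_real_derivative 0) (at s)"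
      by (rule has_field_derivative_transform_within_open[where S = "{..<0}"]) (use 1 in auto)
    then show ?thesis using 1 by simp
  next
    \<comment> \<open>At the junction the difference quotient is at most |y|^(n+1), which tends to 0
      because the exponent of the power is at least two.\<close>
    case 2
    have "((\<lambda>y. (max 0 y ^ Suc (Suc n) - max 0 s ^ Suc (Suc n)) / (y - s)) \<longlongrightarrow> 0) (at s)"
    proof (rule Lim_null_comparison)
      show "\<forall>\<^sub>F y in at s. norm ((max 0 y ^ Suc (Suc n) - max 0 s ^ Suc (Suc n)) / (y - s))
              \<le> \<bar>y\<bar> ^ Suc n"
      proof (rule always_eventually, intro allI)
        fix y :: real
        show "norm ((max 0 y ^ Suc (Suc n) - max 0 s ^ Suc (Suc n)) / (y - s)) \<le> \<bar>y\<bar> ^ Suc n"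
          using 2 by (cases "y > 0") (auto simp: max_def mult_nonpos_nonneg)
      qed
      have "((\<lambda>y. \<bar>y\<bar> ^ Suc n) \<longlongrightarrow> \<bar>s\<bar> ^ Suc n) (at s)"
        by (intro tendsto_intros)
      then show "((\<lambda>y. \<bar>y\<bar> ^ Suc n) \<longlongrightarrow> 0) (at s)" using 2 by simp
    qed
    then show ?thesis using 2 by (simp add: DERIV_def has_field_derivative_iff)
  next
    case 3
    have "((\<lambda>s. s ^ Suc (Suc n)) has_real_derivative real (Suc (Suc n)) * s ^ Suc n) (at s)"
      by (rule derivative_eq_intros | simp)+
    then have "((\<lambda>s. (max 0 s) ^ Suc (Suc n)) has_real_derivative real (Suc (Suc n)) * s ^ Suc n) (at s)"
      by (rule has_field_derivative_transform_within_open[where S = "{0<..}"]) (use 3 in auto)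
    then show ?thesis using 3 by simp
  qed
qed

text \<open>The square makes the kernel C1, matching the test functions of the weak formulation, and
  being a polynomial on its support it allows explicit constants. It is not normalised;
  \<open>bump_mass\<close> is divided out afterwards.\<close>

definition bump :: "real \<Rightarrow> 'a::euclidean_space \<Rightarrow> real" where
  "bump e w = (max 0 (e\<^sup>2 - w \<bullet> w))\<^sup>2"

definition bump_mass :: "'a::euclidean_space itself \<Rightarrow> real \<Rightarrow> real" where
  "bump_mass _ e = (\<integral>w. bump e (w::'a) \<partial>lborel)"

definition mollify :: "real \<Rightarrow> ('a::euclidean_space \<Rightarrow> real) \<Rightarrow> 'a \<Rightarrow> real" where
  "mollify e F z = (\<integral>y. bump e (y - z) * F y \<partial>lborel) / bump_mass TYPE('a) e"

text \<open>The derivative falls on the kernel: the factor in front of \<open>F y\<close> is the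
  gradient of \<open>bump e (y - z)\<close> with respect to \<open>z\<close>. The explicit integral
  makes sense for continuous \<open>F\<close> and is open to size estimates.\<close>

definition mollify_grad :: "real \<Rightarrow> ('a::euclidean_space \<Rightarrow> real) \<Rightarrow> 'a \<Rightarrow> 'a" where
  "mollify_grad e F z =
     (\<integral>y. (4 * max 0 (e\<^sup>2 - (y - z) \<bullet> (y - z)) * F y) *\<^sub>R (y - z) \<partial>lborel) /\<^sub>R bump_mass TYPE('a) e"

lemma pos_part_eq_0_outside_cball:
  assumes "w \<notin> cball 0 e" "0 < e"
  shows "max 0 (e\<^sup>2 - w \<bullet> w) = 0"
proof -
  have "e\<^sup>2 \<le> (norm w)\<^sup>2"
    using assms by (intro power_mono) auto
  then show ?thesis by (simp add: power2_norm_eq_inner)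
qed

lemma continuous_on_bump [continuous_intros]:
  "continuous_on S f \<Longrightarrow> continuous_on S (\<lambda>x. bump e (f x))"
  unfolding bump_def by (intro continuous_intros)

lemma bump_nonneg: "0 \<le> bump e w"
  by (simp add: bump_def)

lemma bump_eq_0_outside_cball:
  assumes "w \<notin> cball 0 e" "0 < e"
  shows "bump e w = 0"
  unfolding bump_def using pos_part_eq_0_outside_cball[OF assms] by simp

lemma integrable_continuous_compact_support:
  fixes f :: "'a::euclidean_space \<Rightarrow> 'b::euclidean_space"
  assumes "continuous_on UNIV f" "compact S" "\<And>x. x \<notin> S \<Longrightarrow> f x = 0"
  shows "integrable lborel f"
proof -
  have "integrable lborel (\<lambda>x. indicator S x *\<^sub>R f x)"
    by (rule borel_integrable_compact) (use assms continuous_on_subset[OF assms(1)] in auto)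
  also have "(\<lambda>x. indicator S x *\<^sub>R f x) = f"
    using assms(3) by (auto simp: indicator_def)
  finally show ?thesis .
qed

lemma integral_lborel_eq_cbox:
  fixes f :: "'a::euclidean_space \<Rightarrow> 'b::euclidean_space"
  assumes "continuous_on UNIV f" "\<And>x. x \<notin> cbox a b \<Longrightarrow> f x = 0"
  shows "(\<integral>x. f x \<partial>lborel) = integral (cbox a b) f"
proof -
  have "set_integrable lborel (cbox a b) f"
    unfolding set_integrable_def
    by (rule borel_integrable_compact) (use continuous_on_subset[OF assms(1)] in auto)
  from set_borel_integral_eq_integral(2)[OF this]
  have "(LINT x : cbox a b | lborel. f x) = integral (cbox a b) f" .
  moreover have "(\<lambda>x. indicator (cbox a b) x *\<^sub>R f x) = f"
    using assms(2) by (auto simp: indicator_def)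
  ultimately show ?thesis by (simp add: set_lebesgue_integral_def)
qed

lemma integrable_bump_mult:
  fixes F :: "'a::euclidean_space \<Rightarrow> real"
  assumes "continuous_on UNIV F" "0 < e"
  shows "integrable lborel (\<lambda>y. bump e (y - z) * F y)"
  by (rule integrable_continuous_compact_support[where S = "cball z e"])
     (use assms bump_eq_0_outside_cball[of _ e] in
       \<open>auto intro!: continuous_intros simp: dist_norm norm_minus_commute\<close>)

lemma integrable_bump_grad_mult:
  fixes F :: "'a::euclidean_space \<Rightarrow> real"
  assumes "continuous_on UNIV F" "0 < e"
  shows "integrable lborel (\<lambda>y. (4 * max 0 (e\<^sup>2 - (y - z) \<bullet> (y - z)) * F y) *\<^sub>R (y - z))"
  by (rule integrable_continuous_compact_support[where S = "cball z e"])
     (use assms pos_part_eq_0_outside_cball[of "_ - z" e] in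
       \<open>auto intro!: continuous_intros simp: dist_norm norm_minus_commute\<close>)

text \<open>On the ball of radius e/2 the kernel is at least (3/4 e^2)^2, hence 9/16. The gradient
  integral will be bounded by the same order, e^4 times the volume of a comparable ball, so that all
  powers of \<open>e\<close> cancel.\<close>

lemma bump_mass_ge:
  assumes "0 < e"
  shows "(9 / 16) * e ^ 4 * measure lborel (cball (0::'a::euclidean_space) (e / 2)) \<le> bump_mass TYPE('a) e"
proof -
  have "(9 / 16) * e ^ 4 * measure lborel (cball (0::'a) (e / 2))
      = (\<integral>w. indicator (cball (0::'a) (e / 2)) w * ((9 / 16) * e ^ 4) \<partial>lborel)"
    by simp
  also have "\<dots> \<le> (\<integral>w. bump e (w::'a) \<partial>lborel)"
  proof (rule integral_mono)
    show "integrable lborel (\<lambda>w::'a. indicator (cball 0 (e / 2)) w * ((9 / 16) * e ^ 4))"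
      by (intro integrable_mult_left integrable_real_indicator) (use emeasure_bounded_finite[OF bounded_cball] in auto)
    show "integrable lborel (\<lambda>w::'a. bump e w)"
      using integrable_bump_mult[OF continuous_on_const[of UNIV 1] assms, of 0] by simp
    fix w :: 'a
    show "indicator (cball 0 (e / 2)) w * ((9 / 16) * e ^ 4) \<le> bump e w"
    proof (cases "norm w \<le> e / 2")
      case True
      have "(norm w)\<^sup>2 \<le> (e / 2)\<^sup>2" using True by (intro power_mono) auto
      then have "3 / 4 * e\<^sup>2 \<le> e\<^sup>2 - w \<bullet> w"
        by (simp add: power2_norm_eq_inner power_divide)
      then have "3 / 4 * e\<^sup>2 \<le> max 0 (e\<^sup>2 - w \<bullet> w)" by (rule max.coboundedI2)
      then have "(3 / 4 * e\<^sup>2)\<^sup>2 \<le> bump e w"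
        unfolding bump_def by (intro power_mono) auto
      then show ?thesis using True by (simp add: power_mult_distrib power_divide)
    qed (auto simp: bump_nonneg)
  qed
  finally show ?thesis by (simp add: bump_mass_def)
qed

lemma bump_mass_pos:
  assumes "0 < e"
  shows "0 < bump_mass TYPE('a::euclidean_space) e"
proof -
  have "0 < (9 / 16) * e ^ 4 * measure lborel (cball (0::'a) (e / 2))" using assms by simp
  then show ?thesis using bump_mass_ge[OF assms, where 'a = 'a] by linarith
qed

lemma lborel_integral_translate:
  fixes f :: "'a::euclidean_space \<Rightarrow> 'b::euclidean_space"
  assumes "continuous_on UNIV f"
  shows "(\<integral>y. f (z + y) \<partial>lborel) = (\<integral>y. f y \<partial>lborel)"
proof -
  have [measurable]: "f \<in> borel_measurable borel" using assms by (rule borel_measurable_continuous_onI)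
  have "(\<integral>y. f y \<partial>lborel) = (\<integral>y. f y \<partial>distr lborel borel ((+) z))"
    by (simp add: lborel_distr_plus)
  also have "\<dots> = (\<integral>y. f (z + y) \<partial>lborel)"
    by (rule integral_distr) auto
  finally show ?thesis by simp
qed

lemma mollify_translated:
  fixes F :: "'a::euclidean_space \<Rightarrow> real"
  assumes "continuous_on UNIV F"
  shows "mollify e F z = (\<integral>w. bump e w * F (z + w) \<partial>lborel) / bump_mass TYPE('a) e"
  unfolding mollify_def
  by (subst lborel_integral_translate[symmetric, where z = z])
     (use assms in \<open>auto intro!: continuous_intros\<close>)

lemma mollify_const:
  fixes z :: "'a::euclidean_space"
  assumes "0 < e"
  shows "mollify e (\<lambda>_. c) z = c"
proof -
  have "mollify e (\<lambda>_. c) z = (\<integral>w. bump e (w::'a) * c \<partial>lborel) / bump_mass TYPE('a) e"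
    using mollify_translated[of "\<lambda>_::'a. c" e z] by simp
  then show ?thesis using bump_mass_pos[OF assms, where 'a = 'a] by (simp add: bump_mass_def)
qed

lemma mollify_diff:
  fixes F G :: "'a::euclidean_space \<Rightarrow> real"
  assumes "continuous_on UNIV F" "continuous_on UNIV G" "0 < e"
  shows "mollify e (\<lambda>z. F z - G z) z = mollify e F z - mollify e G z"
  unfolding mollify_def right_diff_distrib
  by (subst Bochner_Integration.integral_diff)
     (use assms integrable_bump_mult in \<open>auto simp: diff_divide_distrib\<close>)

lemma mollify_abs_le:
  fixes F :: "'a::euclidean_space \<Rightarrow> real"
  assumes "continuous_on UNIV F" "0 < e" "\<And>y. dist z y \<le> e \<Longrightarrow> \<bar>F y\<bar> \<le> c"
  shows "\<bar>mollify e F z\<bar> \<le> c"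
proof -
  have m: "0 < bump_mass TYPE('a) e" by (rule bump_mass_pos[OF assms(2)])
  have "\<bar>\<integral>y. bump e (y - z) * F y \<partial>lborel\<bar> \<le> (\<integral>y. bump e (y - z) * c \<partial>lborel)"
  proof (rule integral_abs_bound_integral)
    show "integrable lborel (\<lambda>y. bump e (y - z) * F y)"
      "integrable lborel (\<lambda>y. bump e (y - z) * c)"
      by (intro integrable_bump_mult assms continuous_on_const)+
    fix y show "\<bar>bump e (y - z) * F y\<bar> \<le> bump e (y - z) * c"
    proof (cases "dist z y \<le> e")
      case True
      then show ?thesis using assms(3) by (simp add: abs_mult bump_nonneg mult_left_mono)
    next
      case False
      then have "bump e (y - z) = 0"
        using assms(2) by (intro bump_eq_0_outside_cball) (auto simp: dist_norm norm_minus_commute)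
      then show ?thesis by simp
    qed
  qed
  then have "\<bar>mollify e F z\<bar> \<le> mollify e (\<lambda>_. c) z"
    unfolding mollify_def using m by (simp add: divide_right_mono)
  then show ?thesis using assms(2) by (simp add: mollify_const)
qed

lemma bump_has_derivative:
  fixes y :: "'a::euclidean_space"
  shows "((\<lambda>x. bump e (y - x)) has_derivative
           (\<lambda>v. ((4 * max 0 (e\<^sup>2 - (y - x) \<bullet> (y - x))) *\<^sub>R (y - x)) \<bullet> v)) (at x within S)"
proof -
  have g: "((\<lambda>x. e\<^sup>2 - (y - x) \<bullet> (y - x)) has_derivative (\<lambda>v. 2 * ((y - x) \<bullet> v))) (at x within S)"
    by (auto intro!: derivative_eq_intros simp: inner_commute)
  have f: "((\<lambda>s::real. (max 0 s)\<^sup>2) has_derivative (\<lambda>d. 2 * max 0 s * d)) (at s)" for s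
    using has_real_derivative_max0_power[of 0 s]
    by (simp add: has_field_derivative_def numeral_2_eq_2)
  show ?thesis
    using has_derivative_compose[OF g f] by (simp add: bump_def mult_ac)
qed

text \<open>For centres within distance 1 of \<open>z\<close> all kernels are supported in one fixed
  box, so the integrals over the whole space become parameter integrals over a compact set, where
  differentiation under the integral sign is available.\<close>

lemma mollify_has_derivative:
  fixes F :: "'a::euclidean_space \<Rightarrow> real"
  assumes F: "continuous_on UNIV F" and e: "0 < e"
  shows "(mollify e F has_derivative (\<lambda>v. mollify_grad e F z \<bullet> v)) (at z)"
    and "isCont (mollify_grad e F) z"
proof -
  define G where "G x y = (4 * max 0 (e\<^sup>2 - (y - x) \<bullet> (y - x)) * F y) *\<^sub>R (y - x)" for x y
  define m where "m = bump_mass TYPE('a) e"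
  obtain c where c: "cball z (1 + e) \<subseteq> cbox (-c) c"
    using bounded_subset_cbox_symmetric[OF bounded_cball] by blast
  define a b where "a = - c" and "b = c"
  have far: "y - x \<notin> cball 0 e" if "x \<in> ball z 1" "y \<notin> cbox a b" for x y
  proof
    assume "y - x \<in> cball 0 e"
    then have "dist x y \<le> e" by (simp add: dist_norm norm_minus_commute)
    with that(1) have "dist z y \<le> 1 + e" using dist_triangle[of z y x] by simp
    with c that(2) show False by (auto simp: a_def b_def)
  qed
  have cont: "continuous_on S (\<lambda>p. F (f p))" if "continuous_on S f" for S and f :: "'c::topological_space \<Rightarrow> 'a"
    using continuous_on_compose2[OF F that] by auto
  have 1: "mollify e F x = integral (cbox a b) (\<lambda>y. bump e (y - x) * F y) / m" if "x \<in> ball z 1" for x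
    unfolding mollify_def m_def
    by (subst integral_lborel_eq_cbox[where a = a and b = b])
       (use that far[OF that] e in \<open>auto simp: bump_eq_0_outside_cball intro!: continuous_intros cont\<close>)
  have 2: "mollify_grad e F x = integral (cbox a b) (G x) /\<^sub>R m" if "x \<in> ball z 1" for x
    unfolding mollify_grad_def m_def G_def
    by (subst integral_lborel_eq_cbox[where a = a and b = b])
       (use that far[OF that] e in \<open>auto simp: pos_part_eq_0_outside_cball intro!: continuous_intros cont\<close>)
  have contG: "continuous_on (S \<times> T) (\<lambda>(x, y). G x y)" for S T
    unfolding G_def split_beta by (intro continuous_intros cont)
  have d: "((\<lambda>x. integral (cbox a b) (\<lambda>y. bump e (y - x) * F y)) has_derivative
      blinfun_apply (integral (cbox a b) (\<lambda>y. blinfun_inner_right (G z y)))) (at z within ball z 1)"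
  proof (rule leibniz_rule)
    fix x y assume "x \<in> ball z 1" "y \<in> cbox a b"
    have "((\<lambda>x. bump e (y - x) * F y) has_derivative
        (\<lambda>v. ((4 * max 0 (e\<^sup>2 - (y - x) \<bullet> (y - x))) *\<^sub>R (y - x)) \<bullet> v * F y)) (at x within ball z 1)"
      by (rule has_derivative_mult_left[OF bump_has_derivative])
    then show "((\<lambda>x. bump e (y - x) * F y) has_derivative
        blinfun_apply (blinfun_inner_right (G x y))) (at x within ball z 1)"
      by (rule has_derivative_eq_rhs) (auto simp: G_def mult_ac)
  next
    fix x assume "x \<in> ball z 1"
    show "(\<lambda>y. bump e (y - x) * F y) integrable_on cbox a b"
      by (intro integrable_continuous continuous_intros cont)
  next
    show "continuous_on (ball z 1 \<times> cbox a b) (\<lambda>(x, y). blinfun_inner_right (G x y))"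
      using contG[of "ball z 1" "cbox a b"] unfolding split_beta by (intro continuous_intros)
  qed auto
  have "(\<lambda>y. G z y) integrable_on cbox a b"
    using contG[of "{z}" "cbox a b"]
    by (intro integrable_continuous continuous_on_compose2[OF contG[of "{z}" "cbox a b"], where f = "Pair z", simplified])
       (auto intro!: continuous_intros)
  then have "integral (cbox a b) (\<lambda>y. blinfun_inner_right (G z y)) = blinfun_inner_right (integral (cbox a b) (G z))"
    using integral_linear[of "G z" "cbox a b" blinfun_inner_right] bounded_linear_blinfun_inner_right
    by (simp add: o_def)
  with d have "((\<lambda>x. integral (cbox a b) (\<lambda>y. bump e (y - x) * F y)) has_derivative
      (\<lambda>v. integral (cbox a b) (G z) \<bullet> v)) (at z)"
    by (simp add: at_within_open[of z "ball z 1"])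
  then have "((\<lambda>x. integral (cbox a b) (\<lambda>y. bump e (y - x) * F y) / m) has_derivative
      (\<lambda>v. integral (cbox a b) (G z) \<bullet> v / m)) (at z)"
    by (auto intro!: derivative_eq_intros simp: divide_inverse)
  then have "(mollify e F has_derivative (\<lambda>v. integral (cbox a b) (G z) \<bullet> v / m)) (at z)"
    by (rule has_derivative_transform_within_open[where s = "ball z 1"]) (use 1 in auto)
  then show "(mollify e F has_derivative (\<lambda>v. mollify_grad e F z \<bullet> v)) (at z)"
    using 2[of z] by (simp add: divide_inverse mult.commute)
  have "continuous_on (ball z 1) (\<lambda>x. integral (cbox a b) (G x) /\<^sub>R m)"
    by (intro continuous_intros integral_continuous_on_param contG)
  then have "continuous_on (ball z 1) (mollify_grad e F)"
    by (subst continuous_on_cong[OF refl 2]) auto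
  then show "isCont (mollify_grad e F) z"
    by (simp add: continuous_on_eq_continuous_at)
qed

lemma mollify_grad_diff:
  fixes F G :: "'a::euclidean_space \<Rightarrow> real"
  assumes "continuous_on UNIV F" "continuous_on UNIV G" "0 < e"
  shows "mollify_grad e (\<lambda>z. F z - G z) z = mollify_grad e F z - mollify_grad e G z"
  unfolding mollify_grad_def right_diff_distrib scaleR_left_diff_distrib
  by (subst Bochner_Integration.integral_diff)
     (use assms integrable_bump_grad_mult in \<open>auto simp: scaleR_diff_right\<close>)

lemma gradient_unique:
  fixes g g' :: "'a::euclidean_space"
  assumes "(F has_derivative (\<lambda>v. g \<bullet> v)) (at z)" "(F has_derivative (\<lambda>v. g' \<bullet> v)) (at z)"
  shows "g = g'"
proof -
  have "(\<lambda>v. g \<bullet> v) = (\<lambda>v. g' \<bullet> v)" using assms by (rule has_derivative_unique)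
  then show ?thesis by (metis vector_eq_rdot)
qed

text \<open>No moment of the kernel is computed: mollifying an affine function averages only its
  additive constant and keeps the slope, and gradients are unique. This allows constants and Taylor
  polynomials to be subtracted before estimating.\<close>

lemma mollify_grad_affine:
  fixes p :: "'a::euclidean_space"
  assumes e: "0 < e"
  shows "mollify_grad e (\<lambda>y. c + p \<bullet> y) z = p"
proof -
  have F: "continuous_on UNIV (\<lambda>y. c + p \<bullet> y)" "continuous_on UNIV (\<lambda>y. p \<bullet> y)"
    by (intro continuous_intros)+
  define m where "m = bump_mass TYPE('a) e"
  have m: "m > 0" using bump_mass_pos[OF e] by (simp add: m_def)
  define k where "k = (\<integral>w. bump e (w::'a) * (c + p \<bullet> w) \<partial>lborel)"
  have i: "integrable lborel (\<lambda>w::'a. bump e w)" "integrable lborel (\<lambda>w::'a. bump e w * (c + p \<bullet> w))"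
    using integrable_bump_mult[OF continuous_on_const[of UNIV 1] e, of 0]
      integrable_bump_mult[OF F(1) e, of 0] by simp_all
  have "mollify e (\<lambda>y. c + p \<bullet> y) x = (k + (p \<bullet> x) * m) / m" for x
  proof -
    have "(\<integral>w. bump e w * (c + p \<bullet> (x + w)) \<partial>lborel)
        = (\<integral>w. bump e w * (c + p \<bullet> w) + bump e w * (p \<bullet> x) \<partial>lborel)"
      by (rule Bochner_Integration.integral_cong) (auto simp: algebra_simps inner_add_right)
    also have "\<dots> = k + m * (p \<bullet> x)"
      using i by (subst Bochner_Integration.integral_add) (auto simp: k_def m_def bump_mass_def)
    finally show ?thesis
      unfolding mollify_translated[OF F(1)] m_def by (simp add: mult.commute)
  qed
  then have *: "mollify e (\<lambda>y. c + p \<bullet> y) = (\<lambda>x. k / m + p \<bullet> x)"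
    using m by (auto simp: add_divide_distrib)
  have "((\<lambda>x. k / m + p \<bullet> x) has_derivative (\<lambda>v. p \<bullet> v)) (at z)"
    by (auto intro!: derivative_eq_intros)
  with mollify_has_derivative(1)[OF F(1) e, of z] show ?thesis
    unfolding * by (rule gradient_unique)
qed

text \<open>The gradient of the kernel is of order $1/e$ relative to its mass and $F$ is of order
  $\eta e$ on its support, so the bound does not depend on $e$.\<close>

lemma norm_mollify_grad_le:
  fixes F :: "'a::euclidean_space \<Rightarrow> real"
  assumes F: "continuous_on UNIV F" and e: "0 < e" and \<eta>: "0 \<le> \<eta>"
    and le: "\<And>y. dist z y \<le> e \<Longrightarrow> \<bar>F y\<bar> \<le> \<eta> * dist z y"
  shows "norm (mollify_grad e F z) \<le> 64 / 9 * 2 ^ DIM('a) * \<eta>"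
proof -
  define m where "m = bump_mass TYPE('a) e"
  have m: "m > 0" using bump_mass_pos[OF e] by (simp add: m_def)
  define w where "w = measure lborel (cball (0::'a) (e / 2))"
  have w: "w > 0" using e by (simp add: w_def)
  have vol: "measure lborel (cball z e) = 2 ^ DIM('a) * w"
    using e by (simp add: w_def content_cball power_divide)
  have "norm (\<integral>y. (4 * max 0 (e\<^sup>2 - (y - z) \<bullet> (y - z)) * F y) *\<^sub>R (y - z) \<partial>lborel)
      \<le> (\<integral>y. norm ((4 * max 0 (e\<^sup>2 - (y - z) \<bullet> (y - z)) * F y) *\<^sub>R (y - z)) \<partial>lborel)"
    by (rule integral_norm_bound)
  also have "\<dots> \<le> (\<integral>y. indicator (cball z e) y * (4 * e ^ 4 * \<eta>) \<partial>lborel)"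
  proof (rule integral_mono)
    show "integrable lborel (\<lambda>y. norm ((4 * max 0 (e\<^sup>2 - (y - z) \<bullet> (y - z)) * F y) *\<^sub>R (y - z)))"
      by (intro integrable_norm integrable_bump_grad_mult F e)
    show "integrable lborel (\<lambda>y. indicator (cball z e) y * (4 * e ^ 4 * \<eta>))"
      by (intro integrable_mult_left integrable_real_indicator) (use emeasure_bounded_finite[OF bounded_cball] in auto)
    fix y
    show "norm ((4 * max 0 (e\<^sup>2 - (y - z) \<bullet> (y - z)) * F y) *\<^sub>R (y - z)) \<le> indicator (cball z e) y * (4 * e ^ 4 * \<eta>)"
    proof (cases "dist z y \<le> e")
      case True
      then have n: "norm (y - z) \<le> e" by (simp add: dist_norm norm_minus_commute)
      have "\<bar>F y\<bar> \<le> \<eta> * e"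
        using le[OF True] mult_left_mono[OF True \<eta>] by linarith
      then have "max 0 (e\<^sup>2 - (y - z) \<bullet> (y - z)) * (\<bar>F y\<bar> * norm (y - z)) \<le> e\<^sup>2 * ((\<eta> * e) * e)"
        using n e \<eta> by (intro mult_mono) auto
      then show ?thesis using True by (simp add: abs_mult mult_ac eval_nat_numeral)
    next
      case False
      then have "max 0 (e\<^sup>2 - (y - z) \<bullet> (y - z)) = 0"
        by (intro pos_part_eq_0_outside_cball e) (auto simp: dist_norm norm_minus_commute)
      then show ?thesis using \<eta> by (simp add: indicator_def)
    qed
  qed
  also have "\<dots> = 2 ^ DIM('a) * w * (4 * e ^ 4 * \<eta>)"
    using vol by simp
  finally have "norm (mollify_grad e F z) \<le> 2 ^ DIM('a) * w * (4 * e ^ 4 * \<eta>) / m"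
    unfolding mollify_grad_def m_def[symmetric] using m
    by (simp add: divide_right_mono divide_inverse_commute[symmetric] field_simps)
  also have "\<dots> \<le> 2 ^ DIM('a) * w * (4 * e ^ 4 * \<eta>) / ((9 / 16) * e ^ 4 * w)"
    using bump_mass_ge[OF e, where 'a = 'a] w e \<eta> m unfolding m_def w_def
    by (intro divide_left_mono mult_pos_pos mult_nonneg_nonneg) auto
  \<comment> \<open>Here 64/9 = 4 / (9/16), and 2^DIM is the ratio of the volumes of the balls of
    radii \<open>e\<close> and e/2.\<close>
  also have "\<dots> = 64 / 9 * 2 ^ DIM('a) * \<eta>"
    using w e by (simp add: field_simps)
  finally show ?thesis .
qed

text \<open>Subtracting the constant \<open>F z\<close> does not change the mollified gradient and
  leaves a function bounded by L times the distance to \<open>z\<close>, so the scale-free bound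
  applies. It serves as the dominating bound in the limit of vanishing \<open>e\<close>.\<close>

lemma norm_mollify_grad_lipschitz_le:
  fixes F :: "'a::euclidean_space \<Rightarrow> real"
  assumes L: "L-lipschitz_on UNIV F" and e: "0 < e"
  shows "norm (mollify_grad e F z) \<le> 64 / 9 * 2 ^ DIM('a) * L"
proof -
  have F: "continuous_on UNIV F" using L by (rule lipschitz_on_continuous_on)
  have "mollify_grad e F z = mollify_grad e (\<lambda>y. F y - F z) z"
    using mollify_grad_affine[OF e, of "F z" 0 z] by (subst mollify_grad_diff[OF F _ e]) auto
  also have "norm \<dots> \<le> 64 / 9 * 2 ^ DIM('a) * L"
    using lipschitz_onD[OF L, of _ z] lipschitz_on_nonneg[OF L]
    by (intro norm_mollify_grad_le e) (auto intro!: continuous_intros F simp: dist_real_def dist_commute)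
  finally show ?thesis .
qed

text \<open>The first-order Taylor polynomial at \<open>z\<close> has mollified gradient exactly
  \<open>g\<close>. The remainder is at most \<open>\<eta>\<close> times the distance on small
  balls, and the scale-free bound turns this into a multiple of \<open>\<eta>\<close>. Only the
  behaviour at the single point \<open>z\<close> enters, as suits functions that are differentiable
  almost everywhere.\<close>

lemma mollify_grad_tendsto:
  fixes F :: "'a::euclidean_space \<Rightarrow> real"
  assumes F: "continuous_on UNIV F" and D: "(F has_derivative (\<lambda>v. g \<bullet> v)) (at z)"
  shows "((\<lambda>e. mollify_grad e F z) \<longlongrightarrow> g) (at_right 0)"
proof (rule tendstoI)
  fix r :: real assume r: "0 < r"
  define C where "C = 64 / 9 * 2 ^ DIM('a :: euclidean_space) * (1::real)"
  have C: "C > 0" by (simp add: C_def)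
  define \<eta> where "\<eta> = r / (2 * C)"
  have \<eta>: "\<eta> > 0" using r C by (simp add: \<eta>_def)
  obtain d where d: "d > 0" "\<And>y. norm (y - z) < d \<Longrightarrow> norm (F y - F z - g \<bullet> (y - z)) \<le> \<eta> * norm (y - z)"
    using D \<eta> unfolding has_derivative_at_alt by blast
  have "dist (mollify_grad e F z) g < r" if e: "0 < e" "e < d" for e
  proof -
    have "mollify_grad e F z - g = mollify_grad e (\<lambda>y. F y - ((F z - g \<bullet> z) + g \<bullet> y)) z"
      by (subst mollify_grad_diff[OF F _ e(1)]) (auto simp: mollify_grad_affine[OF e(1)] intro!: continuous_intros)
    also have "norm \<dots> \<le> 64 / 9 * 2 ^ DIM('a) * \<eta>"
    proof (intro norm_mollify_grad_le e)
      show "continuous_on UNIV (\<lambda>y. F y - ((F z - g \<bullet> z) + g \<bullet> y))" by (intro continuous_intros F)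
      fix y assume "dist z y \<le> e"
      with e have "norm (y - z) < d" by (simp add: dist_norm norm_minus_commute)
      from d(2)[OF this] show "\<bar>F y - ((F z - g \<bullet> z) + g \<bullet> y)\<bar> \<le> \<eta> * dist z y"
        by (simp add: inner_diff_right dist_norm norm_minus_commute algebra_simps)
    qed (use \<eta> in auto)
    also have "\<dots> < r" using r C by (simp add: \<eta>_def C_def)
    finally show ?thesis by (simp add: dist_norm)
  qed
  then show "\<forall>\<^sub>F e in at_right 0. dist (mollify_grad e F z) g < r"
    using d(1) eventually_at_right[of 0 1] by (auto simp: eventually_at_right_field)
qed

lemma mollify_abs_diff_le:
  fixes F :: "'a::euclidean_space \<Rightarrow> real"
  assumes L: "L-lipschitz_on UNIV F" and e: "0 < e"
  shows "\<bar>mollify e F z - F z\<bar> \<le> L * e"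
proof -
  have F: "continuous_on UNIV F" using L by (rule lipschitz_on_continuous_on)
  have "mollify e F z - F z = mollify e (\<lambda>y. F y - F z) z"
    using mollify_diff[OF F continuous_on_const e, of "F z" z] mollify_const[OF e, of "F z" z] by simp
  also have "\<bar>\<dots>\<bar> \<le> L * e"
  proof (rule mollify_abs_le)
    show "continuous_on UNIV (\<lambda>y. F y - F z)" by (intro continuous_intros F)
    fix y assume "dist z y \<le> e"
    then have "L * dist y z \<le> L * e"
      using lipschitz_on_nonneg[OF L] by (simp add: dist_commute mult_left_mono)
    then show "\<bar>F y - F z\<bar> \<le> L * e"
      using lipschitz_onD[OF L, of y z] by (simp add: dist_real_def)
  qed (use e in auto)
  finally show ?thesis .
qed

section \<open>Balance laws tested with Lipschitz functions\<close>

lemma borel_measurable_lebesgue_on_AE: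
  fixes f g :: "'a::euclidean_space \<Rightarrow> 'b::euclidean_space"
  assumes f: "f \<in> borel_measurable (lebesgue_on S)" and S: "S \<in> sets lebesgue"
    and ae: "AE x in lebesgue_on S. f x = g x"
  shows "g \<in> borel_measurable (lebesgue_on S)"
proof -
  have "AE x in lebesgue. x \<in> S \<longrightarrow> f x = g x"
    using ae S by (simp add: AE_restrict_space_iff)
  then have "AE x in lebesgue. (if x \<in> S then f x else 0) = (if x \<in> S then g x else 0)"
    by eventually_elim auto
  moreover have "(\<lambda>x. if x \<in> S then f x else 0) \<in> borel_measurable lebesgue"
    using f S by (simp add: borel_measurable_if)
  ultimately have "(\<lambda>x. if x \<in> S then g x else 0) \<in> borel_measurable lebesgue"
    by (rule borel_measurable_AE[rotated])
  then show ?thesis using S by (simp add: borel_measurable_if)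
qed

text \<open>Gradients of Lipschitz functions will be chosen point by point, without evident
  measurability. They are almost everywhere limits of continuous mollified gradients, and
  completeness of Lebesgue measure absorbs the exceptional null set.\<close>

lemma borel_measurable_lebesgue_on_AE_LIMSEQ:
  fixes f :: "nat \<Rightarrow> 'a::euclidean_space \<Rightarrow> 'b::euclidean_space"
  assumes f: "\<And>n. f n \<in> borel_measurable (lebesgue_on S)" and S: "S \<in> sets lebesgue"
    and ae: "AE x in lebesgue_on S. (\<lambda>n. f n x) \<longlonglongrightarrow> g x"
  shows "g \<in> borel_measurable (lebesgue_on S)"
proof (rule borel_measurable_lebesgue_on_AE[OF _ S])
  show "(\<lambda>x. lim (\<lambda>n. f n x)) \<in> borel_measurable (lebesgue_on S)"
    by (rule borel_measurable_lim_metric[OF f])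
  show "AE x in lebesgue_on S. lim (\<lambda>n. f n x) = g x"
    using ae by eventually_elim (rule limI)
qed

lemma unit_square_eq_cbox: "unit_square = cbox 0 1"
  by (auto simp: unit_square_def mem_box_cart)

lemma unit_square_sets [simp]: "unit_square \<in> sets borel" "unit_square \<in> sets lebesgue"
  by (simp_all add: unit_square_eq_cbox)

lemma cylinder_sets [simp]:
  fixes T :: real
  shows "{0<..<T} \<times> unit_square \<in> sets borel" "{0<..<T} \<times> unit_square \<in> sets lebesgue"
proof -
  show "{0<..<T} \<times> unit_square \<in> sets borel" by (rule borel_Times) auto
  then show "{0<..<T} \<times> unit_square \<in> sets lebesgue" by simp
qed

lemma space_torus [simp]: "space torus = unit_square"
  by (simp add: torus_def)

lemma space_cylinder [simp]: "space (cylinder T) = {0<..<T} \<times> unit_square"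
  by (simp add: cylinder_def)

lemma continuous_on_measurable_cylinder:
  fixes f :: "real \<times> (real^2) \<Rightarrow> 'b::euclidean_space"
  assumes "continuous_on ({0<..<T} \<times> unit_square) f"
  shows "f \<in> borel_measurable (cylinder T)"
  unfolding cylinder_def using assms by (intro continuous_imp_measurable_on_sets_lebesgue) auto

lemma continuous_on_measurable_torus:
  fixes f :: "real^2 \<Rightarrow> 'b::euclidean_space"
  assumes "continuous_on unit_square f"
  shows "f \<in> borel_measurable torus"
  unfolding torus_def using assms by (intro continuous_imp_measurable_on_sets_lebesgue) auto

text \<open>The distributional form of $\partial_t V_1 + \mathrm{div}_x V_2 + J = 0$ with initial
  datum $J_0$, tested with functions of class $C^1$ on the whole space.\<close>

definition weak_balance ::
    "real \<Rightarrow> (real \<times> (real^2) \<Rightarrow> real \<times> (real^2)) \<Rightarrow> (real \<times> (real^2) \<Rightarrow> real) \<Rightarrow> (real^2 \<Rightarrow> real) \<Rightarrow> bool" where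
  "weak_balance T V J J0 \<longleftrightarrow>
     integrable (cylinder T) V \<and> integrable (cylinder T) J \<and> integrable torus J0 \<and>
     (\<forall>F g. (\<forall>z. (F has_derivative (\<lambda>v. g z \<bullet> v)) (at z)) \<longrightarrow> continuous_on UNIV g \<longrightarrow>
        (\<forall>t. periodic (\<lambda>x. F (t, x))) \<longrightarrow> (\<exists>s<T. \<forall>t x. s \<le> t \<longrightarrow> F (t, x) = 0) \<longrightarrow>
        (\<integral>z. g z \<bullet> V z \<partial>cylinder T)
          = (\<integral>z. J z * F z \<partial>cylinder T) - (\<integral>x. J0 x * F (0, x) \<partial>torus))"

text \<open>The balance is applied to mollifications of \<open>F\<close>, which inherit periodicity
  and early vanishing, and dominated convergence passes to the limit: the gradients are bounded
  uniformly and converge almost everywhere, the functions themselves converge at every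
  point.\<close>

lemma weak_balance_lipschitz:
  fixes F :: "real \<times> (real^2) \<Rightarrow> real"
  assumes bal: "weak_balance T V J J0" and s: "s < T" and T: "0 < T"
    and L: "L-lipschitz_on UNIV F"
    and per: "\<And>t. periodic (\<lambda>x. F (t, x))"
    and van: "\<And>t x. s \<le> t \<Longrightarrow> F (t, x) = 0"
    and G: "AE z in cylinder T. (F has_derivative (\<lambda>v. G z \<bullet> v)) (at z)"
  shows "integrable (cylinder T) (\<lambda>z. G z \<bullet> V z)"
    and "integrable (cylinder T) (\<lambda>z. J z * F z)"
    and "integrable torus (\<lambda>x. J0 x * F (0, x))"
    and "(\<integral>z. G z \<bullet> V z \<partial>cylinder T)
          = (\<integral>z. J z * F z \<partial>cylinder T) - (\<integral>x. J0 x * F (0, x) \<partial>torus)"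
proof -
  have V: "integrable (cylinder T) V" and J: "integrable (cylinder T) J" and J0: "integrable torus J0"
    using bal by (auto simp: weak_balance_def)
  have contF: "continuous_on UNIV F" using L by (rule lipschitz_on_continuous_on)
  have L0: "0 \<le> L" using L by (rule lipschitz_on_nonneg)
  \<comment> \<open>Mollification with radius at most \<open>d\<close> spreads the support in time
    by at most \<open>d\<close>, so the approximations vanish from \<open>T - d\<close> on, still
    before \<open>T\<close>.\<close>
  define d where "d = (T - s) / 2"
  have d: "d > 0" using s by (simp add: d_def)
  define e where "e n = d * inverse (real (Suc n))" for n
  have e: "0 < e n" "e n \<le> d" for n
    using d by (auto simp: e_def field_simps)
  have "e \<longlonglongrightarrow> d * 0"
    unfolding e_def by (intro tendsto_mult tendsto_const LIMSEQ_inverse_real_of_nat)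
  then have e0: "e \<longlonglongrightarrow> 0" by simp
  have e0': "filterlim e (at_right 0) sequentially"
    by (rule tendsto_imp_filterlim_at_right[OF e0]) (use e in auto)
  define Fn where "Fn n = mollify (e n) F" for n
  define gn where "gn n = mollify_grad (e n) F" for n
  define b where "b = L * T + L * d"
  have b: "0 \<le> b" using L0 T d by (simp add: b_def)
  have contFn: "continuous_on S (Fn n)" for n S
    using mollify_has_derivative(1)[OF contF e(1)[of n]] unfolding Fn_def
    by (meson has_derivative_continuous continuous_at_imp_continuous_on)
  have contgn: "continuous_on S (gn n)" for n S
    using mollify_has_derivative(2)[OF contF e(1)[of n]] unfolding gn_def
    by (meson continuous_at_imp_continuous_on)
  have Fn_lim: "(\<lambda>n. Fn n z) \<longlonglongrightarrow> F z" for z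
  proof (rule LIM_zero_cancel, rule Lim_null_comparison)
    show "\<forall>\<^sub>F n in sequentially. norm (Fn n z - F z) \<le> L * e n"
      using mollify_abs_diff_le[OF L e(1)] by (simp add: Fn_def)
    have "(\<lambda>n. L * e n) \<longlonglongrightarrow> L * 0" by (intro tendsto_intros e0)
    then show "(\<lambda>n. L * e n) \<longlonglongrightarrow> 0" by simp
  qed
  have F_le: "\<bar>F (t, x)\<bar> \<le> L * T" if "0 \<le> t" "t \<le> T" for t x
  proof -
    have "\<bar>F (t, x) - F (T, x)\<bar> \<le> L * dist (t, x) (T, x)"
      using lipschitz_onD[OF L, of "(t, x)" "(T, x)"] by (simp add: dist_real_def)
    also have "dist (t, x) (T, x) = T - t" using that by (simp add: dist_Pair_Pair dist_real_def)
    also have "L * (T - t) \<le> L * T" using that L0 by (intro mult_left_mono) auto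
    finally show ?thesis using van[of T x] s by simp
  qed
  have Fn_le: "\<bar>Fn n (t, x)\<bar> \<le> b" if "0 \<le> t" "t \<le> T" for n t x
  proof -
    have "\<bar>Fn n (t, x) - F (t, x)\<bar> \<le> L * d"
      using mollify_abs_diff_le[OF L e(1)[of n], of "(t, x)"] mult_left_mono[OF e(2)[of n] L0]
      unfolding Fn_def by linarith
    then show ?thesis using F_le[OF that, of x] by (simp add: b_def)
  qed
  have eq: "(\<integral>z. gn n z \<bullet> V z \<partial>cylinder T)
        = (\<integral>z. J z * Fn n z \<partial>cylinder T) - (\<integral>x. J0 x * Fn n (0, x) \<partial>torus)" for n
  proof -
    have "periodic (\<lambda>x. Fn n (t, x))" for t
      unfolding periodic_def
    proof (intro allI)
      fix x and i :: 2
      have "F ((t, x + axis i 1) + w) = F ((t, x) + w)" for w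
      proof -
        have "F (t + fst w, (x + snd w) + axis i 1) = F (t + fst w, x + snd w)"
          using per[of "t + fst w"] unfolding periodic_def by blast
        then show ?thesis by (cases w) (simp add: add_ac)
      qed
      then show "Fn n (t, x + axis i 1) = Fn n (t, x)"
        unfolding Fn_def mollify_translated[OF contF] by simp
    qed
    moreover have van': "Fn n (t, x) = 0" if t: "T - d \<le> t" for t x
    proof -
      have "\<bar>Fn n (t, x)\<bar> \<le> 0"
        unfolding Fn_def
      proof (rule mollify_abs_le[OF contF e(1)])
        fix y :: "real \<times> (real^2)" assume "dist (t, x) y \<le> e n"
        then have "dist t (fst y) \<le> d" using dist_fst_le[of "(t, x)" y] e(2)[of n] by simp
        then have "s \<le> fst y" using t unfolding d_def dist_real_def by (simp add: field_simps abs_if split: if_splits)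
        then show "\<bar>F y\<bar> \<le> 0" using van[of "fst y" "snd y"] by simp
      qed
      then show ?thesis by simp
    qed
    moreover have "\<exists>s<T. \<forall>t x. s \<le> t \<longrightarrow> Fn n (t, x) = 0"
      using van' d by (intro exI[of _ "T - d"]) auto
    moreover have "\<forall>z. (Fn n has_derivative (\<lambda>v. gn n z \<bullet> v)) (at z)"
      using mollify_has_derivative(1)[OF contF e(1)] unfolding Fn_def gn_def by blast
    moreover note contgn[of UNIV n] bal[unfolded weak_balance_def]
    ultimately show ?thesis by simp
  qed
  define C where "C = 64 / 9 * 2 ^ DIM(real \<times> (real^2)) * L"
  have gn_le: "norm (gn n z) \<le> C" for n z
    unfolding gn_def C_def by (rule norm_mollify_grad_lipschitz_le[OF L e(1)])
  have Vm: "V \<in> borel_measurable (cylinder T)" and Jm: "J \<in> borel_measurable (cylinder T)"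
    and J0m: "J0 \<in> borel_measurable torus" using V J J0 by auto
  have m1: "(\<lambda>z. gn n z \<bullet> V z) \<in> borel_measurable (cylinder T)" for n
    by (intro borel_measurable_inner Vm continuous_on_measurable_cylinder contgn)
  have lim1: "AE z in cylinder T. (\<lambda>n. gn n z \<bullet> V z) \<longlonglongrightarrow> G z \<bullet> V z"
    using G
  proof eventually_elim
    case (elim z)
    have "(\<lambda>n. gn n z) \<longlonglongrightarrow> G z"
      unfolding gn_def by (rule filterlim_compose[OF mollify_grad_tendsto[OF contF elim] e0'])
    then show ?case by (intro tendsto_intros)
  qed
  have m2: "(\<lambda>z. G z \<bullet> V z) \<in> borel_measurable (cylinder T)"
    using borel_measurable_lebesgue_on_AE_LIMSEQ[OF m1[unfolded cylinder_def] _ lim1[unfolded cylinder_def]]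
    by (simp add: cylinder_def)
  have dom1: "integrable (cylinder T) (\<lambda>z. C * norm (V z))" using V by simp
  have le1: "AE z in cylinder T. norm (gn n z \<bullet> V z) \<le> C * norm (V z)" for n
    using order_trans[OF Cauchy_Schwarz_ineq2 mult_right_mono[OF gn_le norm_ge_zero]] by auto
  note dc1 = m2 m1 dom1 lim1 le1
  show "integrable (cylinder T) (\<lambda>z. G z \<bullet> V z)"
    by (rule integrable_dominated_convergence[OF dc1])
  have c1: "(\<lambda>n. \<integral>z. gn n z \<bullet> V z \<partial>cylinder T) \<longlonglongrightarrow> (\<integral>z. G z \<bullet> V z \<partial>cylinder T)"
    by (rule integral_dominated_convergence[OF dc1])
  have dc2: "(\<lambda>z. J z * F z) \<in> borel_measurable (cylinder T)"
    "(\<lambda>z. J z * Fn n z) \<in> borel_measurable (cylinder T)"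
    "integrable (cylinder T) (\<lambda>z. \<bar>J z\<bar> * b)"
    "AE z in cylinder T. (\<lambda>n. J z * Fn n z) \<longlonglongrightarrow> J z * F z"
    "AE z in cylinder T. norm (J z * Fn n z) \<le> \<bar>J z\<bar> * b" for n
  proof -
    show "(\<lambda>z. J z * F z) \<in> borel_measurable (cylinder T)"
      "(\<lambda>z. J z * Fn n z) \<in> borel_measurable (cylinder T)"
      by (intro borel_measurable_times Jm continuous_on_measurable_cylinder contFn
            continuous_on_subset[OF contF] subset_UNIV)+
    show "AE z in cylinder T. (\<lambda>n. J z * Fn n z) \<longlonglongrightarrow> J z * F z"
      by (intro AE_I2 tendsto_intros Fn_lim)
    show "AE z in cylinder T. norm (J z * Fn n z) \<le> \<bar>J z\<bar> * b"
      by (rule AE_I2) (auto simp: abs_mult intro!: mult_left_mono Fn_le)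
  qed (use J in auto)
  show "integrable (cylinder T) (\<lambda>z. J z * F z)"
    by (rule integrable_dominated_convergence[OF dc2])
  have c2: "(\<lambda>n. \<integral>z. J z * Fn n z \<partial>cylinder T) \<longlonglongrightarrow> (\<integral>z. J z * F z \<partial>cylinder T)"
    by (rule integral_dominated_convergence[OF dc2])
  have dc3: "(\<lambda>x. J0 x * F (0, x)) \<in> borel_measurable torus"
    "(\<lambda>x. J0 x * Fn n (0, x)) \<in> borel_measurable torus"
    "integrable torus (\<lambda>x. \<bar>J0 x\<bar> * b)"
    "AE x in torus. (\<lambda>n. J0 x * Fn n (0, x)) \<longlonglongrightarrow> J0 x * F (0, x)"
    "AE x in torus. norm (J0 x * Fn n (0, x)) \<le> \<bar>J0 x\<bar> * b" for n
  proof -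
    show "(\<lambda>x. J0 x * F (0, x)) \<in> borel_measurable torus"
      "(\<lambda>x. J0 x * Fn n (0, x)) \<in> borel_measurable torus"
      by (intro borel_measurable_times J0m continuous_on_measurable_torus
            continuous_on_compose2[OF contFn[of UNIV]] continuous_on_compose2[OF contF]
            continuous_intros subset_UNIV)+
    show "AE x in torus. (\<lambda>n. J0 x * Fn n (0, x)) \<longlonglongrightarrow> J0 x * F (0, x)"
      by (intro AE_I2 tendsto_intros Fn_lim)
    show "AE x in torus. norm (J0 x * Fn n (0, x)) \<le> \<bar>J0 x\<bar> * b"
      by (rule AE_I2) (use T in \<open>auto simp: abs_mult intro!: mult_left_mono Fn_le\<close>)
  qed (use J0 in auto)
  show "integrable torus (\<lambda>x. J0 x * F (0, x))"
    by (rule integrable_dominated_convergence[OF dc3])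
  have c3: "(\<lambda>n. \<integral>x. J0 x * Fn n (0, x) \<partial>torus) \<longlonglongrightarrow> (\<integral>x. J0 x * F (0, x) \<partial>torus)"
    by (rule integral_dominated_convergence[OF dc3])
  show "(\<integral>z. G z \<bullet> V z \<partial>cylinder T)
      = (\<integral>z. J z * F z \<partial>cylinder T) - (\<integral>x. J0 x * F (0, x) \<partial>torus)"
    using LIMSEQ_unique[OF c1] tendsto_diff[OF c2 c3] by (simp add: eq)
qed

section \<open>Fubini for Lebesgue measure on a product\<close>

text \<open>Lebesgue measure on a product is the completion of the product measure, so Fubini's
  theorem is applied to a Borel representative of the function extended by zero and then transferred
  back.\<close>

lemma lebesgue_on_ex_borel:
  fixes f :: "'a::euclidean_space \<Rightarrow> real"
  assumes f: "f \<in> borel_measurable (lebesgue_on S)" and S: "S \<in> sets lebesgue"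
  obtains g where "g \<in> borel_measurable borel" "AE x in lborel. (if x \<in> S then f x else 0) = g x"
proof -
  have "(\<lambda>x. if x \<in> S then f x else 0) \<in> borel_measurable lebesgue"
    using f S by (simp add: borel_measurable_if)
  from completion_ex_borel_measurable_real[OF this] show ?thesis using that by auto
qed

lemma AE_lborel_Times:
  fixes P :: "'a::euclidean_space \<times> 'b::euclidean_space \<Rightarrow> bool"
  assumes "AE z in lborel. P z"
  shows "AE x in lborel. AE y in lborel. P (x, y)"
  by (rule lborel_pair.AE_pair) (unfold lborel_prod, fact)

lemma AE_lebesgue_on_iff:
  assumes "A \<in> sets lebesgue"
  shows "(AE x in lebesgue_on A. P x) \<longleftrightarrow> (AE x in lborel. x \<in> A \<longrightarrow> P x)"
  using assms by (simp add: AE_restrict_space_iff AE_completion_iff)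

text \<open>Applied to the whole product and to almost every slice, so that a single Borel
  representative serves both sides of Fubini's theorem.\<close>

lemma integrable_lebesgue_on_cong_borel:
  fixes f g :: "'a::euclidean_space \<Rightarrow> real"
  assumes B: "B \<in> sets lebesgue" and g: "g \<in> borel_measurable borel"
    and eq: "AE y in lborel. (if y \<in> B then f y else 0) = g y"
  shows "integrable (lebesgue_on B) f \<longleftrightarrow> integrable lborel g"
    and "integral\<^sup>L (lebesgue_on B) f = integral\<^sup>L lborel g"
    and "f \<in> borel_measurable (lebesgue_on B)"
proof -
  have eq': "AE y in lebesgue. g y = (if y \<in> B then f y else 0)"
    using AE_completion[OF eq] by eventually_elim simp
  have m: "(\<lambda>y. if y \<in> B then f y else 0) \<in> borel_measurable lebesgue"
    by (rule borel_measurable_AE[OF _ eq']) (use g in \<open>simp add: measurable_completion\<close>)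
  then show "f \<in> borel_measurable (lebesgue_on B)" using B by (simp add: borel_measurable_if)
  have gl: "g \<in> borel_measurable lebesgue" using g by (simp add: measurable_completion)
  have "integrable (lebesgue_on B) f \<longleftrightarrow> integrable lebesgue (\<lambda>y. if y \<in> B then f y else 0)"
    using B by (simp add: Lebesgue_Measure.integrable_restrict_UNIV)
  also have "\<dots> \<longleftrightarrow> integrable lebesgue g"
    by (rule integrable_cong_AE[OF m gl]) (use eq' in eventually_elim, simp)
  also have "\<dots> \<longleftrightarrow> integrable lborel g"
    using g by (intro integrable_completion) simp
  finally show "integrable (lebesgue_on B) f \<longleftrightarrow> integrable lborel g" .
  have "integral\<^sup>L (lebesgue_on B) f = integral\<^sup>L lebesgue (\<lambda>y. if y \<in> B then f y else 0)"
    using B by (simp add: Lebesgue_Measure.integral_restrict_UNIV)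
  also have "\<dots> = integral\<^sup>L lebesgue g"
    by (rule integral_cong_AE[OF m gl]) (use eq' in eventually_elim, simp)
  also have "\<dots> = integral\<^sup>L lborel g"
    using g by (intro integral_completion) simp
  finally show "integral\<^sup>L (lebesgue_on B) f = integral\<^sup>L lborel g" .
qed

lemma lebesgue_on_Times_sections:
  fixes f :: "'a::euclidean_space \<times> 'b::euclidean_space \<Rightarrow> real"
  assumes eq: "AE z in lborel. (if z \<in> A \<times> B then f z else 0) = g z"
  shows "AE x in lborel. x \<in> A \<longrightarrow> (AE y in lborel. (if y \<in> B then f (x, y) else 0) = g (x, y))"
    and "AE x in lborel. x \<notin> A \<longrightarrow> (AE y in lborel. g (x, y) = 0)"
proof -
  note AE_lborel_Times[OF eq]
  then show "AE x in lborel. x \<in> A \<longrightarrow> (AE y in lborel. (if y \<in> B then f (x, y) else 0) = g (x, y))"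
    and "AE x in lborel. x \<notin> A \<longrightarrow> (AE y in lborel. g (x, y) = 0)"
    by (eventually_elim; auto elim: eventually_mono)+
qed

lemma lebesgue_on_Times_fubini:
  fixes f :: "'a::euclidean_space \<times> 'b::euclidean_space \<Rightarrow> real"
  assumes A: "A \<in> sets lebesgue" and B: "B \<in> sets lebesgue" and AB: "A \<times> B \<in> sets lebesgue"
    and f: "integrable (lebesgue_on (A \<times> B)) f"
  shows "AE x in lebesgue_on A. integrable (lebesgue_on B) (\<lambda>y. f (x, y))"
    and "integrable (lebesgue_on A) (\<lambda>x. \<integral>y. f (x, y) \<partial>lebesgue_on B)"
    and "(\<integral>x. (\<integral>y. f (x, y) \<partial>lebesgue_on B) \<partial>lebesgue_on A) = integral\<^sup>L (lebesgue_on (A \<times> B)) f"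
proof -
  obtain g where g: "g \<in> borel_measurable borel"
      and eq: "AE z in lborel. (if z \<in> A \<times> B then f z else 0) = g z"
    using lebesgue_on_ex_borel[OF _ AB] f by blast
  note fg = integrable_lebesgue_on_cong_borel[OF AB g eq]
  have gi: "integrable (lborel \<Otimes>\<^sub>M lborel) g" using fg(1) f by (simp add: lborel_prod)
  have gs: "(\<lambda>y. g (x, y)) \<in> borel_measurable borel" for x
    using g by (intro measurable_compose[OF _ g]) (simp flip: borel_prod)
  note sec = lebesgue_on_Times_sections[OF eq]
  have "AE x in lborel. x \<in> A \<longrightarrow> integrable (lebesgue_on B) (\<lambda>y. f (x, y))"
    using sec(1) lborel_pair.AE_integrable_fst'[OF gi]
  proof eventually_elim
    case (elim x)
    then show ?case using integrable_lebesgue_on_cong_borel(1)[OF B gs, of "\<lambda>y. f (x, y)" x] by auto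
  qed
  then show "AE x in lebesgue_on A. integrable (lebesgue_on B) (\<lambda>y. f (x, y))"
    using A by (simp add: AE_lebesgue_on_iff)
  define k where "k x = (\<integral>y. g (x, y) \<partial>lborel)" for x
  have ki: "integrable lborel k" unfolding k_def by (rule lborel_pair.integrable_fst'[OF gi])
  have "AE x in lborel. (if x \<in> A then \<integral>y. f (x, y) \<partial>lebesgue_on B else 0) = k x"
    using sec
  proof eventually_elim
    case (elim x)
    show ?case
    proof (cases "x \<in> A")
      case True
      with elim(1) have "AE y in lborel. (if y \<in> B then f (x, y) else 0) = g (x, y)" by blast
      with True show ?thesis unfolding k_def by (simp add: integrable_lebesgue_on_cong_borel(2)[OF B gs])
    next
      case False
      with elim(2) have "AE y in lborel. g (x, y) = 0" by blast
      with False show ?thesis unfolding k_def by (simp add: integral_eq_zero_AE)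
    qed
  qed
  note ak = integrable_lebesgue_on_cong_borel[OF A _ this]
  have km: "k \<in> borel_measurable borel" using ki by auto
  show "integrable (lebesgue_on A) (\<lambda>x. \<integral>y. f (x, y) \<partial>lebesgue_on B)"
    using ak(1)[OF km] ki by blast
  show "(\<integral>x. (\<integral>y. f (x, y) \<partial>lebesgue_on B) \<partial>lebesgue_on A) = integral\<^sup>L (lebesgue_on (A \<times> B)) f"
    using ak(2)[OF km] fg(2) lborel_pair.integral_fst'[OF gi] by (simp add: k_def lborel_prod)
qed

text \<open>This is Tonelli's theorem. The energy inequality speaks about single time slices; their
  uniform bound yields integrability of the energy density in space-time.\<close>

lemma integrable_lebesgue_on_Times_nonneg:
  fixes f :: "'a::euclidean_space \<times> 'b::euclidean_space \<Rightarrow> real"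
  assumes A: "A \<in> lmeasurable" and B: "B \<in> sets lebesgue" and AB: "A \<times> B \<in> sets lebesgue"
    and f: "f \<in> borel_measurable (lebesgue_on (A \<times> B))"
    and nn: "AE z in lebesgue_on (A \<times> B). 0 \<le> f z"
    and bd: "AE x in lebesgue_on A. integrable (lebesgue_on B) (\<lambda>y. f (x, y)) \<and>
               (\<integral>y. f (x, y) \<partial>lebesgue_on B) \<le> K"
  shows "integrable (lebesgue_on (A \<times> B)) f"
proof -
  have A': "A \<in> sets lebesgue" using A by blast
  obtain g where g: "g \<in> borel_measurable borel"
      and eq: "AE z in lborel. (if z \<in> A \<times> B then f z else 0) = g z"
    using lebesgue_on_ex_borel[OF f AB] by blast
  have gs: "(\<lambda>y. g (x, y)) \<in> borel_measurable borel" for x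
    using g by (intro measurable_compose[OF _ g]) (simp flip: borel_prod)
  note sec = lebesgue_on_Times_sections[OF eq]
  have "AE z in lborel. z \<in> A \<times> B \<longrightarrow> 0 \<le> f z"
    using nn AB by (simp add: AE_lebesgue_on_iff)
  with eq have "AE z in lborel. 0 \<le> g z" by eventually_elim (auto split: if_splits)
  then have gn: "AE z in lborel. norm (g z) = g z" by eventually_elim simp
  have "AE x in lborel. x \<in> A \<longrightarrow> integrable (lebesgue_on B) (\<lambda>y. f (x, y)) \<and>
               (\<integral>y. f (x, y) \<partial>lebesgue_on B) \<le> K"
    by (rule iffD1[OF AE_lebesgue_on_iff[OF A'] bd])
  with sec AE_lborel_Times[OF gn]
  have *: "AE x in lborel. (\<integral>\<^sup>+y. norm (g (x, y)) \<partial>lborel) \<le> ennreal K * indicator A x"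
  proof eventually_elim
    case (elim x)
    show ?case
    proof (cases "x \<in> A")
      case True
      with elim(1) have e: "AE y in lborel. (if y \<in> B then f (x, y) else 0) = g (x, y)" by blast
      note r = integrable_lebesgue_on_cong_borel[OF B gs e]
      have i: "integrable lborel (\<lambda>y. g (x, y))" and le: "(\<integral>y. g (x, y) \<partial>lborel) \<le> K"
        using r(1,2) elim(4) True by auto
      have "(\<integral>\<^sup>+y. norm (g (x, y)) \<partial>lborel) = ennreal (\<integral>y. norm (g (x, y)) \<partial>lborel)"
        by (rule nn_integral_eq_integral) (use i in auto)
      also have "(\<integral>y. norm (g (x, y)) \<partial>lborel) = (\<integral>y. g (x, y) \<partial>lborel)"
        by (rule integral_cong_AE) (use i elim(3) in auto)
      finally show ?thesis using True le by (simp add: ennreal_leI)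
    next
      case False
      with elim(2) have "AE y in lborel. g (x, y) = 0" by blast
      then have "AE y in lborel. ennreal (norm (g (x, y))) = 0" by eventually_elim simp
      then have "(\<integral>\<^sup>+y. norm (g (x, y)) \<partial>lborel) = 0"
        using gs by (subst nn_integral_0_iff_AE) auto
      then show ?thesis by simp
    qed
  qed
  have "(\<integral>\<^sup>+z. norm (g z) \<partial>lborel) = (\<integral>\<^sup>+x. \<integral>\<^sup>+y. norm (g (x, y)) \<partial>lborel \<partial>lborel)"
    using lborel.nn_integral_fst[of "\<lambda>z. ennreal (norm (g z))" lborel] g
    by (simp add: lborel_prod)
  also have "\<dots> \<le> (\<integral>\<^sup>+x. ennreal K * indicator A x \<partial>lborel)"
    by (rule nn_integral_mono_AE[OF *])
  also have "\<dots> = (\<integral>\<^sup>+x. ennreal K * indicator A x \<partial>lebesgue)"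
    by (simp add: nn_integral_completion)
  also have "\<dots> = ennreal K * emeasure lebesgue A"
    using A' by (rule nn_integral_cmult_indicator)
  also have "\<dots> < \<infinity>"
    using A by (simp add: fmeasurable_def ennreal_mult_less_top del: emeasure_completion)
  finally have "integrable lborel g"
    using g by (intro integrableI_bounded) auto
  then show ?thesis using integrable_lebesgue_on_cong_borel(1)[OF AB g eq] by blast
qed

text \<open>The shifted box is cut by the plane where coordinate \<open>j\<close> equals 1; the part
  beyond it, moved back by one period, fills the gap left in the unit box.\<close>

lemma integral_cbox_periodic:
  fixes f :: "real^'n \<Rightarrow> real"
  assumes cont: "continuous_on UNIV f" and per: "\<And>x. f (x + axis j 1) = f x" and s: "0 \<le> s" "s \<le> 1"
  shows "integral (cbox 0 1) (\<lambda>x. f (x + s *\<^sub>R axis j 1)) = integral (cbox 0 1) f"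
proof -
  define e where "e = (axis j 1 :: real^'n)"
  have e: "e \<in> Basis" by (simp add: e_def)
  have int: "f integrable_on cbox a b" for a b
    by (intro integrable_continuous continuous_on_subset[OF cont]) auto
  have mem: "x \<in> cbox a b \<longleftrightarrow> (a $ j \<le> x $ j \<and> x $ j \<le> b $ j) \<and>
      (\<forall>i. i \<noteq> j \<longrightarrow> a $ i \<le> x $ i \<and> x $ i \<le> b $ i)" for x a b :: "real^'n"
    by (metis mem_box_cart(2))
  have xe: "x \<bullet> e = x $ j" for x by (simp add: e_def inner_axis)
  have "integral (cbox 0 1) (\<lambda>x. f (x + s *\<^sub>R e)) = integral (cbox (s *\<^sub>R e) (1 + s *\<^sub>R e)) f"
    using integral_shift_cbox_plus[of 0 1 f "s *\<^sub>R e"] by (simp add: o_def add.commute)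
  also have "\<dots> = integral (cbox (s *\<^sub>R e) (1 + s *\<^sub>R e) \<inter> {x. x \<bullet> e \<le> 1}) f
      + integral (cbox (s *\<^sub>R e) (1 + s *\<^sub>R e) \<inter> {x. 1 \<le> x \<bullet> e}) f"
    by (rule integral_split[OF int e])
  also have "cbox (s *\<^sub>R e) (1 + s *\<^sub>R e) \<inter> {x. x \<bullet> e \<le> 1} = cbox 0 1 \<inter> {x. s \<le> x \<bullet> e}"
    using s unfolding xe set_eq_iff Int_iff mem_Collect_eq mem
    by (auto simp: e_def axis_def)
  also have "cbox (s *\<^sub>R e) (1 + s *\<^sub>R e) \<inter> {x. 1 \<le> x \<bullet> e} = cbox (0 + e) ((1 - e + s *\<^sub>R e) + e)"
    using s unfolding xe set_eq_iff Int_iff mem_Collect_eq mem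
    by (auto simp: e_def axis_def)
  also have "integral (cbox (0 + e) ((1 - e + s *\<^sub>R e) + e)) f = integral (cbox 0 (1 - e + s *\<^sub>R e)) f"
    using integral_shift_cbox_plus[of 0 "1 - e + s *\<^sub>R e" f e] per
    by (simp add: o_def add.commute e_def)
  also have "cbox 0 (1 - e + s *\<^sub>R e) = cbox 0 1 \<inter> {x. x \<bullet> e \<le> s}"
    using s unfolding xe set_eq_iff Int_iff mem_Collect_eq mem
    by (auto simp: e_def axis_def)
  also have "integral (cbox 0 1 \<inter> {x. s \<le> x \<bullet> e}) f + integral (cbox 0 1 \<inter> {x. x \<bullet> e \<le> s}) f = integral (cbox 0 1) f"
    using integral_split[OF int e, of 0 1 s] by simp
  finally show ?thesis by (simp add: e_def)
qed

lemma integrable_lebesgue_on_subset: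
  fixes f :: "'a::euclidean_space \<Rightarrow> 'b::euclidean_space"
  assumes "integrable (lebesgue_on S) f" "A \<subseteq> S" "S \<in> sets lebesgue" "A \<in> sets lebesgue"
  shows "integrable (lebesgue_on A) f"
proof -
  have "set_integrable lebesgue S f"
    using assms by (simp add: integrable_restrict_space set_integrable_def)
  then have "set_integrable lebesgue A f"
    by (rule set_integrable_subset) (use assms in auto)
  then show ?thesis
    using assms by (simp add: integrable_restrict_space set_integrable_def)
qed

lemma lebesgue_on_vanishing_outside:
  fixes f :: "'a::euclidean_space \<Rightarrow> real"
  assumes "A \<subseteq> S" "S \<in> sets lebesgue" "A \<in> sets lebesgue"
    and "\<And>x. x \<in> S - A \<Longrightarrow> f x = 0"
  shows "integral\<^sup>L (lebesgue_on S) f = integral\<^sup>L (lebesgue_on A) f"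
proof -
  have "(\<lambda>x. if x \<in> S then f x else 0) = (\<lambda>x. if x \<in> A then f x else 0)"
    using assms by (auto simp: fun_eq_iff)
  then show ?thesis
    using Lebesgue_Measure.integral_restrict_UNIV[of S f] Lebesgue_Measure.integral_restrict_UNIV[of A f] assms
    by simp
qed

lemma cylinder_mono: "s \<le> T \<Longrightarrow> {0<..<s::real} \<times> unit_square \<subseteq> {0<..<T} \<times> unit_square"
  by auto

lemma integrable_cylinder_mono:
  fixes f :: "real \<times> (real^2) \<Rightarrow> 'b::euclidean_space"
  assumes "integrable (cylinder T) f" "s \<le> T"
  shows "integrable (cylinder s) f"
  using assms integrable_lebesgue_on_subset[OF _ cylinder_mono] unfolding cylinder_def by simp

lemma AE_cylinder_mono:
  assumes "AE z in cylinder T. P z" "s \<le> T"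
  shows "AE z in cylinder s. P z"
proof -
  have "AE z in lborel. z \<in> {0<..<T} \<times> unit_square \<longrightarrow> P z"
    using assms(1) by (simp only: cylinder_def AE_lebesgue_on_iff cylinder_sets)
  then have "AE z in lborel. z \<in> {0<..<s} \<times> unit_square \<longrightarrow> P z"
    by eventually_elim (use assms(2) in auto)
  then show ?thesis by (simp only: cylinder_def AE_lebesgue_on_iff cylinder_sets)
qed

lemma measurable_cylinder_mono:
  fixes f :: "real \<times> (real^2) \<Rightarrow> 'b::euclidean_space"
  assumes "f \<in> borel_measurable (cylinder T)" "s \<le> T"
  shows "f \<in> borel_measurable (cylinder s)"
  using assms measurable_restrict_mono[OF _ cylinder_mono] unfolding cylinder_def by blast

lemma integrable_cylinder_continuous:
  fixes f :: "real \<times> (real^2) \<Rightarrow> 'b::euclidean_space"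
  assumes "continuous_on UNIV f"
  shows "integrable (cylinder T) f"
  unfolding cylinder_def
proof (rule integrable_lebesgue_on_subset)
  show "integrable (lebesgue_on (cbox (0, 0) (T, 1))) f"
    by (intro continuous_imp_integrable continuous_on_subset[OF assms]) auto
  show "{0<..<T} \<times> unit_square \<subseteq> cbox (0, 0) (T, 1)"
    unfolding cbox_Pair_eq unit_square_eq_cbox by auto
qed auto

lemma integrable_torus_continuous:
  fixes f :: "real^2 \<Rightarrow> 'b::euclidean_space"
  assumes "continuous_on UNIV f"
  shows "integrable torus f"
  unfolding torus_def unit_square_eq_cbox
  by (intro continuous_imp_integrable continuous_on_subset[OF assms]) auto

lemma integral_torus_eq:
  fixes f :: "real^2 \<Rightarrow> 'b::euclidean_space"
  assumes "continuous_on UNIV f"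
  shows "integral\<^sup>L torus f = integral (cbox 0 1) f"
  using integrable_torus_continuous[OF assms]
  unfolding torus_def unit_square_eq_cbox by (rule lebesgue_integral_eq_integral) auto

lemma cylinder_fubini:
  fixes f :: "real \<times> (real^2) \<Rightarrow> real"
  assumes "integrable (cylinder T) f"
  shows "integrable (lebesgue_on {0<..<T}) (\<lambda>t. \<integral>x. f (t, x) \<partial>torus)"
    and "(\<integral>z. f z \<partial>cylinder T) = (\<integral>t. (\<integral>x. f (t, x) \<partial>torus) \<partial>lebesgue_on {0<..<T})"
  using lebesgue_on_Times_fubini(2,3)[of "{0<..<T}" unit_square f] assms
  by (simp_all add: cylinder_def torus_def)

text \<open>The integral of the shifted function does not depend on the shift; differentiating this
  constant under the integral sign at shift 0 gives the integral of the partial derivative.\<close>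

lemma integral_cbox_periodic_deriv:
  fixes f :: "real^'n \<Rightarrow> real" and g :: "real^'n \<Rightarrow> real^'n"
  assumes deriv: "\<And>x. (f has_derivative (\<lambda>v. g x \<bullet> v)) (at x)" and cont: "continuous_on UNIV g"
    and per: "\<And>x. f (x + axis j 1) = f x"
  shows "integral (cbox 0 1) (\<lambda>x. g x $ j) = 0"
proof -
  define e where "e = (axis j 1 :: real^'n)"
  have contf: "continuous_on S f" for S
    using deriv by (meson has_derivative_continuous continuous_at_imp_continuous_on)
  have contg: "continuous_on S (\<lambda>x. g (k x))" if "continuous_on S k" for S and k :: "'c::topological_space \<Rightarrow> _"
    using continuous_on_compose2[OF cont that] by auto
  have "((\<lambda>s. integral (cbox 0 1) (\<lambda>x. f (x + s *\<^sub>R e))) has_field_derivative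
      integral (cbox 0 1) (\<lambda>x. g (x + 0 *\<^sub>R e) \<bullet> e)) (at 0 within {0..1})"
  proof (rule leibniz_rule_field_derivative)
    fix s :: real and x :: "real^'n"
    have "((\<lambda>s. x + s *\<^sub>R e) has_derivative (\<lambda>d. d *\<^sub>R e)) (at s within {0..1})"
      by (auto intro!: derivative_eq_intros)
    from has_derivative_compose[OF this deriv]
    show "((\<lambda>s. f (x + s *\<^sub>R e)) has_field_derivative g (x + s *\<^sub>R e) \<bullet> e) (at s within {0..1})"
      by (simp add: has_field_derivative_def mult_commute_abs)
    show "(\<lambda>x. f (x + s *\<^sub>R e)) integrable_on cbox 0 1"
      by (intro integrable_continuous continuous_on_compose2[OF contf[of UNIV]] continuous_intros) auto
  next
    show "continuous_on ({0..1} \<times> cbox 0 1) (\<lambda>(s, x). g (x + s *\<^sub>R e) \<bullet> e)"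
      unfolding split_beta by (intro continuous_intros contg)
  qed auto
  moreover have "((\<lambda>s. integral (cbox 0 1) (\<lambda>x. f (x + s *\<^sub>R e))) has_field_derivative 0) (at 0 within {0..1})"
  proof (rule has_field_derivative_transform_within[where d = 1])
    show "((\<lambda>s. integral (cbox 0 1) f) has_field_derivative 0) (at 0 within {0..1})" by simp
    fix s :: real assume "s \<in> {0..1}"
    then show "integral (cbox 0 1) f = integral (cbox 0 1) (\<lambda>x. f (x + s *\<^sub>R e))"
      unfolding e_def by (subst integral_cbox_periodic[OF contf per]) auto
  qed auto
  moreover have "at (0::real) within {0..1} \<noteq> bot"
    by (simp add: at_within_Icc_at_right)
  ultimately have "integral (cbox 0 1) (\<lambda>x. g (x + 0 *\<^sub>R e) \<bullet> e) = 0"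
    using vector_derivative_unique_within has_real_derivative_iff_has_vector_derivative by blast
  then show ?thesis by (simp add: e_def inner_axis)
qed

text \<open>The divergence theorem on the torus in the form of a balance law. Through
  \<open>weak_balance_lipschitz\<close> it becomes available for Lipschitz functions.\<close>

lemma weak_balance_space_const: "weak_balance T (\<lambda>_. (0, axis j 1)) (\<lambda>_. 0) (\<lambda>_. 0)"
  unfolding weak_balance_def
proof (intro conjI allI impI)
  show "integrable (cylinder T) (\<lambda>_. (0 :: real, axis j 1 :: real^2))"
    by (intro integrable_cylinder_continuous continuous_intros)
  fix F :: "real \<times> (real^2) \<Rightarrow> real" and g
  assume D: "\<forall>z. (F has_derivative (\<lambda>v. g z \<bullet> v)) (at z)" and cont: "continuous_on UNIV g"
    and per: "\<forall>t. periodic (\<lambda>x. F (t, x))"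
  have contg: "continuous_on S (\<lambda>x. g (k x))" if "continuous_on S k" for S and k :: "'c::topological_space \<Rightarrow> _"
    using continuous_on_compose2[OF cont that] by auto
  have "integral (cbox 0 1) (\<lambda>x. snd (g (t, x)) $ j) = 0" for t
  proof (rule integral_cbox_periodic_deriv)
    show "((\<lambda>x. F (t, x)) has_derivative (\<lambda>v. snd (g (t, x)) \<bullet> v)) (at x)" for x
    proof -
      have "((\<lambda>x. (t, x)) has_derivative (\<lambda>v. (0, v))) (at x)"
        by (auto intro!: derivative_eq_intros)
      from has_derivative_compose[OF this D[rule_format]] show ?thesis
        by (simp add: inner_prod_def)
    qed
    show "continuous_on UNIV (\<lambda>x. snd (g (t, x)))" by (intro continuous_intros contg)
    show "F (t, x + axis j 1) = F (t, x)" for x using per by (auto simp: periodic_def)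
  qed
  then have "(\<integral>x. snd (g (t, x)) $ j \<partial>torus) = 0" for t
    by (subst integral_torus_eq) (auto intro!: continuous_intros contg)
  moreover have "(\<integral>z. snd (g z) $ j \<partial>cylinder T)
      = (\<integral>t. (\<integral>x. snd (g (t, x)) $ j \<partial>torus) \<partial>lebesgue_on {0<..<T})"
    by (rule cylinder_fubini(2)) (intro integrable_cylinder_continuous continuous_intros cont)
  ultimately show "(\<integral>z. g z \<bullet> (0, axis j 1) \<partial>cylinder T)
      = (\<integral>z. 0 * F z \<partial>cylinder T) - (\<integral>x. 0 * F (0, x) \<partial>torus)"
    by (simp add: inner_prod_def inner_axis)
qed auto

text \<open>The fundamental theorem of calculus in time, again as a balance law and for the same
  purpose. The initial datum 1 accounts for the boundary term at time 0.\<close>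

lemma weak_balance_time_const:
  assumes "0 < T"
  shows "weak_balance T (\<lambda>_. (1, 0)) (\<lambda>_. 0) (\<lambda>_. 1)"
  unfolding weak_balance_def
proof (intro conjI allI impI)
  show "integrable (cylinder T) (\<lambda>_. (1 :: real, 0 :: real^2))"
    by (intro integrable_cylinder_continuous continuous_intros)
  show "integrable torus (\<lambda>_. 1 :: real)"
    by (intro integrable_torus_continuous continuous_intros)
  fix F :: "real \<times> (real^2) \<Rightarrow> real" and g
  assume D: "\<forall>z. (F has_derivative (\<lambda>v. g z \<bullet> v)) (at z)" and cont: "continuous_on UNIV g"
    and "\<exists>s<T. \<forall>t x. s \<le> t \<longrightarrow> F (t, x) = 0"
  then have F_T: "F (T, x) = 0" for x by auto
  have contF: "continuous_on UNIV F"
    using D by (meson has_derivative_continuous continuous_at_imp_continuous_on)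
  have contF': "continuous_on S (\<lambda>x. F (k x))" if "continuous_on S k" for S and k :: "'c::topological_space \<Rightarrow> _"
    using continuous_on_compose2[OF contF that] by auto
  have contg: "continuous_on S (\<lambda>x. g (k x))" if "continuous_on S k" for S and k :: "'c::topological_space \<Rightarrow> _"
    using continuous_on_compose2[OF cont that] by auto
  define \<Phi> where "\<Phi> t = integral (cbox 0 1) (\<lambda>x. F (t, x))" for t
  define \<Phi>' where "\<Phi>' t = integral (cbox 0 1) (\<lambda>x. fst (g (t, x)))" for t
  have \<Phi>': "(\<Phi> has_field_derivative \<Phi>' t) (at t within UNIV)" for t
    unfolding \<Phi>_def \<Phi>'_def
  proof (rule leibniz_rule_field_derivative)
    fix s :: real and x :: "real^2"
    have "((\<lambda>s. (s, x)) has_derivative (\<lambda>d. (d, 0))) (at s within UNIV)"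
      by (auto intro!: derivative_eq_intros)
    from has_derivative_compose[OF this D[rule_format]]
    show "((\<lambda>s. F (s, x)) has_field_derivative fst (g (s, x))) (at s within UNIV)"
      by (simp add: has_field_derivative_def inner_prod_def)
    show "(\<lambda>x. F (s, x)) integrable_on cbox 0 1"
      by (intro integrable_continuous contF' continuous_intros)
  next
    show "continuous_on (UNIV \<times> cbox 0 1) (\<lambda>(s, x). fst (g (s, x)))"
      unfolding split_beta by (intro continuous_intros contg)
  qed auto
  have "(\<integral>z. fst (g z) \<partial>cylinder T) = (\<integral>t. (\<integral>x. fst (g (t, x)) \<partial>torus) \<partial>lebesgue_on {0<..<T})"
    and i: "integrable (lebesgue_on {0<..<T}) (\<lambda>t. \<integral>x. fst (g (t, x)) \<partial>torus)"
    by (intro cylinder_fubini integrable_cylinder_continuous continuous_intros cont)+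
  moreover have "(\<lambda>t. \<integral>x. fst (g (t, x)) \<partial>torus) = \<Phi>'"
    unfolding \<Phi>'_def by (rule ext) (intro integral_torus_eq continuous_intros contg)
  ultimately have "(\<integral>z. fst (g z) \<partial>cylinder T) = integral {0<..<T} \<Phi>'"
    by (simp add: lebesgue_integral_eq_integral)
  also have "\<dots> = integral {0..T} \<Phi>'"
    by (simp add: integral_open_interval_real)
  also have "\<dots> = \<Phi> T - \<Phi> 0"
    by (rule integral_unique, rule fundamental_theorem_of_calculus)
       (use assms \<Phi>' in \<open>auto simp: has_real_derivative_iff_has_vector_derivative intro: has_vector_derivative_at_within\<close>)
  also have "\<Phi> T = 0" by (simp add: \<Phi>_def F_T)
  also have "\<Phi> 0 = (\<integral>x. F (0, x) \<partial>torus)"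
    unfolding \<Phi>_def by (rule integral_torus_eq[symmetric]) (intro contF' continuous_intros)
  finally show "(\<integral>z. g z \<bullet> (1, 0) \<partial>cylinder T)
      = (\<integral>z. 0 * F z \<partial>cylinder T) - (\<integral>x. 1 * F (0, x) \<partial>torus)"
    by (simp add: inner_prod_def)
qed auto

section \<open>The weak formulation as balance laws\<close>

lemma has_derivative_imp_dt:
  fixes F :: "real \<times> (real^2) \<Rightarrow> 'b::real_normed_vector"
  assumes "(F has_derivative D) (at (t, x))"
  shows "dt (\<lambda>t x. F (t, x)) t x = D (1, 0)"
proof -
  have "((\<lambda>s. (s, x)) has_derivative (\<lambda>d. (d, 0))) (at t)"
    by (auto intro!: derivative_eq_intros)
  from has_derivative_compose[OF this assms]
  have *: "((\<lambda>s. F (s, x)) has_derivative (\<lambda>d. D (d, 0))) (at t)" .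
  have "(\<lambda>d. D (d, 0)) = (\<lambda>d. d *\<^sub>R D (1, 0))"
  proof
    show "D (d, 0) = d *\<^sub>R D (1, 0)" for d
      using linear_scale[OF has_derivative_linear[OF assms], of d "(1, 0)"] by simp
  qed
  from *[unfolded this] show ?thesis
    unfolding dt_def by (intro vector_derivative_at) (simp add: has_vector_derivative_def)
qed

lemma has_derivative_imp_dx:
  fixes F :: "real \<times> (real^2) \<Rightarrow> 'b::real_normed_vector"
  assumes "(F has_derivative D) (at (t, x))"
  shows "dx j (\<lambda>y. F (t, y)) x = D (0, axis j 1)"
proof -
  have "((\<lambda>y. (t, y)) has_derivative (\<lambda>v. (0, v))) (at x)"
    by (auto intro!: derivative_eq_intros)
  from has_derivative_compose[OF this assms]
  have "((\<lambda>y. F (t, y)) has_derivative (\<lambda>v. D (0, v))) (at x)" .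
  from frechet_derivative_at[OF this, symmetric] show ?thesis
    unfolding dx_def by simp
qed

text \<open>The constant vector \<open>c\<close> lets one scalar lemma serve both equations:
  \<open>c\<close> is 1 for the continuity equation and a coordinate vector for one component of the
  momentum equation.\<close>

lemma test_function_C1:
  fixes F :: "real \<times> (real^2) \<Rightarrow> real" and c :: "'b::real_normed_vector"
  assumes D: "\<And>z. (F has_derivative (\<lambda>v. g z \<bullet> v)) (at z)" and cont: "continuous_on UNIV g"
    and per: "\<And>t. periodic (\<lambda>x. F (t, x))" and s: "s < T" and van: "\<And>t x. s \<le> t \<Longrightarrow> F (t, x) = 0"
  shows "test_function T (\<lambda>t x. F (t, x) *\<^sub>R c)"
  unfolding test_function_def
proof (intro conjI ballI)
  show "periodic (\<lambda>x. F (t, x) *\<^sub>R c)" for t using per[of t] by (simp add: periodic_def)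
  show "\<exists>t0<T. \<forall>t x. t0 \<le> t \<longrightarrow> 0 \<le> t \<longrightarrow> t < T \<longrightarrow> F (t, x) *\<^sub>R c = 0"
    by (intro exI[of _ s] conjI allI impI s) (simp only: van scaleR_zero_left)
  show "\<exists>D :: real \<times> (real^2) \<Rightarrow> (real \<times> (real^2)) \<Rightarrow>\<^sub>L 'b.
        continuous_on ({0..<T} \<times> UNIV) D \<and>
        (\<forall>z\<in>{0..<T} \<times> UNIV.
           ((\<lambda>(t, x). F (t, x) *\<^sub>R c) has_derivative blinfun_apply (D z)) (at z within {0..<T} \<times> UNIV))"
  proof (intro exI conjI ballI)
    show "continuous_on ({0..<T} \<times> UNIV) (\<lambda>z. blinfun_scaleR_left c o\<^sub>L blinfun_inner_right (g z))"
      by (intro bounded_bilinear.continuous_on[OF bounded_bilinear_blinfun_compose] continuous_on_const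
            bounded_linear.continuous_on[OF bounded_linear_blinfun_inner_right]
            continuous_on_subset[OF cont subset_UNIV])
    fix z
    have "((\<lambda>z. F z *\<^sub>R c) has_derivative (\<lambda>v. (g z \<bullet> v) *\<^sub>R c)) (at z within {0..<T} \<times> UNIV)"
      by (rule has_derivative_scaleR_left[OF has_derivative_at_withinI[OF D]])
    moreover have "(\<lambda>(t, x). F (t, x) *\<^sub>R c) = (\<lambda>z. F z *\<^sub>R c)" by auto
    moreover have "blinfun_apply (blinfun_scaleR_left c o\<^sub>L blinfun_inner_right (g z)) = (\<lambda>v. (g z \<bullet> v) *\<^sub>R c)"
      by (rule ext) simp
    ultimately show "((\<lambda>(t, x). F (t, x) *\<^sub>R c) has_derivative
        blinfun_apply (blinfun_scaleR_left c o\<^sub>L blinfun_inner_right (g z))) (at z within {0..<T} \<times> UNIV)"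
      by (simp only:)
  qed
qed

lemma gradient_eq_0_beyond:
  fixes F :: "real \<times> (real^2) \<Rightarrow> real"
  assumes D: "(F has_derivative (\<lambda>v. g \<bullet> v)) (at (t, x))" and van: "\<And>t x. s \<le> t \<Longrightarrow> F (t, x) = 0"
    and t: "s < t"
  shows "g = 0"
proof -
  have "((\<lambda>z. 0::real) has_derivative (\<lambda>v. 0 \<bullet> v)) (at (t, x))" by simp
  then have "(F has_derivative (\<lambda>v. 0 \<bullet> v)) (at (t, x))"
    by (rule has_derivative_transform_within_open[where s = "{s<..} \<times> UNIV"])
       (use t van in \<open>simp_all add: open_Times split_paired_all\<close>)
  from gradient_unique[OF D this] show ?thesis .
qed

lemma integral_cylinder_vanishing_beyond:
  fixes f :: "real \<times> (real^2) \<Rightarrow> real"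
  assumes "s \<le> T" "\<And>t x. s \<le> t \<Longrightarrow> f (t, x) = 0"
  shows "integral\<^sup>L (cylinder T) f = integral\<^sup>L (cylinder s) f"
  unfolding cylinder_def
proof (rule lebesgue_on_vanishing_outside)
  fix z :: "real \<times> (real^2)"
  assume "z \<in> {0<..<T} \<times> unit_square - {0<..<s} \<times> unit_square"
  then have "s \<le> fst z" by (cases z) auto
  then show "f z = 0" using assms(2)[of "fst z" "snd z"] by simp
qed (use assms(1) in auto)

text \<open>A test function vanishing before \<open>T'\<close> is also admissible up to
  \<open>T\<close>, and nothing beyond \<open>T'\<close> contributes. The shorter cylinder is the
  one on which the energy bound will supply integrability of \<open>h\<close> and of the momentum
  separately.\<close>

lemma weak_balance_continuity:
  assumes w: "weak_continuity_eq T h0 h u" and T: "T' < T"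
    and int: "integrable (cylinder T') (\<lambda>(t, x). (h t x, h t x *\<^sub>R u t x))" "integrable torus h0"
  shows "weak_balance T' (\<lambda>(t, x). (h t x, h t x *\<^sub>R u t x)) (\<lambda>_. 0) h0"
  unfolding weak_balance_def
proof (intro conjI allI impI int)
  fix F :: "real \<times> (real^2) \<Rightarrow> real" and g
  assume D: "\<forall>z. (F has_derivative (\<lambda>v. g z \<bullet> v)) (at z)" and cont: "continuous_on UNIV g"
    and per: "\<forall>t. periodic (\<lambda>x. F (t, x))" and "\<exists>s<T'. \<forall>t x. s \<le> t \<longrightarrow> F (t, x) = 0"
  then obtain s where s: "s < T'" and van: "\<And>t x. s \<le> t \<Longrightarrow> F (t, x) = 0" by blast
  have D': "(F has_derivative (\<lambda>v. g z \<bullet> v)) (at z)" for z using D by blast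
  have gz: "g (t, x) = 0" if "T' \<le> t" for t x
    by (rule gradient_eq_0_beyond[where s = s, OF D' van]) (use s that in simp_all)
  have test: "test_function T (\<lambda>t x. F (t, x))"
    using test_function_C1[OF D' cont spec[OF per] less_trans[OF s T] van, of "1::real"] by simp
  have key: "h t x * dt (\<lambda>t x. F (t, x)) t x + (h t x *\<^sub>R u t x) \<bullet> grad (\<lambda>x. F (t, x)) x
      = g (t, x) \<bullet> (h t x, h t x *\<^sub>R u t x)" for t x
  proof -
    have "grad (\<lambda>x. F (t, x)) x = snd (g (t, x))"
      unfolding grad_def has_derivative_imp_dx[OF D']
      by (simp add: vec_eq_iff inner_prod_def inner_axis)
    then show ?thesis
      by (simp add: has_derivative_imp_dt[OF D'] inner_prod_def inner_commute)
  qed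
  have I: "(\<lambda>(t, x). h t x * dt (\<lambda>t x. F (t, x)) t x + (h t x *\<^sub>R u t x) \<bullet> grad (\<lambda>x. F (t, x)) x)
      = (\<lambda>z. g z \<bullet> (case z of (t, x) \<Rightarrow> (h t x, h t x *\<^sub>R u t x)))"
    by (rule ext) (simp only: split_beta fst_conv snd_conv prod.collapse key)
  have "(\<integral>z. g z \<bullet> (case z of (t, x) \<Rightarrow> (h t x, h t x *\<^sub>R u t x)) \<partial>cylinder T') =
      (\<integral>z. g z \<bullet> (case z of (t, x) \<Rightarrow> (h t x, h t x *\<^sub>R u t x)) \<partial>cylinder T)"
    by (rule integral_cylinder_vanishing_beyond[symmetric])
       (use T in \<open>simp_all add: gz\<close>)
  also have "\<dots> = - (\<integral>x. h0 x * F (0, x) \<partial>torus)"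
    by (rule w[unfolded weak_continuity_eq_def Let_def, THEN spec, THEN mp, OF test, unfolded I,
          THEN conjunct2, THEN conjunct2])
  finally show "(\<integral>z. g z \<bullet> (case z of (t, x) \<Rightarrow> (h t x, h t x *\<^sub>R u t x)) \<partial>cylinder T')
      = (\<integral>z. 0 * F z \<partial>cylinder T') - (\<integral>x. h0 x * F (0, x) \<partial>torus)"
    by simp
qed auto

text \<open>Row \<open>i\<close> of the momentum equation as a space-time field: the momentum
  component, followed by row \<open>i\<close> of the convective tensor plus pressure.\<close>

definition momentum_flux ::
    "real \<Rightarrow> (real \<Rightarrow> real^2 \<Rightarrow> real) \<Rightarrow> (real \<Rightarrow> real^2 \<Rightarrow> real^2) \<Rightarrow> 2 \<Rightarrow> real \<times> (real^2) \<Rightarrow> real \<times> (real^2)" where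
  "momentum_flux a h u i = (\<lambda>(t, x).
     (h t x * u t x $ i, (h t x * u t x $ i) *\<^sub>R u t x + (a * (h t x)\<^sup>2) *\<^sub>R axis i 1))"

text \<open>The sign is that of friction and force moved to the left-hand side, in agreement with
  \<open>weak_balance\<close>.\<close>

definition momentum_source ::
    "(real^2 \<Rightarrow> real) \<Rightarrow> (real^2 \<Rightarrow> real^2) \<Rightarrow> (real \<Rightarrow> real^2 \<Rightarrow> real) \<Rightarrow> (real \<Rightarrow> real^2 \<Rightarrow> real^2) \<Rightarrow>
     2 \<Rightarrow> real \<times> (real^2) \<Rightarrow> real" where
  "momentum_source \<gamma> f h B i = (\<lambda>(t, x). h t x * (\<gamma> x * B t x $ i - f x $ i))"

text \<open>Testing with a scalar function times the coordinate vector \<open>axis i 1\<close>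
  isolates one component, since only row \<open>i\<close> of the gradient of such a field is
  nonzero.\<close>

lemma weak_balance_momentum:
  assumes w: "weak_momentum_eq T a \<gamma> f h0 u0 h u B" and T: "T' < T"
    and int: "integrable (cylinder T') (momentum_flux a h u i)"
      "integrable (cylinder T') (momentum_source \<gamma> f h B i)" "integrable torus (\<lambda>x. h0 x * u0 x $ i)"
  shows "weak_balance T' (momentum_flux a h u i) (momentum_source \<gamma> f h B i) (\<lambda>x. h0 x * u0 x $ i)"
  unfolding weak_balance_def
proof (intro conjI allI impI int)
  fix F :: "real \<times> (real^2) \<Rightarrow> real" and g
  assume D: "\<forall>z. (F has_derivative (\<lambda>v. g z \<bullet> v)) (at z)" and cont: "continuous_on UNIV g"
    and per: "\<forall>t. periodic (\<lambda>x. F (t, x))" and "\<exists>s<T'. \<forall>t x. s \<le> t \<longrightarrow> F (t, x) = 0"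
  then obtain s where s: "s < T'" and van: "\<And>t x. s \<le> t \<Longrightarrow> F (t, x) = 0" by blast
  have D': "(F has_derivative (\<lambda>v. g z \<bullet> v)) (at z)" for z using D by blast
  define \<Phi> where "\<Phi> t x = F (t, x) *\<^sub>R (axis i 1 :: real^2)" for t x
  have gz: "g (t, x) = 0" if "T' \<le> t" for t x
    by (rule gradient_eq_0_beyond[where s = s, OF D' van]) (use s that in simp_all)
  have test: "test_function T \<Phi>"
    unfolding \<Phi>_def by (rule test_function_C1[OF D' cont spec[OF per] less_trans[OF s T] van])
  have dt: "dt \<Phi> t x = fst (g (t, x)) *\<^sub>R axis i 1" for t x
    using has_derivative_imp_dt[OF has_derivative_scaleR_left[OF D']]
    unfolding \<Phi>_def by (simp add: inner_prod_def)
  have dx: "dx l (\<lambda>y. \<Phi> t y $ k) x = snd (g (t, x)) $ l * axis i 1 $ k" for t x k l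
    using has_derivative_imp_dx[OF has_derivative_mult_left[OF D']]
    unfolding \<Phi>_def by (simp add: inner_prod_def inner_axis)
  have key: "(h t x *\<^sub>R u t x) \<bullet> dt \<Phi> t x + (h t x *\<^sub>R tensor (u t x) (u t x)) \<bullet> vgrad (\<Phi> t) x
        + a * (h t x)\<^sup>2 * dvg (\<Phi> t) x = g (t, x) \<bullet> momentum_flux a h u i (t, x)" for t x
  proof -
    have "tensor (u t x) (u t x) \<bullet> vgrad (\<Phi> t) x
        = (\<Sum>k\<in>UNIV. \<Sum>l\<in>UNIV. (u t x $ k * u t x $ l) * (snd (g (t, x)) $ l * axis i 1 $ k))"
      unfolding inner_vec_def[where 'a = "real^2"] by (simp add: tensor_def vgrad_def dx inner_vec_def)
    also have "\<dots> = (\<Sum>k\<in>UNIV. if k = i then u t x $ i * (u t x \<bullet> snd (g (t, x))) else 0)"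
      by (rule sum.cong) (simp_all add: axis_def inner_vec_def sum_distrib_left mult_ac)
    finally have 1: "tensor (u t x) (u t x) \<bullet> vgrad (\<Phi> t) x = u t x $ i * (u t x \<bullet> snd (g (t, x)))"
      by simp
    have "dvg (\<Phi> t) x = (\<Sum>j\<in>UNIV. if j = i then snd (g (t, x)) $ i else 0)"
      unfolding dvg_def dx by (rule sum.cong) (simp_all add: axis_def)
    then have 2: "dvg (\<Phi> t) x = snd (g (t, x)) $ i" by simp
    have 3: "u t x \<bullet> (fst (g (t, x)) *\<^sub>R axis i 1) = fst (g (t, x)) * u t x $ i"
      by (simp add: inner_axis)
    have "g (t, x) \<bullet> momentum_flux a h u i (t, x) = fst (g (t, x)) * (h t x * u t x $ i)
        + (h t x * u t x $ i) * (u t x \<bullet> snd (g (t, x))) + a * (h t x)\<^sup>2 * snd (g (t, x)) $ i"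
      by (simp add: momentum_flux_def inner_prod_def inner_axis inner_add_right inner_commute[of "snd (g (t, x))"])
    then show ?thesis
      unfolding dt inner_scaleR_left 1 2 3 by (simp add: mult_ac)
  qed
  have I: "(\<lambda>(t, x). (h t x *\<^sub>R u t x) \<bullet> dt \<Phi> t x + (h t x *\<^sub>R tensor (u t x) (u t x)) \<bullet> vgrad (\<Phi> t) x
                     + a * (h t x)\<^sup>2 * dvg (\<Phi> t) x)
      = (\<lambda>z. g z \<bullet> momentum_flux a h u i z)"
    by (rule ext) (simp only: split_beta fst_conv snd_conv prod.collapse key)
  have J: "(\<lambda>(t, x). (h t x *\<^sub>R (\<gamma> x *\<^sub>R B t x - f x)) \<bullet> \<Phi> t x) = (\<lambda>z. momentum_source \<gamma> f h B i z * F z)"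
    by (rule ext) (simp add: \<Phi>_def momentum_source_def inner_axis mult_ac split: prod.split)
  have I0: "(\<lambda>x. (h0 x *\<^sub>R u0 x) \<bullet> \<Phi> 0 x) = (\<lambda>x. h0 x * u0 x $ i * F (0, x))"
    by (rule ext) (simp add: \<Phi>_def inner_axis mult_ac)
  have "(\<integral>z. g z \<bullet> momentum_flux a h u i z \<partial>cylinder T') = (\<integral>z. g z \<bullet> momentum_flux a h u i z \<partial>cylinder T)"
    by (rule integral_cylinder_vanishing_beyond[symmetric])
       (use T in \<open>simp_all add: gz\<close>)
  also have "\<dots> = (\<integral>z. momentum_source \<gamma> f h B i z * F z \<partial>cylinder T) - (\<integral>x. h0 x * u0 x $ i * F (0, x) \<partial>torus)"
    by (rule w[unfolded weak_momentum_eq_def Let_def, THEN spec, THEN mp, OF test, unfolded I J I0,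
          THEN conjunct2, THEN conjunct2, THEN conjunct2])
  also have "(\<integral>z. momentum_source \<gamma> f h B i z * F z \<partial>cylinder T) = (\<integral>z. momentum_source \<gamma> f h B i z * F z \<partial>cylinder T')"
    by (rule integral_cylinder_vanishing_beyond) (use T s van in auto)
  finally show "(\<integral>z. g z \<bullet> momentum_flux a h u i z \<partial>cylinder T')
      = (\<integral>z. momentum_source \<gamma> f h B i z * F z \<partial>cylinder T') - (\<integral>x. h0 x * u0 x $ i * F (0, x) \<partial>torus)" .
qed

section \<open>The energy inequality with a time weight\<close>

lemma integrable_mult_bounded:
  fixes f k :: "'a \<Rightarrow> real"
  assumes f: "integrable M f" and k: "k \<in> borel_measurable M" and le: "AE z in M. \<bar>k z\<bar> \<le> C"
  shows "integrable M (\<lambda>z. k z * f z)"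
proof (rule Bochner_Integration.integrable_bound)
  show "integrable M (\<lambda>z. C * \<bar>f z\<bar>)" using f by simp
  show "(\<lambda>z. k z * f z) \<in> borel_measurable M" using f k by auto
  show "AE z in M. norm (k z * f z) \<le> norm (C * \<bar>f z\<bar>)"
    using le by eventually_elim (auto simp: abs_mult intro!: mult_right_mono)
qed

lemma integrable_cylinder_mult_continuous:
  fixes f k :: "real \<times> (real^2) \<Rightarrow> real"
  assumes f: "integrable (cylinder T) f" and k: "continuous_on ({0..T} \<times> unit_square) k"
  shows "integrable (cylinder T) (\<lambda>z. k z * f z)"
proof -
  have "compact ({0..T} \<times> unit_square)"
    unfolding unit_square_eq_cbox by (intro compact_Times compact_Icc compact_cbox)
  then have "bounded (k ` ({0..T} \<times> unit_square))"
    using k by (intro compact_imp_bounded compact_continuous_image)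
  then obtain C where C: "\<And>z. z \<in> {0..T} \<times> unit_square \<Longrightarrow> norm (k z) \<le> C"
    unfolding bounded_iff by blast
  show ?thesis
  proof (rule integrable_mult_bounded[OF f])
    show "k \<in> borel_measurable (cylinder T)"
      by (intro continuous_on_measurable_cylinder continuous_on_subset[OF k]) auto
    show "AE z in cylinder T. \<bar>k z\<bar> \<le> C"
      by (rule AE_I2) (use C in auto)
  qed
qed

lemma sigma_finite_cylinder: "sigma_finite_measure (cylinder T)"
proof -
  have "{0<..<T} \<times> unit_square \<in> lmeasurable"
  proof (rule bounded_set_imp_lmeasurable)
    have "{0<..<T} \<times> unit_square \<subseteq> cbox (0, 0) (T, 1)"
      unfolding cbox_Pair_eq unit_square_eq_cbox by auto
    then show "bounded ({0<..<T} \<times> unit_square)" by (rule bounded_subset[OF bounded_cbox])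
  qed simp
  from finite_measure_lebesgue_on[OF this] show ?thesis
    unfolding cylinder_def finite_measure_def by blast
qed

text \<open>Integration by parts in time, done by exchanging the order of integration since
  $R$ is merely integrable.\<close>

lemma integral_cylinder_by_parts:
  fixes R :: "real \<times> (real^2) \<Rightarrow> real"
  assumes R: "integrable (cylinder T) R"
    and \<psi>: "\<And>t. (\<psi> has_real_derivative - g t) (at t)" and g: "continuous_on UNIV g"
    and \<psi>T: "\<psi> T = 0"
  shows "integrable (lebesgue_on {0<..<T}) (\<lambda>\<tau>. g \<tau> * integral\<^sup>L (cylinder \<tau>) R)"
    and "(\<integral>\<tau>. g \<tau> * integral\<^sup>L (cylinder \<tau>) R \<partial>lebesgue_on {0<..<T}) = (\<integral>z. \<psi> (fst z) * R z \<partial>cylinder T)"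
proof -
  interpret C: sigma_finite_measure "cylinder T" by (rule sigma_finite_cylinder)
  interpret P: pair_sigma_finite lborel "cylinder T" ..
  define G where "G \<tau> = indicator {0<..<T} \<tau> * g \<tau>" for \<tau>
  \<comment> \<open>\<open>k\<close> is to be integrated in both orders: over space-time first it
    gives \<open>g \<tau>\<close> times the integral of \<open>R\<close> up to time
    \<open>\<tau>\<close>; over \<open>\<tau>\<close> first it gives \<open>R\<close> times the
    integral of \<open>g\<close> from the time of \<open>z\<close> to \<open>T\<close>, which is the
    value of \<open>\<psi>\<close> there because \<open>\<psi> T = 0\<close>.\<close>
  define k where "k \<tau> z = G \<tau> * ((if fst z < \<tau> then 1 else 0) * R z)" for \<tau> :: real and z :: "real \<times> (real^2)"
  have [measurable]: "g \<in> borel_measurable borel" using g by (rule borel_measurable_continuous_onI)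
  have [measurable]: "G \<in> borel_measurable borel" unfolding G_def by measurable
  have Rm [measurable]: "R \<in> borel_measurable (cylinder T)" using R by auto
  have fm [measurable]: "fst \<in> borel_measurable (cylinder T)"
    by (intro continuous_on_measurable_cylinder continuous_intros)
  have Gi: "integrable lborel (\<lambda>\<tau>. norm (G \<tau>))"
  proof -
    have "set_integrable lborel {0..T} g"
      by (rule borel_integrable_atLeastAtMost') (rule continuous_on_subset[OF g subset_UNIV])
    then have "set_integrable lborel {0<..<T} g" by (rule set_integrable_subset) auto
    then show ?thesis unfolding set_integrable_def G_def by (intro integrable_norm) simp
  qed
  have km: "case_prod k \<in> borel_measurable (lborel \<Otimes>\<^sub>M cylinder T)"
    unfolding k_def split_beta by measurable
  have "integrable (lborel \<Otimes>\<^sub>M cylinder T) (case_prod (\<lambda>\<tau> z. norm (G \<tau>) * norm (R z)))"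
    by (rule P.Fubini_integrable) (use R Gi in \<open>auto simp: abs_mult\<close>)
  then have ki: "integrable (lborel \<Otimes>\<^sub>M cylinder T) (case_prod k)"
    by (rule Bochner_Integration.integrable_bound[OF _ km])
       (auto simp: k_def abs_mult intro!: AE_I2 mult_left_mono)
  have inner1: "(\<integral>z. k \<tau> z \<partial>cylinder T) = (if \<tau> \<in> {0<..<T} then g \<tau> * integral\<^sup>L (cylinder \<tau>) R else 0)" for \<tau>
  proof (cases "\<tau> \<in> {0<..<T}")
    case True
    have "(\<integral>z. (if fst z < \<tau> then 1 else 0) * R z \<partial>cylinder T)
        = (\<integral>z. (if fst z < \<tau> then 1 else 0) * R z \<partial>cylinder \<tau>)"
      by (rule integral_cylinder_vanishing_beyond) (use True in auto)
    also have "\<dots> = integral\<^sup>L (cylinder \<tau>) R"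
      by (rule Bochner_Integration.integral_cong) auto
    finally show ?thesis using True by (simp add: k_def G_def)
  qed (auto simp: k_def G_def)
  have inner2: "(\<integral>\<tau>. k \<tau> z \<partial>lborel) = \<psi> (fst z) * R z" if "z \<in> space (cylinder T)" for z
  proof -
    have t: "0 < fst z" "fst z < T" using that by auto
    have "(\<integral>\<tau>. G \<tau> * (if fst z < \<tau> then 1 else 0) \<partial>lborel) = (\<integral>\<tau>. indicator {fst z..T} \<tau> *\<^sub>R g \<tau> \<partial>lborel)"
    proof (rule integral_cong_AE)
      \<comment> \<open>The two integrands can differ only at the endpoints of the interval.\<close>
      show "AE \<tau> in lborel. G \<tau> * (if fst z < \<tau> then 1 else 0) = indicator {fst z..T} \<tau> *\<^sub>R g \<tau>"
        using AE_lborel_singleton[of "fst z"] AE_lborel_singleton[of T]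
        by eventually_elim (use t in \<open>auto simp: G_def indicator_def\<close>)
    qed measurable
    also have "\<dots> = - \<psi> T - - \<psi> (fst z)"
    proof (rule integral_FTC_atLeastAtMost)
      show "((\<lambda>t. - \<psi> t) has_vector_derivative g x) (at x within {fst z..T})" for x
        using DERIV_minus[OF \<psi>[of x]]
        by (simp add: has_real_derivative_iff_has_vector_derivative has_vector_derivative_at_within)
    qed (use t continuous_on_subset[OF g] in auto)
    finally have *: "(\<integral>\<tau>. G \<tau> * (if fst z < \<tau> then 1 else 0) \<partial>lborel) = \<psi> (fst z)"
      using \<psi>T by simp
    have "(\<integral>\<tau>. k \<tau> z \<partial>lborel) = (\<integral>\<tau>. (G \<tau> * (if fst z < \<tau> then 1 else 0)) * R z \<partial>lborel)"
      by (simp add: k_def mult.assoc)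
    also have "\<dots> = \<psi> (fst z) * R z"
      by (simp only: integral_mult_left_zero *)
    finally show ?thesis .
  qed
  have c: "(\<lambda>\<tau>. \<integral>z. k \<tau> z \<partial>cylinder T) \<in> borel_measurable borel"
    using P.integrable_fst[OF ki] by auto
  note r = integrable_lebesgue_on_cong_borel[of "{0<..<T}", OF _ c, of "\<lambda>\<tau>. g \<tau> * integral\<^sup>L (cylinder \<tau>) R"]
  show "integrable (lebesgue_on {0<..<T}) (\<lambda>\<tau>. g \<tau> * integral\<^sup>L (cylinder \<tau>) R)"
    by (subst r(1)) (use P.integrable_fst[OF ki] in \<open>auto simp: inner1\<close>)
  have "(\<integral>\<tau>. g \<tau> * integral\<^sup>L (cylinder \<tau>) R \<partial>lebesgue_on {0<..<T}) = (\<integral>\<tau>. \<integral>z. k \<tau> z \<partial>cylinder T \<partial>lborel)"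
    by (rule r(2)) (auto simp: inner1)
  also have "\<dots> = (\<integral>z. \<integral>\<tau>. k \<tau> z \<partial>lborel \<partial>cylinder T)"
    by (rule P.Fubini_integral[OF ki, symmetric])
  also have "\<dots> = (\<integral>z. \<psi> (fst z) * R z \<partial>cylinder T)"
    by (rule Bochner_Integration.integral_cong[OF refl inner2])
  finally show "(\<integral>\<tau>. g \<tau> * integral\<^sup>L (cylinder \<tau>) R \<partial>lebesgue_on {0<..<T}) = (\<integral>z. \<psi> (fst z) * R z \<partial>cylinder T)" .
qed

text \<open>Multiplying by \<open>g\<close>, which is nonnegative, and integrating over time turns
  an inequality valid at almost every time into one between space-time integrals. In this form it
  can be added to the weak balances tested with multiples of \<open>\<psi>\<close>. The right-hand
  side uses that \<open>g\<close> has integral \<open>\<psi> 0\<close>.\<close>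

lemma weighted_time_inequality:
  fixes E R :: "real \<times> (real^2) \<Rightarrow> real"
  assumes T: "0 < T" and E: "integrable (cylinder T) E" and R: "integrable (cylinder T) R"
    and \<psi>: "\<And>t. (\<psi> has_real_derivative - g t) (at t)" and g: "continuous_on UNIV g" "\<And>t. 0 \<le> g t"
    and \<psi>T: "\<psi> T = 0"
    and le: "AE \<tau> in lebesgue_on {0<..<T}. (\<integral>x. E (\<tau>, x) \<partial>torus) + integral\<^sup>L (cylinder \<tau>) R \<le> K"
  shows "integrable (cylinder T) (\<lambda>z. g (fst z) * E z)" "integrable (cylinder T) (\<lambda>z. \<psi> (fst z) * R z)"
    and "(\<integral>z. g (fst z) * E z \<partial>cylinder T) + (\<integral>z. \<psi> (fst z) * R z \<partial>cylinder T) \<le> \<psi> 0 * K"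
proof -
  have g': "continuous_on S (\<lambda>z. g (fst z))" for S :: "(real \<times> (real^2)) set"
    by (rule continuous_on_compose2[OF g(1)]) (auto intro: continuous_intros)
  show gE: "integrable (cylinder T) (\<lambda>z. g (fst z) * E z)"
    by (rule integrable_cylinder_mult_continuous[OF E g'])
  have \<psi>c: "continuous_on UNIV \<psi>"
    using \<psi> by (meson DERIV_isCont continuous_at_imp_continuous_on)
  have \<psi>': "continuous_on S (\<lambda>z. \<psi> (fst z))" for S :: "(real \<times> (real^2)) set"
    by (rule continuous_on_compose2[OF \<psi>c]) (auto intro: continuous_intros)
  show "integrable (cylinder T) (\<lambda>z. \<psi> (fst z) * R z)"
    by (rule integrable_cylinder_mult_continuous[OF R \<psi>'])
  note parts = integral_cylinder_by_parts[OF R \<psi> g(1) \<psi>T]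
  note fub = cylinder_fubini[OF gE]
  have gi: "integrable (lebesgue_on {0<..<T}) g"
    by (rule integrable_lebesgue_on_subset[where S = "{0..T}"])
       (auto intro!: continuous_imp_integrable_real continuous_on_subset[OF g(1)])
  have "(\<integral>z. g (fst z) * E z \<partial>cylinder T) + (\<integral>z. \<psi> (fst z) * R z \<partial>cylinder T)
      = (\<integral>\<tau>. (\<integral>x. g \<tau> * E (\<tau>, x) \<partial>torus) + g \<tau> * integral\<^sup>L (cylinder \<tau>) R \<partial>lebesgue_on {0<..<T})"
    using fub parts by simp
  also have "\<dots> \<le> (\<integral>\<tau>. g \<tau> * K \<partial>lebesgue_on {0<..<T})"
  proof (rule integral_mono_AE)
    show "integrable (lebesgue_on {0<..<T}) (\<lambda>\<tau>. (\<integral>x. g \<tau> * E (\<tau>, x) \<partial>torus) + g \<tau> * integral\<^sup>L (cylinder \<tau>) R)"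
      using fub parts by simp
    show "integrable (lebesgue_on {0<..<T}) (\<lambda>\<tau>. g \<tau> * K)" using gi by simp
    show "AE \<tau> in lebesgue_on {0<..<T}. (\<integral>x. g \<tau> * E (\<tau>, x) \<partial>torus) + g \<tau> * integral\<^sup>L (cylinder \<tau>) R \<le> g \<tau> * K"
      using le
    proof eventually_elim
      case (elim \<tau>)
      show ?case using mult_left_mono[OF elim g(2)[of \<tau>]] by (simp add: distrib_left)
    qed
  qed
  also have "\<dots> = (\<integral>\<tau>. g \<tau> \<partial>lebesgue_on {0<..<T}) * K" by simp
  also have "(\<integral>\<tau>. g \<tau> \<partial>lebesgue_on {0<..<T}) = integral {0..T} g"
    by (subst lebesgue_integral_eq_integral[OF gi]) (auto simp: integral_open_interval_real)
  also have "\<dots> = - \<psi> T - - \<psi> 0"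
  proof (rule integral_unique, rule fundamental_theorem_of_calculus)
    show "((\<lambda>t. - \<psi> t) has_vector_derivative g x) (at x within {0..T})" for x
      using DERIV_minus[OF \<psi>[of x]]
      by (simp add: has_real_derivative_iff_has_vector_derivative has_vector_derivative_at_within)
  qed (use T in auto)
  finally show "(\<integral>z. g (fst z) * E z \<partial>cylinder T) + (\<integral>z. \<psi> (fst z) * R z \<partial>cylinder T) \<le> \<psi> 0 * K"
    using \<psi>T by simp
qed

lemma energy_density_nonneg: "0 \<le> a \<Longrightarrow> 0 \<le> \<eta> \<Longrightarrow> 0 \<le> energy_density a \<eta> v"
  by (simp add: energy_density_def)

lemma measurable_energy_density:
  assumes "(\<lambda>(t, x). h t x) \<in> borel_measurable (cylinder T)" "(\<lambda>(t, x). u t x) \<in> borel_measurable (cylinder T)"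
  shows "(\<lambda>(t, x). energy_density a (h t x) (u t x)) \<in> borel_measurable (cylinder T)"
proof -
  have "(\<lambda>z. 1/2 * (case z of (t, x) \<Rightarrow> h t x) * (norm (case z of (t, x) \<Rightarrow> u t x))\<^sup>2
      + a * (case z of (t, x) \<Rightarrow> h t x)\<^sup>2) \<in> borel_measurable (cylinder T)"
    using assms by measurable
  moreover have "(\<lambda>z. 1/2 * (case z of (t, x) \<Rightarrow> h t x) * (norm (case z of (t, x) \<Rightarrow> u t x))\<^sup>2
      + a * (case z of (t, x) \<Rightarrow> h t x)\<^sup>2) = (\<lambda>(t, x). energy_density a (h t x) (u t x))"
    by (auto simp: energy_density_def fun_eq_iff)
  ultimately show ?thesis by simp
qed

text \<open>Work and dissipation are integrable up to some admissible time after \<open>T'\<close>,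
  hence on the cylinder up to \<open>T'\<close>. The inequality then bounds the energy of almost all
  slices by one constant, and Tonelli's theorem gives integrability in space-time.\<close>

lemma energy_inequality_integrable:
  assumes en: "energy_inequality T a \<gamma> f h0 u0 h u B" and a: "0 < a"
    and h: "(\<lambda>(t, x). h t x) \<in> borel_measurable (cylinder T)"
    and u: "(\<lambda>(t, x). u t x) \<in> borel_measurable (cylinder T)"
    and nn: "AE (t, x) in cylinder T. 0 \<le> h t x" and T': "0 < T'" "T' < T"
  shows "integrable (cylinder T') (\<lambda>(t, x). energy_density a (h t x) (u t x))"
    and "integrable torus (\<lambda>x. energy_density a (h0 x) (u0 x))"
    and "integrable (cylinder T') (\<lambda>(t, x). h t x * \<gamma> x * (B t x \<bullet> u t x))"
    and "integrable (cylinder T') (\<lambda>(t, x). h t x * (f x \<bullet> u t x))"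
    and "AE \<tau> in lebesgue_on {0<..<T'}. (\<integral>x. energy_density a (h \<tau> x) (u \<tau> x) \<partial>torus)
      + (\<integral>z. (case z of (t, x) \<Rightarrow> h t x * \<gamma> x * (B t x \<bullet> u t x) - h t x * (f x \<bullet> u t x)) \<partial>cylinder \<tau>)
      \<le> (\<integral>x. energy_density a (h0 x) (u0 x) \<partial>torus)"
proof -
  define D where "D = (\<lambda>(t, x). h t x * \<gamma> x * (B t x \<bullet> u t x))"
  define W where "W = (\<lambda>(t, x). h t x * (f x \<bullet> u t x))"
  define E where "E \<tau> x = energy_density a (h \<tau> x) (u \<tau> x)" for \<tau> x
  define E0 where "E0 x = energy_density a (h0 x) (u0 x)" for x
  have "AE \<tau> in lebesgue_on {0<..<T}. integrable torus (E \<tau>) \<and> integrable torus E0 \<and>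
      integrable (cylinder \<tau>) D \<and> integrable (cylinder \<tau>) W \<and>
      integral\<^sup>L torus (E \<tau>) + integral\<^sup>L (cylinder \<tau>) D \<le> integral\<^sup>L torus E0 + integral\<^sup>L (cylinder \<tau>) W"
    using en unfolding energy_inequality_def D_def W_def E_def E0_def Let_def .
  then have ae: "AE \<tau> in lborel. \<tau> \<in> {0<..<T} \<longrightarrow> integrable torus (E \<tau>) \<and> integrable torus E0 \<and>
      integrable (cylinder \<tau>) D \<and> integrable (cylinder \<tau>) W \<and>
      integral\<^sup>L torus (E \<tau>) + integral\<^sup>L (cylinder \<tau>) D \<le> integral\<^sup>L torus E0 + integral\<^sup>L (cylinder \<tau>) W"
    by (subst (asm) AE_lebesgue_on_iff) auto
  \<comment> \<open>The admissible times have full measure, while the interval from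
    \<open>T'\<close> to \<open>T\<close> has positive length, so they cannot all avoid it.\<close>
  have "\<exists>\<tau>. T' < \<tau> \<and> \<tau> < T \<and> integrable torus E0 \<and> integrable (cylinder \<tau>) D \<and> integrable (cylinder \<tau>) W"
  proof (rule ccontr)
    assume no: "\<not> ?thesis"
    have "AE \<tau> in lborel. \<tau> \<notin> {T'<..<T}"
      using ae by eventually_elim (use no T' in auto)
    then have "{T'<..<T} \<in> null_sets lborel" by (simp add: AE_iff_null_sets)
    then have "emeasure lborel {T'<..<T} = 0" by blast
    then show False using T' by simp
  qed
  then obtain \<tau>1 where \<tau>1: "T' < \<tau>1" and E0i: "integrable torus E0"
    and i1: "integrable (cylinder \<tau>1) D" "integrable (cylinder \<tau>1) W" by blast
  have Di: "integrable (cylinder \<tau>) D" and Wi: "integrable (cylinder \<tau>) W" if "\<tau> \<le> T'" for \<tau>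
    using integrable_cylinder_mono[OF i1(1), of \<tau>] integrable_cylinder_mono[OF i1(2), of \<tau>] that \<tau>1 by auto
  have "AE \<tau> in lebesgue_on {0<..<T'}. integrable torus (E \<tau>) \<and>
      integral\<^sup>L torus (E \<tau>) + integral\<^sup>L (cylinder \<tau>) (\<lambda>z. D z - W z) \<le> integral\<^sup>L torus E0"
  proof (subst AE_lebesgue_on_iff)
    show "AE \<tau> in lborel. \<tau> \<in> {0<..<T'} \<longrightarrow> integrable torus (E \<tau>) \<and>
      integral\<^sup>L torus (E \<tau>) + integral\<^sup>L (cylinder \<tau>) (\<lambda>z. D z - W z) \<le> integral\<^sup>L torus E0"
      using ae
    proof eventually_elim
      case (elim \<tau>)
      show ?case
      proof
        assume "\<tau> \<in> {0<..<T'}"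
        then show "integrable torus (E \<tau>) \<and>
          integral\<^sup>L torus (E \<tau>) + integral\<^sup>L (cylinder \<tau>) (\<lambda>z. D z - W z) \<le> integral\<^sup>L torus E0"
          using elim Di[of \<tau>] Wi[of \<tau>] T' by auto
      qed
    qed
  qed simp
  note main = this
  have DW: "(\<lambda>z. D z - W z) = (\<lambda>z. (case z of (t, x) \<Rightarrow> h t x * \<gamma> x * (B t x \<bullet> u t x) - h t x * (f x \<bullet> u t x)))"
    by (auto simp: D_def W_def)
  show "AE \<tau> in lebesgue_on {0<..<T'}. (\<integral>x. energy_density a (h \<tau> x) (u \<tau> x) \<partial>torus)
      + (\<integral>z. (case z of (t, x) \<Rightarrow> h t x * \<gamma> x * (B t x \<bullet> u t x) - h t x * (f x \<bullet> u t x)) \<partial>cylinder \<tau>)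
      \<le> (\<integral>x. energy_density a (h0 x) (u0 x) \<partial>torus)"
    using main unfolding DW E_def E0_def by eventually_elim blast
  show "integrable torus (\<lambda>x. energy_density a (h0 x) (u0 x))"
    using E0i unfolding E0_def .
  show "integrable (cylinder T') (\<lambda>(t, x). h t x * \<gamma> x * (B t x \<bullet> u t x))"
    using Di[of T'] unfolding D_def by simp
  show "integrable (cylinder T') (\<lambda>(t, x). h t x * (f x \<bullet> u t x))"
    using Wi[of T'] unfolding W_def by simp
  \<comment> \<open>The work and dissipation up to a variable time are replaced by the integral of
    their absolute difference up to \<open>T'\<close>, so that the bound is independent of the time
    slice.\<close>
  define K where "K = integral\<^sup>L torus E0 + (\<integral>z. norm (D z - W z) \<partial>cylinder T')"
  have iDW: "integrable (cylinder T') (\<lambda>z. D z - W z)" using Di Wi by simp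
  have le_norm: "- integral\<^sup>L (cylinder \<tau>) (\<lambda>z. D z - W z) \<le> (\<integral>z. norm (D z - W z) \<partial>cylinder T')"
    if "\<tau> \<le> T'" for \<tau>
  proof -
    have "- integral\<^sup>L (cylinder \<tau>) (\<lambda>z. D z - W z) \<le> norm (integral\<^sup>L (cylinder \<tau>) (\<lambda>z. D z - W z))" by simp
    also have "\<dots> \<le> (\<integral>z. norm (D z - W z) \<partial>cylinder \<tau>)" by (rule integral_norm_bound)
    also have "\<dots> \<le> (\<integral>z. norm (D z - W z) \<partial>cylinder T')"
      unfolding cylinder_def
      by (rule integral_mono_lebesgue_on_AE)
         (use iDW that in \<open>auto simp: cylinder_def\<close>)
    finally show ?thesis .
  qed
  show "integrable (cylinder T') (\<lambda>(t, x). energy_density a (h t x) (u t x))"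
    unfolding cylinder_def
  proof (rule integrable_lebesgue_on_Times_nonneg)
    show "(\<lambda>(t, x). energy_density a (h t x) (u t x)) \<in> borel_measurable (lebesgue_on ({0<..<T'} \<times> unit_square))"
      using measurable_cylinder_mono[OF measurable_energy_density[OF h u]] T' unfolding cylinder_def by simp
    show "AE z in lebesgue_on ({0<..<T'} \<times> unit_square). 0 \<le> (case z of (t, x) \<Rightarrow> energy_density a (h t x) (u t x))"
      using AE_cylinder_mono[OF nn, of T'] T' unfolding cylinder_def
      by (auto elim!: eventually_mono intro!: energy_density_nonneg simp: a less_imp_le)
    show "AE \<tau> in lebesgue_on {0<..<T'}.
        integrable (lebesgue_on unit_square) (\<lambda>x. case (\<tau>, x) of (t, x) \<Rightarrow> energy_density a (h t x) (u t x)) \<and>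
        (\<integral>x. (case (\<tau>, x) of (t, x) \<Rightarrow> energy_density a (h t x) (u t x)) \<partial>lebesgue_on unit_square) \<le> K"
      using main AE_space
    proof eventually_elim
      case (elim \<tau>)
      then have "integral\<^sup>L torus (E \<tau>) \<le> K" using le_norm[of \<tau>] by (auto simp: K_def)
      then show ?case using elim by (simp add: E_def[abs_def] torus_def)
    qed
  qed (auto simp: bounded_set_imp_lmeasurable)
qed

section \<open>Weighted Lipschitz test functions\<close>

lemma periodic_int_shift:
  assumes "periodic F"
  shows "F (x + of_int k *\<^sub>R axis i 1) = F x"
proof (induction k arbitrary: x rule: int_induct[where k = 0])
  case base
  show ?case by simp
next
  case (step1 k)
  have "F (x + of_int (k + 1) *\<^sub>R axis i 1) = F ((x + of_int k *\<^sub>R axis i 1) + axis i 1)"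
    by (simp add: algebra_simps)
  then show ?case using assms step1 by (simp add: periodic_def)
next
  case (step2 k)
  have "F (x + of_int (k - 1) *\<^sub>R axis i 1) = F ((x + of_int (k - 1) *\<^sub>R axis i 1) + axis i 1)"
    using assms by (simp add: periodic_def)
  also have "\<dots> = F (x + of_int k *\<^sub>R axis i 1)" by (simp add: algebra_simps)
  finally show ?case using step2 by simp
qed

lemma periodic_unit_square:
  assumes "periodic F"
  shows "\<exists>y\<in>unit_square. F x = F y"
proof
  define y :: "real^2" where "y = (\<chi> i. frac (x $ i))"
  have "x = (y + of_int \<lfloor>x $ 1\<rfloor> *\<^sub>R axis 1 1) + of_int \<lfloor>x $ 2\<rfloor> *\<^sub>R axis 2 1"
    by (simp add: vec_eq_iff forall_2 y_def frac_def axis_def)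
  then show "F x = F y" by (metis periodic_int_shift[OF assms])
  show "y \<in> unit_square"
    by (simp add: unit_square_def y_def frac_lt_1 less_imp_le)
qed

text \<open>Boundedness is recorded because products of Lipschitz functions stay Lipschitz only with
  it; \<open>periodic_lipschitzI\<close> obtains it from periodicity and compactness of the unit
  square.\<close>

definition periodic_lipschitz :: "real \<Rightarrow> (real \<times> (real^2) \<Rightarrow> real) \<Rightarrow> bool" where
  "periodic_lipschitz T F \<longleftrightarrow>
     (\<exists>L. L-lipschitz_on ({0..T} \<times> UNIV) F) \<and>
     (\<exists>M. \<forall>z\<in>{0..T} \<times> UNIV. \<bar>F z\<bar> \<le> M) \<and>
     (\<forall>t\<in>{0..T}. periodic (\<lambda>x. F (t, x)))"

lemma periodic_lipschitzI:
  assumes L: "L-lipschitz_on ({0..T} \<times> UNIV) F" and per: "\<And>t. t \<in> {0..T} \<Longrightarrow> periodic (\<lambda>x. F (t, x))"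
  shows "periodic_lipschitz T F"
proof -
  have "compact ({0..T} \<times> unit_square)"
    unfolding unit_square_eq_cbox by (intro compact_Times compact_Icc compact_cbox)
  moreover have "continuous_on ({0..T} \<times> unit_square) F"
    using lipschitz_on_continuous_on[OF L] by (rule continuous_on_subset) auto
  ultimately have "bounded (F ` ({0..T} \<times> unit_square))"
    by (intro compact_imp_bounded compact_continuous_image)
  then obtain M where M: "\<And>z. z \<in> {0..T} \<times> unit_square \<Longrightarrow> \<bar>F z\<bar> \<le> M"
    unfolding bounded_iff real_norm_def by blast
  have "\<bar>F (t, x)\<bar> \<le> M" if "t \<in> {0..T}" for t x
    using periodic_unit_square[OF per[OF that], of x] M[of "(t, _)"] that by auto
  then show ?thesis unfolding periodic_lipschitz_def using L per by fast
qed

lemma periodic_lipschitz_continuous_on: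
  "periodic_lipschitz T F \<Longrightarrow> continuous_on ({0..T} \<times> UNIV) F"
  unfolding periodic_lipschitz_def using lipschitz_on_continuous_on by blast

lemma periodic_lipschitz_mono:
  assumes "periodic_lipschitz T F" "T' \<le> T"
  shows "periodic_lipschitz T' F"
proof -
  obtain L where L: "L-lipschitz_on ({0..T} \<times> UNIV) F"
    using assms(1) unfolding periodic_lipschitz_def by blast
  show ?thesis
  proof (rule periodic_lipschitzI)
    show "L-lipschitz_on ({0..T'} \<times> UNIV) F"
      by (rule lipschitz_on_subset[OF L]) (use assms(2) in auto)
    show "periodic (\<lambda>x. F (t, x))" if "t \<in> {0..T'}" for t
    proof -
      have "t \<in> {0..T}" using that assms(2) by simp
      with assms(1) show ?thesis unfolding periodic_lipschitz_def by blast
    qed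
  qed
qed

lemma periodic_lipschitz_const [intro]: "periodic_lipschitz T (\<lambda>_. c)"
proof (rule periodic_lipschitzI)
  show "0-lipschitz_on ({0..T} \<times> UNIV) (\<lambda>_. c)" by (rule lipschitz_onI) simp_all
qed (simp add: periodic_def)

lemma periodic_lipschitz_add [intro]:
  assumes F: "periodic_lipschitz T F" and G: "periodic_lipschitz T G"
  shows "periodic_lipschitz T (\<lambda>z. F z + G z)"
proof -
  obtain L K where L: "L-lipschitz_on ({0..T} \<times> UNIV) F" "K-lipschitz_on ({0..T} \<times> UNIV) G"
    using F G unfolding periodic_lipschitz_def by blast
  show ?thesis
    by (rule periodic_lipschitzI[OF lipschitz_on_add[OF L]])
       (use F G in \<open>auto simp: periodic_lipschitz_def periodic_def\<close>)
qed

lemma periodic_lipschitz_mult [intro]: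
  assumes F: "periodic_lipschitz T F" and G: "periodic_lipschitz T G"
  shows "periodic_lipschitz T (\<lambda>z. F z * G z)"
proof (cases "0 \<le> T")
  case True
  obtain L K where L: "L-lipschitz_on ({0..T} \<times> UNIV) F" and K: "K-lipschitz_on ({0..T} \<times> UNIV) G"
    using F G unfolding periodic_lipschitz_def by blast
  obtain M N where M: "\<And>z. z \<in> {0..T} \<times> UNIV \<Longrightarrow> \<bar>F z\<bar> \<le> M" and N: "\<And>z. z \<in> {0..T} \<times> UNIV \<Longrightarrow> \<bar>G z\<bar> \<le> N"
    using F G unfolding periodic_lipschitz_def by blast
  have MN: "0 \<le> M" "0 \<le> N"
    using M[of "(0, 0)"] N[of "(0, 0)"] True by auto
  have "(M * K + N * L)-lipschitz_on ({0..T} \<times> UNIV) (\<lambda>z. F z * G z)"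
  proof (rule lipschitz_onI)
    fix y z :: "real \<times> (real^2)" assume yz: "y \<in> {0..T} \<times> UNIV" "z \<in> {0..T} \<times> UNIV"
    have "\<bar>F y * G y - F z * G z\<bar> = \<bar>F y * (G y - G z) + G z * (F y - F z)\<bar>"
      by (simp add: algebra_simps)
    also have "\<dots> \<le> \<bar>F y\<bar> * \<bar>G y - G z\<bar> + \<bar>G z\<bar> * \<bar>F y - F z\<bar>"
      by (metis abs_mult abs_triangle_ineq)
    also have "\<dots> \<le> M * (K * dist y z) + N * (L * dist y z)"
      using lipschitz_onD[OF L yz] lipschitz_onD[OF K yz] M[OF yz(1)] N[OF yz(2)] MN
      by (intro add_mono mult_mono) (auto simp: dist_real_def)
    finally show "dist (F y * G y) (F z * G z) \<le> (M * K + N * L) * dist y z"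
      by (simp add: dist_real_def algebra_simps)
  qed (use MN lipschitz_on_nonneg[OF L] lipschitz_on_nonneg[OF K] in simp)
  then show ?thesis
    by (rule periodic_lipschitzI) (use F G in \<open>auto simp: periodic_lipschitz_def periodic_def\<close>)
next
  case False
  then show ?thesis
    by (intro periodic_lipschitzI[where L = 0] lipschitz_onI) auto
qed

lemma periodic_lipschitz_sum [intro]:
  assumes "\<And>i. i \<in> I \<Longrightarrow> periodic_lipschitz T (F i)"
  shows "periodic_lipschitz T (\<lambda>z. \<Sum>i\<in>I. F i z)"
  using assms by (induction I rule: infinite_finite_induct) auto

lemma periodic_lipschitz_time:
  assumes \<psi>: "\<And>t. (\<psi> has_real_derivative - g t) (at t)" and g: "continuous_on UNIV g"
  shows "periodic_lipschitz T (\<lambda>z. \<psi> (fst z))"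
proof -
  have "bounded (g ` {0..T})"
    by (intro compact_imp_bounded compact_continuous_image continuous_on_subset[OF g]) auto
  then obtain M where M: "\<And>t. t \<in> {0..T} \<Longrightarrow> \<bar>g t\<bar> \<le> M"
    unfolding bounded_iff real_norm_def by blast
  have "(max 0 M)-lipschitz_on ({0..T} \<times> UNIV) (\<lambda>z :: real \<times> (real^2). \<psi> (fst z))"
  proof (rule lipschitz_onI)
    fix y z :: "real \<times> (real^2)" assume yz: "y \<in> {0..T} \<times> UNIV" "z \<in> {0..T} \<times> UNIV"
    have "norm (\<psi> (fst y) - \<psi> (fst z)) \<le> max 0 M * norm (fst y - fst z)"
    proof (rule field_differentiable_bound)
      show "convex {0..T}" by simp
      show "(\<psi> has_field_derivative - g x) (at x within {0..T})" for x
        using \<psi>[of x] by (rule has_field_derivative_at_within)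
      show "norm (- g x) \<le> max 0 M" if "x \<in> {0..T}" for x using M[OF that] by simp
    qed (use yz in auto)
    also have "\<dots> \<le> max 0 M * dist y z"
      using dist_fst_le[of y z] by (intro mult_left_mono) (auto simp: dist_norm)
    finally show "dist (\<psi> (fst y)) (\<psi> (fst z)) \<le> max 0 M * dist y z" by (simp add: dist_norm)
  qed simp
  then show ?thesis by (rule periodic_lipschitzI) (simp add: periodic_def)
qed

text \<open>A function on $[0,T]$ is extended to all times by freezing it outside of the interval,
  which keeps it Lipschitz and makes it accessible to the mollifier.\<close>

lemma weak_balance_weighted:
  fixes \<phi> :: "real \<times> (real^2) \<Rightarrow> real"
  assumes bal: "weak_balance T V J J0" and s: "s < T" and T: "0 < T"
    and \<psi>: "\<And>t. (\<psi> has_real_derivative - g t) (at t)" and g: "continuous_on UNIV g"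
    and van: "\<And>t. s \<le> t \<Longrightarrow> \<psi> t = 0"
    and \<phi>: "periodic_lipschitz T \<phi>"
    and G: "AE z in cylinder T. (\<phi> has_derivative (\<lambda>v. G z \<bullet> v)) (at z)"
  shows "integrable (cylinder T) (\<lambda>z. - g (fst z) * \<phi> z * fst (V z) + \<psi> (fst z) * (G z \<bullet> V z))" (is "integrable _ ?I")
    and "integrable (cylinder T) (\<lambda>z. J z * (\<psi> (fst z) * \<phi> z))"
    and "integrable torus (\<lambda>x. J0 x * (\<psi> 0 * \<phi> (0, x)))"
    and "(\<integral>z. - g (fst z) * \<phi> z * fst (V z) + \<psi> (fst z) * (G z \<bullet> V z) \<partial>cylinder T)
          = (\<integral>z. J z * (\<psi> (fst z) * \<phi> z) \<partial>cylinder T) - (\<integral>x. J0 x * (\<psi> 0 * \<phi> (0, x)) \<partial>torus)"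
proof -
  define c where "c = (\<lambda>z :: real \<times> (real^2). (max 0 (min T (fst z)), snd z))"
  define F where "F z = \<psi> (fst (c z)) * \<phi> (c z)" for z
  have P: "periodic_lipschitz T (\<lambda>z. \<psi> (fst z) * \<phi> z)"
    using periodic_lipschitz_time[OF \<psi> g] \<phi> by (rule periodic_lipschitz_mult)
  then obtain L where L: "L-lipschitz_on ({0..T} \<times> UNIV) (\<lambda>z. \<psi> (fst z) * \<phi> z)"
    unfolding periodic_lipschitz_def by blast
  have "1-lipschitz_on UNIV c"
  proof (rule lipschitz_onI)
    fix y z :: "real \<times> (real^2)"
    have "dist (max 0 (min T (fst y))) (max 0 (min T (fst z))) \<le> dist (fst y) (fst z)"
      by (auto simp: dist_real_def max_def min_def)
    then show "dist (c y) (c z) \<le> 1 * dist y z"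
      unfolding c_def dist_prod_def by (auto intro!: real_sqrt_le_mono add_mono power_mono)
  qed simp
  moreover have "c ` UNIV \<subseteq> {0..T} \<times> UNIV" using T by (auto simp: c_def)
  ultimately have LF: "(L * 1)-lipschitz_on UNIV F"
    unfolding F_def using lipschitz_on_compose2[of 1 UNIV c L "\<lambda>z. \<psi> (fst z) * \<phi> z"]
      lipschitz_on_subset[OF L] by blast
  have per: "periodic (\<lambda>x. F (t, x))" for t
  proof -
    have "max 0 (min T t) \<in> {0..T}" using T by auto
    with P have "periodic (\<lambda>x. \<psi> (max 0 (min T t)) * \<phi> (max 0 (min T t), x))"
      unfolding periodic_lipschitz_def fst_conv by blast
    then show ?thesis by (simp add: F_def c_def)
  qed
  have vanF: "F (t, x) = 0" if "s \<le> t" for t x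
  proof -
    have "s \<le> max 0 (min T t)" using that s by auto
    then show ?thesis unfolding F_def c_def fst_conv by (simp only: van mult_zero_left)
  qed
  have eqF: "F z = \<psi> (fst z) * \<phi> z" if "0 \<le> fst z" "fst z \<le> T" for z
  proof -
    have "c z = z" using that by (auto simp: c_def prod_eq_iff)
    then show ?thesis by (simp add: F_def)
  qed
  define GF where "GF z = (- g (fst z) * \<phi> z) *\<^sub>R (1, 0) + \<psi> (fst z) *\<^sub>R G z" for z
  have D: "AE z in cylinder T. (F has_derivative (\<lambda>v. GF z \<bullet> v)) (at z)"
    using G AE_space
  proof eventually_elim
    case (elim z)
    have "((\<lambda>z. \<psi> (fst z)) has_derivative (\<lambda>v. - g (fst z) * fst v)) (at z)"
      using has_derivative_compose[OF has_derivative_fst[OF has_derivative_ident] \<psi>[unfolded has_field_derivative_def]]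
      by simp
    from has_derivative_mult[OF this elim(1)]
    have "((\<lambda>z. \<psi> (fst z) * \<phi> z) has_derivative (\<lambda>v. GF z \<bullet> v)) (at z)"
      by (rule has_derivative_eq_rhs)
         (simp add: GF_def fun_eq_iff inner_add_left inner_prod_def algebra_simps)
    \<comment> \<open>For times in the open interval the freezing is the identity, so the product
      rule for the unfrozen function also computes the gradient of \<open>F\<close>.\<close>
    then show ?case
    proof (rule has_derivative_transform_within_open)
      show "open ({0<..<T} \<times> (UNIV :: (real^2) set))" by (intro open_Times) auto
      show "z \<in> {0<..<T} \<times> UNIV" using elim(2) by auto
      show "\<psi> (fst y) * \<phi> y = F y" if "y \<in> {0<..<T} \<times> UNIV" for y
        using that eqF[of y] by auto
    qed
  qed
  note W = weak_balance_lipschitz[OF bal s T LF per _ D]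
  have W1: "integrable (cylinder T) (\<lambda>z. GF z \<bullet> V z)" by (rule W(1)) (rule vanF)
  have W2: "integrable (cylinder T) (\<lambda>z. J z * F z)" by (rule W(2)) (rule vanF)
  have W3: "integrable torus (\<lambda>x. J0 x * F (0, x))" by (rule W(3)) (rule vanF)
  have W4: "(\<integral>z. GF z \<bullet> V z \<partial>cylinder T)
      = (\<integral>z. J z * F z \<partial>cylinder T) - (\<integral>x. J0 x * F (0, x) \<partial>torus)"
    by (rule W(4)) (rule vanF)
  have 1: "GF z \<bullet> V z = - g (fst z) * \<phi> z * fst (V z) + \<psi> (fst z) * (G z \<bullet> V z)" for z
    by (simp add: GF_def inner_add_left inner_prod_def algebra_simps)
  have 2: "F (0, x) = \<psi> 0 * \<phi> (0, x)" for x using eqF[of "(0, x)"] T by simp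
  have 3: "J z * F z = J z * (\<psi> (fst z) * \<phi> z)" if "z \<in> space (cylinder T)" for z
    using that eqF[of z] by auto
  show "integrable (cylinder T) ?I" using W1 by (simp only: 1)
  show "integrable (cylinder T) (\<lambda>z. J z * (\<psi> (fst z) * \<phi> z))"
    by (rule iffD1[OF Bochner_Integration.integrable_cong[OF refl 3] W2])
  show "integrable torus (\<lambda>x. J0 x * (\<psi> 0 * \<phi> (0, x)))" using W3 by (simp only: 2)
  show "integral\<^sup>L (cylinder T) ?I
          = (\<integral>z. J z * (\<psi> (fst z) * \<phi> z) \<partial>cylinder T) - (\<integral>x. J0 x * (\<psi> 0 * \<phi> (0, x)) \<partial>torus)"
    using W4 Bochner_Integration.integral_cong[OF refl, of "cylinder T" "\<lambda>z. J z * F z", OF 3]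
    by (simp only: 1 2)
qed

text \<open>A small step from \<open>z\<close> in the direction of \<open>g\<close> itself changes
  \<open>F\<close> at rate |g| up to an arbitrarily small error, while the Lipschitz condition
  allows at most the rate \<open>L\<close>.\<close>

lemma norm_gradient_le_lipschitz:
  fixes F :: "'a::euclidean_space \<Rightarrow> real"
  assumes L: "L-lipschitz_on S F" and S: "open S" "z \<in> S" and D: "(F has_derivative (\<lambda>v. g \<bullet> v)) (at z)"
  shows "norm g \<le> L"
proof (rule field_le_epsilon)
  fix e :: real assume e: "0 < e"
  obtain d where d: "d > 0" "\<And>y. norm (y - z) < d \<Longrightarrow> norm (F y - F z - g \<bullet> (y - z)) \<le> e * norm (y - z)"
    using D e unfolding has_derivative_at_alt by blast
  obtain r where r: "r > 0" "ball z r \<subseteq> S" using S openE by blast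
  show "norm g \<le> L + e"
  proof (cases "g = 0")
    case True
    then show ?thesis using e lipschitz_on_nonneg[OF L] by simp
  next
    case False
    define k where "k = min d r / 2 / norm g"
    have k: "k > 0" using False d(1) r(1) by (simp add: k_def)
    have kn: "k * norm g = min d r / 2" using False by (simp add: k_def)
    define y where "y = z + k *\<^sub>R g"
    have ny: "norm (y - z) = k * norm g" using k by (simp add: y_def)
    have "norm (y - z) < d" "y \<in> S"
      using ny kn d(1) r by (auto simp: dist_norm norm_minus_commute intro!: subsetD[OF r(2)])
    then have "\<bar>F y - F z - g \<bullet> (y - z)\<bar> \<le> e * (k * norm g)" "\<bar>F y - F z\<bar> \<le> L * (k * norm g)"
      using d(2)[of y] lipschitz_onD[OF L _ S(2), of y] ny by (auto simp: dist_norm)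
    then have "g \<bullet> (y - z) \<le> (L + e) * (k * norm g)" by (simp add: algebra_simps abs_le_iff)
    moreover have "g \<bullet> (y - z) = norm g * (k * norm g)"
      by (simp add: y_def power2_norm_eq_inner[symmetric] power2_eq_square)
    moreover have "0 < k * norm g" using k False by simp
    ultimately show ?thesis by (metis mult_le_cancel_right_pos)
  qed
qed

lemma differentiable_imp_gradient:
  fixes F :: "'a::euclidean_space \<Rightarrow> real"
  assumes "F differentiable (at z)"
  obtains g where "(F has_derivative (\<lambda>v. g \<bullet> v)) (at z)"
proof -
  obtain D where D: "(F has_derivative D) (at z)" using assms unfolding differentiable_def by blast
  have "D v = (\<Sum>b\<in>Basis. D b *\<^sub>R b) \<bullet> v" for v
  proof -
    have "D v = D (\<Sum>b\<in>Basis. (v \<bullet> b) *\<^sub>R b)" by (simp add: euclidean_representation)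
    also have "\<dots> = (\<Sum>b\<in>Basis. (v \<bullet> b) *\<^sub>R D b)"
      using has_derivative_linear[OF D] by (simp add: linear_sum linear_scale)
    finally show ?thesis by (simp add: inner_sum_left inner_commute[of v] mult.commute)
  qed
  with D show ?thesis using that by (metis (no_types) ext)
qed

section \<open>The relative energy\<close>

text \<open>Both selections are subgradients of the norm: B.u = |u| and b.U = |U|, with |B| and |b|
  at most 1. The Cauchy-Schwarz inequality bounds the mixed products B.U and b.u by |U| and |u|.
  Vectors of the unit ball chosen where the velocity is zero are included.\<close>

lemma friction_monotone:
  fixes u U B b :: "'a::real_inner"
  assumes "u \<noteq> 0 \<longrightarrow> B = (1 / norm u) *\<^sub>R u" "u = 0 \<longrightarrow> B \<in> cball 0 1"
    and "U \<noteq> 0 \<longrightarrow> b = (1 / norm U) *\<^sub>R U" "U = 0 \<longrightarrow> b \<in> cball 0 1"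
  shows "0 \<le> (B - b) \<bullet> (u - U)"
proof -
  have le: "norm B \<le> 1" "norm b \<le> 1"
    using assms by (cases "u = 0"; cases "U = 0"; simp)+
  have eq: "B \<bullet> u = norm u" "b \<bullet> U = norm U"
    using assms by (cases "u = 0"; cases "U = 0"; simp add: dot_square_norm power2_eq_square)+
  have "B \<bullet> U \<le> norm U" "b \<bullet> u \<le> norm u"
    using norm_cauchy_schwarz[of B U] norm_cauchy_schwarz[of b u] le
      mult_right_mono[OF le(1), of "norm U"] mult_right_mono[OF le(2), of "norm u"] by simp_all
  then show ?thesis using eq by (simp add: inner_diff_left inner_diff_right)
qed

text \<open>The integrand of the relative energy balance at a point, with $p = \psi$, $g = -\psi'$,
  partial derivatives of the strong solution written as \<open>Ht\<close>, \<open>Hx i\<close>, \<open>Ut i\<close> and \<open>Ux i j\<close>,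
  and \<open>b\<close>, \<open>B\<close> the friction selections of the strong and the weak solution.\<close>

lemma relative_energy_pointwise:
  fixes a p g L h H Ht \<gamma> :: real and u U B b f Hx Ut :: "2 \<Rightarrow> real" and Ux :: "2 \<Rightarrow> 2 \<Rightarrow> real"
  assumes a: "0 < a" and h: "0 \<le> h" and H: "0 < H" and p: "0 \<le> p" and \<gamma>: "0 \<le> \<gamma>"
    and bound: "\<And>i j. \<bar>Ux i j\<bar> \<le> L"
    and mono: "0 \<le> (\<Sum>i\<in>UNIV. (B i - b i) * (u i - U i))"
    and cont: "Ht + (\<Sum>j\<in>UNIV. Hx j * U j + H * Ux j j) = 0"
    and mom: "\<And>i. Ht * U i + H * Ut i + (\<Sum>j\<in>UNIV. Hx j * (U i * U j) + H * (Ux i j * U j + U i * Ux j j))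
        + 2 * a * H * Hx i = H * (- (\<gamma> * b i) + f i)"
  defines "\<phi> \<equiv> (\<Sum>i\<in>UNIV. (U i)\<^sup>2) / 2 - 2 * a * H"
  defines "P \<equiv> g * (1 / 2 * h * (\<Sum>i\<in>UNIV. (u i)\<^sup>2) + a * h\<^sup>2)
      + p * (h * \<gamma> * (\<Sum>i\<in>UNIV. B i * u i) - h * (\<Sum>i\<in>UNIV. f i * u i))
      - (- g * \<phi> * h + p * ((\<Sum>i\<in>UNIV. U i * Ut i) * h - 2 * a * Ht * h
          + (\<Sum>j\<in>UNIV. ((\<Sum>i\<in>UNIV. U i * Ux i j) - 2 * a * Hx j) * (h * u j))))
      + (\<Sum>i\<in>UNIV. - g * U i * (h * u i)
          + p * (Ut i * (h * u i) + (\<Sum>j\<in>UNIV. Ux i j * (h * u i * u j)) + Ux i i * (a * h\<^sup>2))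
          - h * (\<gamma> * B i - f i) * (p * U i))
      - (- g * (a * H\<^sup>2) + p * (2 * a * H * Ht))
      - (\<Sum>j\<in>UNIV. p * (2 * a * H * U j * Hx j + a * H\<^sup>2 * Ux j j))"
  shows "(g - 4 * L * p) * (1 / 2 * h * (\<Sum>i\<in>UNIV. (u i - U i)\<^sup>2) + a * (h - H)\<^sup>2) \<le> P"
proof -
  note [simp] = sum_2
  have Ht: "Ht = - (\<Sum>j\<in>UNIV. Hx j * U j + H * Ux j j)" using cont by simp
  \<comment> \<open>Subtracting \<open>U i\<close> times the continuity equation leaves an equation
    with the common factor \<open>H\<close>, which is cancelled since \<open>H\<close> is
    positive.\<close>
  have Ut: "Ut i = - (\<gamma> * b i) + f i - (\<Sum>j\<in>UNIV. Ux i j * U j) - 2 * a * Hx i" for i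
  proof -
    have "H * Ut i = H * (- (\<gamma> * b i) + f i - (\<Sum>j\<in>UNIV. Ux i j * U j) - 2 * a * Hx i)"
      using mom[of i] unfolding Ht by (simp add: algebra_simps)
    then show ?thesis using H by simp
  qed
  \<comment> \<open>What survives after \<open>Ht\<close> and \<open>Ut\<close> are eliminated:
    friction, a quadratic form in the velocity difference, and the pressure remainder. The force
    cancels, and the terms with \<open>g\<close> assemble into the relative energy.\<close>
  define R where "R = - h * \<gamma> * (\<Sum>i\<in>UNIV. (B i - b i) * (u i - U i))
      - h * (\<Sum>i\<in>UNIV. \<Sum>j\<in>UNIV. (u i - U i) * Ux i j * (u j - U j))
      - a * (\<Sum>j\<in>UNIV. Ux j j) * (h - H)\<^sup>2"
  have P: "P = g * (1 / 2 * h * (\<Sum>i\<in>UNIV. (u i - U i)\<^sup>2) + a * (h - H)\<^sup>2) - p * R"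
    unfolding P_def R_def \<phi>_def Ut Ht by (simp add: field_simps power2_eq_square)
  have L: "0 \<le> L" using bound[of 1 1] by linarith
  \<comment> \<open>Young's inequality. Used for each of the four entries of the velocity gradient,
    it produces the factor 2L in the quadratic form.\<close>
  have q: "- (v * w * z) \<le> L * (v\<^sup>2 + z\<^sup>2) / 2" if "\<bar>w\<bar> \<le> L" for v w z :: real
  proof -
    have "- (v * w * z) \<le> \<bar>w\<bar> * \<bar>v * z\<bar>"
      by (metis abs_ge_minus_self abs_mult mult.assoc mult.commute)
    also have "\<dots> \<le> L * ((v\<^sup>2 + z\<^sup>2) / 2)"
    proof (rule mult_mono)
      have "0 \<le> (\<bar>v\<bar> - \<bar>z\<bar>)\<^sup>2" by simp
      then show "\<bar>v * z\<bar> \<le> (v\<^sup>2 + z\<^sup>2) / 2" by (simp add: power2_diff abs_mult)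
    qed (use that L in auto)
    finally show ?thesis by simp
  qed
  define D where "D = (\<Sum>i\<in>UNIV. (u i - U i)\<^sup>2)"
  have "- (\<Sum>i\<in>UNIV. \<Sum>j\<in>UNIV. (u i - U i) * Ux i j * (u j - U j)) \<le> 2 * L * D"
    using q[OF bound[of 1 1], of "u 1 - U 1" "u 1 - U 1"] q[OF bound[of 1 2], of "u 1 - U 1" "u 2 - U 2"]
      q[OF bound[of 2 1], of "u 2 - U 2" "u 1 - U 1"] q[OF bound[of 2 2], of "u 2 - U 2" "u 2 - U 2"]
    by (simp add: D_def algebra_simps)
  from mult_left_mono[OF this h]
  have 1: "- h * (\<Sum>i\<in>UNIV. \<Sum>j\<in>UNIV. (u i - U i) * Ux i j * (u j - U j)) \<le> 2 * L * (h * D)"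
    by (simp only: mult_minus_left mult_minus_right mult_ac)
  have "- (\<Sum>j\<in>UNIV. Ux j j) \<le> 2 * L"
    using bound[of 1 1] bound[of 2 2] by (simp add: abs_le_iff)
  then have "- (\<Sum>j\<in>UNIV. Ux j j) * (a * (h - H)\<^sup>2) \<le> 2 * L * (a * (h - H)\<^sup>2)"
    by (rule mult_right_mono) (use a in simp)
  moreover have "- a * (\<Sum>j\<in>UNIV. Ux j j) * (h - H)\<^sup>2 = - (\<Sum>j\<in>UNIV. Ux j j) * (a * (h - H)\<^sup>2)"
    by (simp del: sum_2)
  ultimately have 2: "- a * (\<Sum>j\<in>UNIV. Ux j j) * (h - H)\<^sup>2 \<le> 2 * L * (a * (h - H)\<^sup>2)"
    by (simp only:)
  have 3: "- h * \<gamma> * (\<Sum>i\<in>UNIV. (B i - b i) * (u i - U i)) \<le> 0"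
    using mult_nonneg_nonneg[OF mult_nonneg_nonneg[OF h \<gamma>] mono] by simp
  have 4: "0 \<le> L * (a * (h - H)\<^sup>2)" using L a by simp
  \<comment> \<open>The bound 2L h D equals 4L times h D / 2, the kinetic part of the relative
    energy; for the pressure part 2L would do, and 4L is taken to have one common factor.\<close>
  have "R \<le> 4 * L * (1 / 2 * h * D + a * (h - H)\<^sup>2)"
    using 1 2 3 4 unfolding R_def by (simp add: algebra_simps del: sum_2)
  from mult_left_mono[OF this p] show ?thesis
    unfolding P D_def[symmetric] by (simp add: algebra_simps del: sum_2)
qed

text \<open>The product rule brings the equations into the form in which
  \<open>relative_energy_pointwise\<close> expects them, with the derivatives of \<open>H\<close>
  and of each component of \<open>U\<close> separated.\<close>

lemma strong_equations_componentwise: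
  fixes H :: "real \<Rightarrow> real^2 \<Rightarrow> real" and U :: "real \<Rightarrow> real^2 \<Rightarrow> real^2"
  assumes dH: "((\<lambda>z. H (fst z) (snd z)) has_derivative (\<lambda>v. gH \<bullet> v)) (at (t, x))"
    and dU: "\<And>i. ((\<lambda>z. U (fst z) (snd z) $ i) has_derivative (\<lambda>v. gU i \<bullet> v)) (at (t, x))"
    and cont: "dt H t x + dvg (\<lambda>y. H t y *\<^sub>R U t y) x = 0"
    and mom: "dt (\<lambda>s y. H s y *\<^sub>R U s y) t x
          + tensor_dvg (\<lambda>y. H t y *\<^sub>R tensor (U t y) (U t y)) x
          + grad (\<lambda>y. a * (H t y)\<^sup>2) x
          = H t x *\<^sub>R (- (\<gamma> x *\<^sub>R B t x) + f x)"
  shows "fst gH + (\<Sum>j\<in>UNIV. snd gH $ j * U t x $ j + H t x * snd (gU j) $ j) = 0"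
    and "fst gH * U t x $ i + H t x * fst (gU i)
        + (\<Sum>j\<in>UNIV. snd gH $ j * (U t x $ i * U t x $ j)
            + H t x * (snd (gU i) $ j * U t x $ j + U t x $ i * snd (gU j) $ j))
        + 2 * a * H t x * snd gH $ i = H t x * (- (\<gamma> x * B t x $ i) + f x $ i)"
proof -
  have e1: "g \<bullet> (1, 0) = fst g" and e2: "g \<bullet> (0, axis j 1) = snd g $ j" for g :: "real \<times> (real^2)" and j
    by (simp_all add: inner_prod_def inner_axis)
  have dHU: "((\<lambda>z. H (fst z) (snd z) * U (fst z) (snd z) $ i) has_derivative
      (\<lambda>v. H t x * (gU i \<bullet> v) + gH \<bullet> v * U t x $ i)) (at (t, x))" for i
    using has_derivative_mult[OF dH dU[of i]] by simp
  have "((\<lambda>z. \<chi> i. H (fst z) (snd z) * U (fst z) (snd z) $ i) has_derivative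
      (\<lambda>v. \<chi> i. H t x * (gU i \<bullet> v) + gH \<bullet> v * U t x $ i)) (at (t, x))"
    by (subst has_derivative_componentwise_within) (auto simp: Basis_vec_def inner_axis intro: dHU)
  moreover have "(\<lambda>z. \<chi> i. H (fst z) (snd z) * U (fst z) (snd z) $ i) = (\<lambda>z. H (fst z) (snd z) *\<^sub>R U (fst z) (snd z))"
    by (simp add: fun_eq_iff vec_eq_iff)
  ultimately have dHUv: "((\<lambda>z. H (fst z) (snd z) *\<^sub>R U (fst z) (snd z)) has_derivative
      (\<lambda>v. \<chi> i. H t x * (gU i \<bullet> v) + gH \<bullet> v * U t x $ i)) (at (t, x))" by simp
  have dHUU: "((\<lambda>z. H (fst z) (snd z) * (U (fst z) (snd z) $ i * U (fst z) (snd z) $ j)) has_derivative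
      (\<lambda>v. H t x * (U t x $ i * (gU j \<bullet> v) + gU i \<bullet> v * U t x $ j) + gH \<bullet> v * (U t x $ i * U t x $ j))) (at (t, x))" for i j
    using has_derivative_mult[OF dH has_derivative_mult[OF dU[of i] dU[of j]]] by simp
  have dHH: "((\<lambda>z. a * (H (fst z) (snd z))\<^sup>2) has_derivative (\<lambda>v. 2 * a * H t x * (gH \<bullet> v))) (at (t, x))"
    using has_derivative_mult_right[OF has_derivative_mult[OF dH dH], of a]
    by (simp add: power2_eq_square algebra_simps)
  have 1: "dt H t x = fst gH"
    using has_derivative_imp_dt[OF dH] by (simp add: e1)
  have 2: "dvg (\<lambda>y. H t y *\<^sub>R U t y) x = (\<Sum>j\<in>UNIV. snd gH $ j * U t x $ j + H t x * snd (gU j) $ j)"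
    unfolding dvg_def using has_derivative_imp_dx[OF dHU] by (simp add: e2 add.commute)
  show "fst gH + (\<Sum>j\<in>UNIV. snd gH $ j * U t x $ j + H t x * snd (gU j) $ j) = 0"
    using cont unfolding 1 2 .
  have 3: "dt (\<lambda>s y. H s y *\<^sub>R U s y) t x $ i = fst gH * U t x $ i + H t x * fst (gU i)"
    using has_derivative_imp_dt[OF dHUv] by (simp add: e1 add.commute)
  have 4: "tensor_dvg (\<lambda>y. H t y *\<^sub>R tensor (U t y) (U t y)) x $ i
      = (\<Sum>j\<in>UNIV. snd gH $ j * (U t x $ i * U t x $ j)
            + H t x * (snd (gU i) $ j * U t x $ j + U t x $ i * snd (gU j) $ j))"
    unfolding tensor_dvg_def dvg_def tensor_def using has_derivative_imp_dx[OF dHUU]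
    by (simp add: e2 add.commute)
  have 5: "grad (\<lambda>y. a * (H t y)\<^sup>2) x $ i = 2 * a * H t x * snd gH $ i"
    unfolding grad_def using has_derivative_imp_dx[OF dHH] by (simp add: e2)
  have "(dt (\<lambda>s y. H s y *\<^sub>R U s y) t x
          + tensor_dvg (\<lambda>y. H t y *\<^sub>R tensor (U t y) (U t y)) x
          + grad (\<lambda>y. a * (H t y)\<^sup>2) x) $ i = (H t x *\<^sub>R (- (\<gamma> x *\<^sub>R B t x) + f x)) $ i"
    by (simp only: mom)
  then show "fst gH * U t x $ i + H t x * fst (gU i)
        + (\<Sum>j\<in>UNIV. snd gH $ j * (U t x $ i * U t x $ j)
            + H t x * (snd (gU i) $ j * U t x $ j + U t x $ i * snd (gU j) $ j))
        + 2 * a * H t x * snd gH $ i = H t x * (- (\<gamma> x * B t x $ i) + f x $ i)"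
    by (simp only: vector_add_component vector_scaleR_component vector_uminus_component 3 4 5 real_scaleR_def)
qed

lemma Ck_continuous_on: "Ck k F \<Longrightarrow> continuous_on UNIV F"
  by (cases k) (auto intro: differentiable_imp_continuous_on simp: differentiable_on_def differentiable_at_withinI)

lemma borel_measurable_vec_nth_comp:
  fixes f :: "'a \<Rightarrow> real^2"
  assumes "f \<in> borel_measurable M"
  shows "(\<lambda>z. f z $ i) \<in> borel_measurable M"
proof -
  have "(\<lambda>z. f z \<bullet> axis i 1) \<in> borel_measurable M" using assms by auto
  then show ?thesis by (simp add: inner_axis)
qed

lemma integrable_Pair:
  fixes f :: "'a \<Rightarrow> 'b::euclidean_space" and g :: "'a \<Rightarrow> 'c::euclidean_space"
  assumes "integrable M f" "integrable M g"
  shows "integrable M (\<lambda>z. (f z, g z))"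
proof (rule Bochner_Integration.integrable_bound)
  show "integrable M (\<lambda>z. norm (f z) + norm (g z))" using assms by auto
  show "(\<lambda>z. (f z, g z)) \<in> borel_measurable M" using assms by (intro borel_measurable_Pair) auto
  show "AE z in M. norm (f z, g z) \<le> norm (norm (f z) + norm (g z))"
    by (rule AE_I2) (simp add: norm_Pair_le)
qed

text \<open>Meant for the initial data, which are only known to agree almost everywhere with
  continuous functions; completeness of the measure supplies their measurability.\<close>

lemma integrable_torus_AE_continuous:
  fixes f g :: "real^2 \<Rightarrow> real"
  assumes g: "continuous_on UNIV g" and eq: "AE x in torus. f x = g x"
  shows "integrable torus f"
proof -
  have gi: "integrable torus g" by (rule integrable_torus_continuous[OF g])
  have eq': "AE x in torus. g x = f x" using eq by eventually_elim simp
  have "f \<in> borel_measurable torus"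
    using borel_measurable_lebesgue_on_AE[of g unit_square f] gi eq' unfolding torus_def by auto
  then show ?thesis by (rule integrable_cong_AE_imp[OF gi _ eq'])
qed

text \<open>The energy controls h^2 and h|u|^2. On a domain of finite measure the lower-order
  quantities follow from h <= 1 + h^2 and |u| <= 1 + |u|^2, multiplied by h in the second
  case.\<close>

lemma momentum_integrable:
  fixes h :: "real \<times> (real^2) \<Rightarrow> real" and u :: "real \<times> (real^2) \<Rightarrow> real^2"
  assumes a: "0 < a" and hm [measurable]: "h \<in> borel_measurable (cylinder T)"
    and um [measurable]: "u \<in> borel_measurable (cylinder T)"
    and nn: "AE z in cylinder T. 0 \<le> h z"
    and E: "integrable (cylinder T) (\<lambda>z. energy_density a (h z) (u z))"
  shows "integrable (cylinder T) h" "integrable (cylinder T) (\<lambda>z. (h z)\<^sup>2)"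
    "integrable (cylinder T) (\<lambda>z. h z *\<^sub>R u z)" "integrable (cylinder T) (\<lambda>z. h z * u z $ i)"
    "integrable (cylinder T) (\<lambda>z. (h z * u z $ i) *\<^sub>R u z)"
proof -
  have comp [measurable]: "(\<lambda>z. u z $ i) \<in> borel_measurable (cylinder T)" for i
    by (rule borel_measurable_vec_nth_comp[OF um])
  show h2: "integrable (cylinder T) (\<lambda>z. (h z)\<^sup>2)"
  proof (rule Bochner_Integration.integrable_bound)
    show "integrable (cylinder T) (\<lambda>z. energy_density a (h z) (u z) / a)" using E by simp
    show "AE z in cylinder T. norm ((h z)\<^sup>2) \<le> norm (energy_density a (h z) (u z) / a)"
      using nn by eventually_elim (use a in \<open>simp add: energy_density_def field_simps\<close>)
  qed measurable
  have hu2: "integrable (cylinder T) (\<lambda>z. h z * (norm (u z))\<^sup>2)"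
  proof (rule Bochner_Integration.integrable_bound)
    show "integrable (cylinder T) (\<lambda>z. 2 * energy_density a (h z) (u z))" using E by simp
    show "AE z in cylinder T. norm (h z * (norm (u z))\<^sup>2) \<le> norm (2 * energy_density a (h z) (u z))"
      using nn by eventually_elim (use a in \<open>simp add: energy_density_def abs_mult\<close>)
  qed measurable
  have one: "integrable (cylinder T) (\<lambda>_. 1 :: real)"
    by (intro integrable_cylinder_continuous continuous_on_const)
  show h1: "integrable (cylinder T) h"
  proof (rule Bochner_Integration.integrable_bound)
    show "integrable (cylinder T) (\<lambda>z. 1 + (h z)\<^sup>2)" using one h2 by simp
    show "AE z in cylinder T. norm (h z) \<le> norm (1 + (h z)\<^sup>2)"
      using nn
    proof eventually_elim
      case (elim z)
      have "0 \<le> (h z - 1)\<^sup>2" by simp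
      then have "2 * h z \<le> 1 + (h z)\<^sup>2" by (simp add: power2_diff)
      with elim show ?case by simp
    qed
  qed (rule hm)
  show "integrable (cylinder T) (\<lambda>z. h z *\<^sub>R u z)"
  proof (rule Bochner_Integration.integrable_bound)
    show "integrable (cylinder T) (\<lambda>z. h z + h z * (norm (u z))\<^sup>2)" using h1 hu2 by simp
    show "AE z in cylinder T. norm (h z *\<^sub>R u z) \<le> norm (h z + h z * (norm (u z))\<^sup>2)"
      using nn
    proof eventually_elim
      case (elim z)
      have "0 \<le> (norm (u z) - 1)\<^sup>2" by simp
      then have "2 * norm (u z) \<le> 1 + (norm (u z))\<^sup>2" by (simp add: power2_diff)
      then have "norm (u z) \<le> 1 + (norm (u z))\<^sup>2" using norm_ge_zero[of "u z"] by linarith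
      from mult_left_mono[OF this elim] elim show ?case by (simp add: distrib_left)
    qed
  qed measurable
  then have "integrable (cylinder T) (\<lambda>z. (h z *\<^sub>R u z) \<bullet> axis i 1)" by (rule integrable_inner_left)
  then show "integrable (cylinder T) (\<lambda>z. h z * u z $ i)" by (simp add: inner_axis)
  show "integrable (cylinder T) (\<lambda>z. (h z * u z $ i) *\<^sub>R u z)"
  proof (rule Bochner_Integration.integrable_bound[OF hu2])
    show "AE z in cylinder T. norm ((h z * u z $ i) *\<^sub>R u z) \<le> norm (h z * (norm (u z))\<^sup>2)"
      using nn
    proof eventually_elim
      case (elim z)
      have "\<bar>u z $ i\<bar> * norm (u z) \<le> norm (u z) * norm (u z)"
        by (intro mult_right_mono component_le_norm_cart) simp
      from mult_left_mono[OF this elim] elim show ?case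
        by (simp add: abs_mult power2_eq_square mult.assoc)
    qed
  qed measurable
qed

text \<open>Three times are involved: the weight vanishes from \<open>s\<close> on, all integrals
  are taken up to \<open>T'\<close>, and \<open>T\<close> is the lifespan. The gap between
  \<open>s\<close> and \<open>T'\<close> accommodates mollification, the gap between
  \<open>T'\<close> and \<open>T\<close> guarantees integrability.\<close>

lemma relative_energy_uniqueness:
  fixes T T' s a :: real
    and \<gamma> :: "real^2 \<Rightarrow> real" and f :: "real^2 \<Rightarrow> real^2"
    and h0 :: "real^2 \<Rightarrow> real" and u0 :: "real^2 \<Rightarrow> real^2"
    and h H :: "real \<Rightarrow> real^2 \<Rightarrow> real"
    and u U B b :: "real \<Rightarrow> real^2 \<Rightarrow> real^2"
  assumes T: "0 < s" "s < T'" "T' < T" and a: "a > 0"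
    and \<gamma>: "continuous_on UNIV \<gamma>" "\<And>x. \<gamma> x \<ge> 0"
    and f: "continuous_on UNIV f"
    and diss: "dissipative_weak_solution T a \<gamma> f h0 u0 h u B"
    and strong: "strong_solution T a \<gamma> f H U b"
    and Hpos: "\<And>t x. t \<in> {0..T} \<Longrightarrow> H t x > 0"
    and h0: "AE x in torus. h0 x = H 0 x"
    and u0: "AE x in torus. u0 x = U 0 x"
  shows "AE z in cylinder T'. fst z < s \<longrightarrow> h (fst z) (snd z) = H (fst z) (snd z) \<and> u (fst z) (snd z) = U (fst z) (snd z)"
proof -
  have T0: "0 < T'" "T' \<le> T" using T by auto

  \<comment> \<open>Functions of a space-time point and the data of the weak solution\<close>
  define hz where "hz z = h (fst z) (snd z)" for z
  define uz where "uz z = u (fst z) (snd z)" for z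
  define Bz where "Bz z = B (fst z) (snd z)" for z
  define Hz where "Hz z = H (fst z) (snd z)" for z
  define Uz where "Uz i z = U (fst z) (snd z) $ i" for i z
  define bz where "bz z = b (fst z) (snd z)" for z
  have curry: "(\<lambda>(t, x). h t x) = hz" "(\<lambda>(t, x). u t x) = uz" "(\<lambda>(t, x). B t x) = Bz"
    "(\<lambda>(t, x). H t x) = Hz" "(\<lambda>(t, x). U t x) = (\<lambda>z. U (fst z) (snd z))"
    by (auto simp: hz_def uz_def Bz_def Hz_def fun_eq_iff)

  note weak = diss[unfolded dissipative_weak_solution_def weak_solution_def friction_selection_def curry]
  note str = strong[unfolded strong_solution_def friction_selection_def curry]
  have hmT: "hz \<in> borel_measurable (cylinder T)" and umT: "uz \<in> borel_measurable (cylinder T)"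
    and BmT: "Bz \<in> borel_measurable (cylinder T)"
    and nnT: "AE (t, x) in cylinder T. 0 \<le> h t x"
    and selT: "AE (t, x) in cylinder T. (u t x \<noteq> 0 \<longrightarrow> B t x = (1 / norm (u t x)) *\<^sub>R u t x) \<and>
        (u t x = 0 \<longrightarrow> B t x \<in> cball 0 1)"
    and wcont: "weak_continuity_eq T h0 h u" and wmom: "weak_momentum_eq T a \<gamma> f h0 u0 h u B"
    and en: "energy_inequality T a \<gamma> f h0 u0 h u B"
    using weak by blast+
  have hm: "hz \<in> borel_measurable (cylinder T')" and um: "uz \<in> borel_measurable (cylinder T')"
    and Bm: "Bz \<in> borel_measurable (cylinder T')"
    using measurable_cylinder_mono[OF _ T0(2)] hmT umT BmT by blast+
  have nn: "AE z in cylinder T'. 0 \<le> hz z"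
    using AE_cylinder_mono[OF nnT T0(2)] by (simp add: hz_def split_beta)
  have sel: "AE z in cylinder T'. (uz z \<noteq> 0 \<longrightarrow> Bz z = (1 / norm (uz z)) *\<^sub>R uz z) \<and> (uz z = 0 \<longrightarrow> Bz z \<in> cball 0 1)"
    using AE_cylinder_mono[OF selT T0(2)] by (simp only: uz_def Bz_def split_beta)

  \<comment> \<open>Lipschitz regularity and gradients of the strong solution\<close>
  obtain LH where LH: "LH-lipschitz_on ({0..T} \<times> UNIV) Hz" using str by blast
  obtain L where L: "L-lipschitz_on ({0..T} \<times> UNIV) (\<lambda>z. U (fst z) (snd z))" using str by blast
  have LU: "L-lipschitz_on ({0..T} \<times> UNIV) (Uz i)" for i
  proof (rule lipschitz_onI)
    fix y z :: "real \<times> (real^2)" assume yz: "y \<in> {0..T} \<times> UNIV" "z \<in> {0..T} \<times> UNIV"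
    have "dist (Uz i y) (Uz i z) \<le> dist (U (fst y) (snd y)) (U (fst z) (snd z))"
      unfolding Uz_def by (rule dist_vec_nth_le)
    also have "\<dots> \<le> L * dist y z" by (rule lipschitz_onD[OF L yz])
    finally show "dist (Uz i y) (Uz i z) \<le> L * dist y z" .
  qed (rule lipschitz_on_nonneg[OF L])
  have perHU: "periodic (H t) \<and> periodic (U t)" if "t \<in> {0..T}" for t using str that by blast
  have plH: "periodic_lipschitz T' Hz"
  proof (rule periodic_lipschitz_mono[OF periodic_lipschitzI[OF LH] T0(2)])
    show "periodic (\<lambda>x. Hz (t, x))" if "t \<in> {0..T}" for t using perHU[OF that] by (simp add: Hz_def)
  qed
  have plU: "periodic_lipschitz T' (Uz i)" for i
  proof (rule periodic_lipschitz_mono[OF periodic_lipschitzI[OF LU] T0(2)])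
    show "periodic (\<lambda>x. Uz i (t, x))" if "t \<in> {0..T}" for t
      using perHU[OF that] by (simp add: Uz_def periodic_def)
  qed

  \<comment> \<open>The choice returns the true gradient wherever the function is differentiable,
    hence almost everywhere in the cylinder; elsewhere its value is arbitrary.\<close>
  define gH where "gH z = (SOME g. (Hz has_derivative (\<lambda>v. g \<bullet> v)) (at z))" for z
  define gU where "gU i z = (SOME g. (Uz i has_derivative (\<lambda>v. g \<bullet> v)) (at z))" for i z
  have eqs: "AE (t, x) in cylinder T.
        Hz differentiable (at (t, x)) \<and>
        (\<lambda>z. U (fst z) (snd z)) differentiable (at (t, x)) \<and>
        dt H t x + dvg (\<lambda>y. H t y *\<^sub>R U t y) x = 0 \<and>
        dt (\<lambda>s y. H s y *\<^sub>R U s y) t x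
          + tensor_dvg (\<lambda>y. H t y *\<^sub>R tensor (U t y) (U t y)) x
          + grad (\<lambda>y. a * (H t y)\<^sup>2) x
          = H t x *\<^sub>R (- (\<gamma> x *\<^sub>R b t x) + f x)"
    and selUT: "AE (t, x) in cylinder T. (U t x \<noteq> 0 \<longrightarrow> b t x = (1 / norm (U t x)) *\<^sub>R U t x) \<and>
        (U t x = 0 \<longrightarrow> b t x \<in> cball 0 1)"
    using str by blast+
  have selU: "AE z in cylinder T'. (U (fst z) (snd z) \<noteq> 0 \<longrightarrow> bz z = (1 / norm (U (fst z) (snd z))) *\<^sub>R U (fst z) (snd z))
      \<and> (U (fst z) (snd z) = 0 \<longrightarrow> bz z \<in> cball 0 1)"
    using AE_cylinder_mono[OF selUT T0(2)] by (simp only: bz_def split_beta)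
  have grads: "AE z in cylinder T'. (Hz has_derivative (\<lambda>v. gH z \<bullet> v)) (at z) \<and>
        (\<forall>i. (Uz i has_derivative (\<lambda>v. gU i z \<bullet> v)) (at z)) \<and>
        fst (gH z) + (\<Sum>j\<in>UNIV. snd (gH z) $ j * Uz j z + Hz z * snd (gU j z) $ j) = 0 \<and>
        (\<forall>i. fst (gH z) * Uz i z + Hz z * fst (gU i z)
          + (\<Sum>j\<in>UNIV. snd (gH z) $ j * (Uz i z * Uz j z)
              + Hz z * (snd (gU i z) $ j * Uz j z + Uz i z * snd (gU j z) $ j))
          + 2 * a * Hz z * snd (gH z) $ i = Hz z * (- (\<gamma> (snd z) * bz z $ i) + f (snd z) $ i))"
    using AE_cylinder_mono[OF eqs T0(2)]
  proof eventually_elim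
    case (elim z)
    obtain t x where z: "z = (t, x)" by (cases z)
    have dH: "(Hz has_derivative (\<lambda>v. gH z \<bullet> v)) (at z)"
    proof -
      obtain g where "(Hz has_derivative (\<lambda>v. g \<bullet> v)) (at z)"
        using elim z differentiable_imp_gradient by blast
      then show ?thesis unfolding gH_def by (rule someI)
    qed
    have dU: "(Uz i has_derivative (\<lambda>v. gU i z \<bullet> v)) (at z)" for i
    proof -
      have "(\<lambda>z. U (fst z) (snd z)) differentiable (at z)" using elim z by simp
      then obtain D where "((\<lambda>z. U (fst z) (snd z)) has_derivative D) (at z)"
        unfolding differentiable_def by blast
      from bounded_linear.has_derivative[OF bounded_linear_vec_nth this]
      have "Uz i differentiable (at z)" unfolding Uz_def differentiable_def by blast
      then obtain g where "(Uz i has_derivative (\<lambda>v. g \<bullet> v)) (at z)"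
        using differentiable_imp_gradient by blast
      then show ?thesis unfolding gU_def by (rule someI)
    qed
    note S = strong_equations_componentwise[OF dH[unfolded z Hz_def] dU[unfolded z Uz_def],
        of a \<gamma> b f]
    show ?case
      using dH dU S elim unfolding z by (simp add: Hz_def Uz_def bz_def)
  qed

  \<comment> \<open>The time weight\<close>
  define n where "n = Suc (nat \<lceil>4 * L * T'\<rceil>)"
  \<comment> \<open>On times before \<open>s\<close> the difference
    \<open>g t - 4 * L * \<psi> t\<close> equals (s-t)^n (n + 1 - 4L(s-t)), so it is positive once n
    + 1 exceeds 4LT'. The successor in \<open>n\<close> keeps the exponent of \<open>\<psi>\<close>
    at least two, which makes \<open>\<psi>\<close> a C1 function.\<close>
  have n: "4 * L * T' < real (Suc n)" by (simp add: n_def) linarith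
  define \<psi> where "\<psi> t = (max 0 (s - t)) ^ Suc n" for t
  define g where "g t = real (Suc n) * (max 0 (s - t)) ^ n" for t
  have \<psi>: "(\<psi> has_real_derivative - g t) (at t)" for t
  proof -
    have "((\<lambda>t. s - t) has_real_derivative - 1) (at t)"
      by (auto intro!: derivative_eq_intros)
    from DERIV_chain2[OF has_real_derivative_max0_power this, of "nat \<lceil>4 * L * T'\<rceil>"]
    show ?thesis unfolding \<psi>_def g_def n_def by simp
  qed
  have g: "continuous_on UNIV g" unfolding g_def by (intro continuous_intros)
  have g0: "0 \<le> g t" and \<psi>0: "0 \<le> \<psi> t" for t by (simp_all add: g_def \<psi>_def)
  have van: "\<psi> t = 0" if "s \<le> t" for t using that by (simp add: \<psi>_def max_def)
  have L0: "0 \<le> L" using L by (rule lipschitz_on_nonneg)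
  have weight: "0 \<le> g t - 4 * L * \<psi> t \<and> (t < s \<longrightarrow> 0 < g t - 4 * L * \<psi> t)" if "0 < t" for t
  proof -
    have eq: "g t - 4 * L * \<psi> t = (max 0 (s - t)) ^ n * (real (Suc n) - 4 * L * max 0 (s - t))"
      by (simp add: g_def \<psi>_def algebra_simps)
    have "max 0 (s - t) \<le> T'" using that T by auto
    then have "4 * L * max 0 (s - t) \<le> 4 * L * T'" using L0 by (intro mult_left_mono) auto
    then have "0 < real (Suc n) - 4 * L * max 0 (s - t)" using n by linarith
    then show ?thesis unfolding eq by (auto intro!: mult_nonneg_nonneg mult_pos_pos)
  qed

  \<comment> \<open>The weighted energy inequality\<close>
  define E where "E z = energy_density a (hz z) (uz z)" for z
  define R where "R z = hz z * \<gamma> (snd z) * (Bz z \<bullet> uz z) - hz z * (f (snd z) \<bullet> uz z)" for z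
  define E0 where "E0 x = energy_density a (h0 x) (u0 x)" for x
  note EI = energy_inequality_integrable[OF en a hmT[folded curry] umT[folded curry] nnT T0(1) T(3)]
  have Ei: "integrable (cylinder T') E" using EI(1) unfolding E_def[abs_def] by (simp add: hz_def uz_def case_prod_unfold)
  have E0i: "integrable torus E0" using EI(2) unfolding E0_def[abs_def] .
  have R_eq: "R = (\<lambda>(t, x). h t x * \<gamma> x * (B t x \<bullet> u t x) - h t x * (f x \<bullet> u t x))"
    by (auto simp: R_def hz_def uz_def Bz_def)
  have Ri: "integrable (cylinder T') R"
    using Bochner_Integration.integrable_diff[OF EI(3,4)] unfolding R_eq by (simp add: case_prod_unfold)
  have "AE \<tau> in lebesgue_on {0<..<T'}. (\<integral>x. E (\<tau>, x) \<partial>torus) + integral\<^sup>L (cylinder \<tau>) R \<le> integral\<^sup>L torus E0"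
    using EI(5) unfolding R_eq E_def E0_def[abs_def] by (simp add: hz_def uz_def)
  note energy = weighted_time_inequality[OF T0(1) Ei Ri \<psi> g g0 van[OF less_imp_le[OF T(2)]] this]

  \<comment> \<open>Integrable fluxes and the balance laws of the weak solution\<close>
  note mi = momentum_integrable[OF a hm um nn Ei[unfolded E_def[abs_def]]]
  define V where "V = (\<lambda>(t, x). (h t x, h t x *\<^sub>R u t x))"
  have V_eq: "V = (\<lambda>z. (hz z, hz z *\<^sub>R uz z))" by (auto simp: V_def hz_def uz_def)
  have Vi: "integrable (cylinder T') V"
    unfolding V_eq by (intro integrable_Pair mi)
  have contH0: "continuous_on UNIV (\<lambda>x. Hz (0, x))" and contU0: "continuous_on UNIV (\<lambda>x. Uz i (0, x))" for i
    by (rule continuous_on_compose2[OF periodic_lipschitz_continuous_on[OF plH]]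
          continuous_on_compose2[OF periodic_lipschitz_continuous_on[OF plU]];
        use T0 in \<open>auto intro!: continuous_intros\<close>)+
  have h0i: "integrable torus h0"
    by (rule integrable_torus_AE_continuous[OF contH0]) (use h0 in \<open>simp add: Hz_def\<close>)
  have h0u0i: "integrable torus (\<lambda>x. h0 x * u0 x $ i)" for i
  proof (rule integrable_torus_AE_continuous)
    show "continuous_on UNIV (\<lambda>x. Hz (0, x) * Uz i (0, x))" by (intro continuous_intros contH0 contU0)
    show "AE x in torus. h0 x * u0 x $ i = Hz (0, x) * Uz i (0, x)"
      using h0 u0 by eventually_elim (simp add: Hz_def Uz_def)
  qed
  have balC: "weak_balance T' V (\<lambda>_. 0) h0"
    unfolding V_def by (rule weak_balance_continuity[OF wcont T(3) Vi[unfolded V_def] h0i])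

  define W where "W i = momentum_flux a h u i" for i
  have W_eq: "W i = (\<lambda>z. (hz z * uz z $ i, (hz z * uz z $ i) *\<^sub>R uz z + (a * (hz z)\<^sup>2) *\<^sub>R axis i 1))" for i
    by (auto simp: W_def momentum_flux_def hz_def uz_def)
  have Wi: "integrable (cylinder T') (W i)" for i
    unfolding W_eq
    by (intro integrable_Pair Bochner_Integration.integrable_add mi integrable_scaleR_left integrable_mult_right)
  define J where "J i = momentum_source \<gamma> f h B i" for i
  have J_eq: "J i = (\<lambda>z. (\<gamma> (snd z) * Bz z $ i - f (snd z) $ i) * hz z)" for i
    by (auto simp: J_def momentum_source_def hz_def Bz_def)
  have contf: "continuous_on UNIV (\<lambda>x. f x $ i)" for i by (intro continuous_intros f)
  have snd_cont: "continuous_on S (\<lambda>z. k (snd z))" if "continuous_on UNIV k" for S :: "(real \<times> (real^2)) set" and k :: "real^2 \<Rightarrow> real"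
    by (rule continuous_on_compose2[OF that]) (auto intro: continuous_intros)
  have Ji: "integrable (cylinder T') (J i)" for i
  proof -
    \<comment> \<open>The selection has norm at most 1 in either case, so the friction force is
      dominated by a multiple of \<open>h\<close>.\<close>
    have "integrable (cylinder T') (\<lambda>z. Bz z $ i * hz z)"
    proof (rule integrable_mult_bounded[OF mi(1)])
      show "(\<lambda>z. Bz z $ i) \<in> borel_measurable (cylinder T')" by (rule borel_measurable_vec_nth_comp[OF Bm])
      show "AE z in cylinder T'. \<bar>Bz z $ i\<bar> \<le> 1"
        using sel
      proof eventually_elim
        case (elim z)
        have "norm (Bz z) \<le> 1" using elim by (cases "uz z = 0") auto
        then show ?case using component_le_norm_cart[of "Bz z" i] by linarith
      qed
    qed
    from integrable_cylinder_mult_continuous[OF this snd_cont[OF \<gamma>(1)]]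
      integrable_cylinder_mult_continuous[OF mi(1) snd_cont[OF contf]]
    show ?thesis unfolding J_eq by (simp add: left_diff_distrib mult.assoc)
  qed
  have balM: "weak_balance T' (W i) (J i) (\<lambda>x. h0 x * u0 x $ i)" for i
    unfolding W_def J_def
    by (rule weak_balance_momentum[OF wmom T(3) Wi[unfolded W_def] Ji[unfolded J_def] h0u0i])

  \<comment> \<open>Test functions built from the strong solution\<close>
  define \<phi> where "\<phi> z = (\<Sum>i\<in>UNIV. Uz i z * Uz i z) * (1 / 2) + (- 2 * a) * Hz z" for z
  define G\<phi> where "G\<phi> z = (\<Sum>i\<in>UNIV. Uz i z *\<^sub>R gU i z) + (- 2 * a) *\<^sub>R gH z" for z
  have pl\<phi>: "periodic_lipschitz T' \<phi>"
    unfolding \<phi>_def[abs_def] by (intro periodic_lipschitz_add periodic_lipschitz_mult periodic_lipschitz_sum periodic_lipschitz_const plU plH)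
  have d\<phi>: "AE z in cylinder T'. (\<phi> has_derivative (\<lambda>v. G\<phi> z \<bullet> v)) (at z)"
    using grads
  proof eventually_elim
    case (elim z)
    then have dH: "(Hz has_derivative (\<lambda>v. gH z \<bullet> v)) (at z)"
      and dU: "\<And>i. (Uz i has_derivative (\<lambda>v. gU i z \<bullet> v)) (at z)" by blast+
    show ?case unfolding \<phi>_def[abs_def] G\<phi>_def
      by (rule has_derivative_eq_rhs, (rule derivative_intros dH dU)+)
         (simp add: fun_eq_iff sum_2 inner_add_left inner_diff_left algebra_simps)
  qed
  \<comment> \<open>The part of the relative energy that depends on the strong solution alone.
    Tested in the constant time field, it contributes its initial value and its time
    derivative.\<close>
  define q where "q z = a * (Hz z * Hz z)" for z
  have plq: "periodic_lipschitz T' q"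
    unfolding q_def[abs_def] by (intro periodic_lipschitz_mult periodic_lipschitz_const plH)
  have dq: "AE z in cylinder T'. (q has_derivative (\<lambda>v. ((2 * a * Hz z) *\<^sub>R gH z) \<bullet> v)) (at z)"
    using grads
  proof eventually_elim
    case (elim z)
    then have dH: "(Hz has_derivative (\<lambda>v. gH z \<bullet> v)) (at z)" by blast
    show ?case unfolding q_def[abs_def]
      by (rule has_derivative_eq_rhs, (rule derivative_intros dH)+) (simp add: fun_eq_iff algebra_simps)
  qed
  \<comment> \<open>The field q U is tested against constant space fields, so the weighted
    divergence of q U integrates to zero. Together with the time derivative of \<open>q\<close> and
    the continuity equation it leaves the term a H^2 div U that completes the square (h-H)^2 in the
    pressure remainder.\<close>
  have plqU: "periodic_lipschitz T' (\<lambda>z. q z * Uz j z)" for j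
    by (intro periodic_lipschitz_mult plq plU)
  have dqU: "AE z in cylinder T'. ((\<lambda>z. q z * Uz j z) has_derivative
      (\<lambda>v. ((2 * a * Hz z * Uz j z) *\<^sub>R gH z + q z *\<^sub>R gU j z) \<bullet> v)) (at z)" for j
    using grads dq
  proof eventually_elim
    case (elim z)
    then have dU: "(Uz j has_derivative (\<lambda>v. gU j z \<bullet> v)) (at z)" by blast
    from has_derivative_mult[OF elim(2) this] show ?case
      by (rule has_derivative_eq_rhs) (simp add: fun_eq_iff inner_add_left algebra_simps)
  qed
  have dU: "AE z in cylinder T'. (Uz i has_derivative (\<lambda>v. gU i z \<bullet> v)) (at z)" for i
    using grads by eventually_elim blast
  note C = weak_balance_weighted[OF balC T(2) T0(1) \<psi> g van pl\<phi> d\<phi>]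
  note M = weak_balance_weighted[OF balM T(2) T0(1) \<psi> g van plU dU]
  note Q = weak_balance_weighted[OF weak_balance_time_const[OF T0(1)] T(2) T0(1) \<psi> g van plq dq]
  note X = weak_balance_weighted[OF weak_balance_space_const T(2) T0(1) \<psi> g van plqU dqU]

  \<comment> \<open>The integrated relative energy balance\<close>
  define IC where "IC z = - g (fst z) * \<phi> z * fst (V z) + \<psi> (fst z) * (G\<phi> z \<bullet> V z)" for z
  define IM where "IM i z = - g (fst z) * Uz i z * fst (W i z) + \<psi> (fst z) * (gU i z \<bullet> W i z)" for i z
  define JM where "JM i z = J i z * (\<psi> (fst z) * Uz i z)" for i z
  define IQ where "IQ z = - g (fst z) * q z * fst (1 :: real, 0 :: real^2)
      + \<psi> (fst z) * (((2 * a * Hz z) *\<^sub>R gH z) \<bullet> (1, 0))" for z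
  define IX where "IX j z = - g (fst z) * (q z * Uz j z) * fst (0 :: real, axis j 1 :: real^2)
      + \<psi> (fst z) * (((2 * a * Hz z * Uz j z) *\<^sub>R gH z + q z *\<^sub>R gU j z) \<bullet> (0, axis j 1))" for j z
  have CI: "integrable (cylinder T') IC" "integral\<^sup>L (cylinder T') IC = - (\<integral>x. h0 x * (\<psi> 0 * \<phi> (0, x)) \<partial>torus)"
    and C0: "integrable torus (\<lambda>x. h0 x * (\<psi> 0 * \<phi> (0, x)))"
    using C unfolding IC_def[abs_def] by simp_all
  have MI: "integrable (cylinder T') (IM i)" "integrable (cylinder T') (JM i)"
    "integral\<^sup>L (cylinder T') (IM i) = integral\<^sup>L (cylinder T') (JM i) - (\<integral>x. h0 x * u0 x $ i * (\<psi> 0 * Uz i (0, x)) \<partial>torus)"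
    and M0: "integrable torus (\<lambda>x. h0 x * u0 x $ i * (\<psi> 0 * Uz i (0, x)))" for i
    using M[of i] unfolding IM_def[abs_def] JM_def[abs_def] by simp_all
  have QI: "integrable (cylinder T') IQ" "integral\<^sup>L (cylinder T') IQ = - (\<integral>x. \<psi> 0 * q (0, x) \<partial>torus)"
    and Q0: "integrable torus (\<lambda>x. \<psi> 0 * q (0, x))"
    using Q unfolding IQ_def[abs_def] by simp_all
  have XI: "integrable (cylinder T') (IX j)" "integral\<^sup>L (cylinder T') (IX j) = 0" for j
    using X[of j] unfolding IX_def[abs_def] by simp_all

  \<comment> \<open>The signs follow the expansion of e: energy, minus the \<open>\<phi>\<close>
    test, plus the momentum tests, minus the balance of \<open>q\<close>. Each tested integrand
    carries -g rather than g, hence the apparent reversal.\<close>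
  define P where "P z = g (fst z) * E z + \<psi> (fst z) * R z - IC z + (\<Sum>i\<in>UNIV. IM i z - JM i z) - IQ z - (\<Sum>j\<in>UNIV. IX j z)" for z
  have Pi: "integrable (cylinder T') P"
    unfolding P_def[abs_def] by (intro Bochner_Integration.integrable_add Bochner_Integration.integrable_diff
        Bochner_Integration.integrable_sum energy CI MI QI XI)
  have "integral\<^sup>L (cylinder T') P \<le> 0"
  proof -
    have "integral\<^sup>L (cylinder T') P = ((\<integral>z. g (fst z) * E z \<partial>cylinder T') + (\<integral>z. \<psi> (fst z) * R z \<partial>cylinder T'))
        - integral\<^sup>L (cylinder T') IC + (\<Sum>i\<in>UNIV. integral\<^sup>L (cylinder T') (IM i) - integral\<^sup>L (cylinder T') (JM i))
        - integral\<^sup>L (cylinder T') IQ - (\<Sum>j\<in>UNIV. integral\<^sup>L (cylinder T') (IX j))"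
      unfolding P_def[abs_def] using energy(1,2) CI(1) MI(1,2) QI(1) XI(1) by simp
    also have "\<dots> \<le> \<psi> 0 * integral\<^sup>L torus E0 + (\<integral>x. h0 x * (\<psi> 0 * \<phi> (0, x)) \<partial>torus)
        - (\<Sum>i\<in>UNIV. \<integral>x. h0 x * u0 x $ i * (\<psi> 0 * Uz i (0, x)) \<partial>torus) + (\<integral>x. \<psi> 0 * q (0, x) \<partial>torus)"
      using energy(3) by (simp add: CI(2) MI(3) QI(2) XI(2) sum_negf)
    also have "\<dots> = (\<integral>x. \<psi> 0 * E0 x + h0 x * (\<psi> 0 * \<phi> (0, x))
        - (\<Sum>i\<in>UNIV. h0 x * u0 x $ i * (\<psi> 0 * Uz i (0, x))) + \<psi> 0 * q (0, x) \<partial>torus)"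
      using E0i C0 M0 Q0 by simp
    \<comment> \<open>The collected initial terms are \<open>\<psi> 0\<close> times the relative
      energy at time 0, which vanishes because the data coincide almost everywhere.\<close>
    also have "\<dots> = 0"
    proof (rule integral_eq_zero_AE)
      show "AE x in torus. \<psi> 0 * E0 x + h0 x * (\<psi> 0 * \<phi> (0, x))
          - (\<Sum>i\<in>UNIV. h0 x * u0 x $ i * (\<psi> 0 * Uz i (0, x))) + \<psi> 0 * q (0, x) = 0"
        using h0 u0
      proof eventually_elim
        case (elim x)
        show ?case
          unfolding E0_def energy_density_def \<phi>_def q_def elim power2_norm_eq_inner
          by (simp add: Hz_def Uz_def inner_vec_def sum_2 power2_eq_square field_simps)
      qed
    qed
    finally show ?thesis .
  qed

  \<comment> \<open>Pointwise lower bound and conclusion\<close>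
  have P_ge: "AE z in cylinder T'. (g (fst z) - 4 * L * \<psi> (fst z)) *
      (1 / 2 * hz z * (\<Sum>i\<in>UNIV. (uz z $ i - Uz i z)\<^sup>2) + a * (hz z - Hz z)\<^sup>2) \<le> P z"
    using nn sel selU grads AE_space
  proof eventually_elim
    case (elim z)
    have dU: "(Uz i has_derivative (\<lambda>v. gU i z \<bullet> v)) (at z)" for i using elim(4) by blast
    have zT: "z \<in> {0<..<T} \<times> UNIV" and zT': "fst z \<in> {0..T}" using elim(5) T0 by auto
    have "norm (gU i z) \<le> L" for i
    proof (rule norm_gradient_le_lipschitz[OF _ _ zT dU])
      show "L-lipschitz_on ({0<..<T} \<times> UNIV) (Uz i)" by (rule lipschitz_on_subset[OF LU]) auto
    qed (auto intro: open_Times)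
    then have bound: "\<bar>snd (gU i z) $ j\<bar> \<le> L" for i j
      using component_le_norm_cart[of "snd (gU i z)" j] norm_snd_le[of "snd (gU i z)" "fst (gU i z)"]
      unfolding prod.collapse by (meson order_trans)
    have "0 \<le> (Bz z - bz z) \<bullet> (uz z - U (fst z) (snd z))"
      using elim(2,3) by (intro friction_monotone) blast+
    then have mono: "0 \<le> (\<Sum>i\<in>UNIV. (Bz z $ i - bz z $ i) * (uz z $ i - Uz i z))"
      by (simp add: inner_vec_def Uz_def)
    have Hp: "0 < Hz z" using Hpos[OF zT'] by (simp add: Hz_def)
    have c: "fst (gH z) + (\<Sum>j\<in>UNIV. snd (gH z) $ j * Uz j z + Hz z * snd (gU j z) $ j) = 0"
      and m: "\<And>i. fst (gH z) * Uz i z + Hz z * fst (gU i z)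
          + (\<Sum>j\<in>UNIV. snd (gH z) $ j * (Uz i z * Uz j z)
              + Hz z * (snd (gU i z) $ j * Uz j z + Uz i z * snd (gU j z) $ j))
          + 2 * a * Hz z * snd (gH z) $ i = Hz z * (- (\<gamma> (snd z) * bz z $ i) + f (snd z) $ i)"
      using elim(4) by blast+
    note rel = relative_energy_pointwise[of a "hz z" "Hz z" "\<psi> (fst z)" "\<gamma> (snd z)" "\<lambda>i j. snd (gU i z) $ j" L
        "\<lambda>i. Bz z $ i" "\<lambda>i. bz z $ i" "\<lambda>i. uz z $ i" "\<lambda>i. Uz i z" "fst (gH z)" "\<lambda>j. snd (gH z) $ j"
        "\<lambda>i. fst (gU i z)" "\<lambda>i. f (snd z) $ i" "g (fst z)",
        OF a elim(1) Hp \<psi>0 \<gamma>(2) bound mono c m]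
    have "(norm (uz z))\<^sup>2 = (\<Sum>i\<in>UNIV. (uz z $ i)\<^sup>2)"
      unfolding power2_norm_eq_inner by (simp add: inner_vec_def power2_eq_square)
    then have Ez: "E z = 1 / 2 * hz z * (\<Sum>i\<in>UNIV. (uz z $ i)\<^sup>2) + a * (hz z)\<^sup>2"
      by (simp add: E_def energy_density_def)
    show ?case
      by (rule order_trans[OF rel eq_refl])
         (simp add: P_def Ez R_def IC_def IM_def JM_def IQ_def IX_def V_eq W_eq J_eq
           \<phi>_def G\<phi>_def q_def inner_vec_def inner_prod_def inner_axis sum_2
           axis_def power2_eq_square field_simps)
  qed
  have e_nonneg: "0 \<le> 1 / 2 * hz z * (\<Sum>i\<in>UNIV. (uz z $ i - Uz i z)\<^sup>2) + a * (hz z - Hz z)\<^sup>2" if "0 \<le> hz z" for z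
    using that a by (intro add_nonneg_nonneg mult_nonneg_nonneg sum_nonneg) auto
  \<comment> \<open>The weight factor and the relative energy are both nonnegative. Since the
    integral of \<open>P\<close> is at most 0, \<open>P\<close> must then vanish almost
    everywhere.\<close>
  have P_nonneg: "AE z in cylinder T'. 0 \<le> P z"
    using P_ge nn AE_space
  proof eventually_elim
    case (elim z)
    have "0 < fst z" using elim(3) by auto
    then show ?case using elim(1) mult_nonneg_nonneg[OF _ e_nonneg[OF elim(2)]] weight by fastforce
  qed
  with \<open>integral\<^sup>L (cylinder T') P \<le> 0\<close> have "integral\<^sup>L (cylinder T') P = 0"
    using integral_nonneg_AE[OF P_nonneg] by simp
  then have "AE z in cylinder T'. P z = 0"
    using integral_nonneg_eq_0_iff_AE[OF Pi P_nonneg] by simp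
  with P_ge nn AE_space show ?thesis
  proof eventually_elim
    case (elim z)
    define e where "e = 1 / 2 * hz z * (\<Sum>i\<in>UNIV. (uz z $ i - Uz i z)\<^sup>2) + a * (hz z - Hz z)\<^sup>2"
    have z: "0 < fst z" "fst z \<in> {0..T}" using elim(3) T0 by auto
    show ?case
    proof
      assume "fst z < s"
      then have "0 < g (fst z) - 4 * L * \<psi> (fst z)" using weight[OF z(1)] by blast
      moreover have "(g (fst z) - 4 * L * \<psi> (fst z)) * e \<le> 0" using elim(1,4) by (simp only: e_def)
      ultimately have "e \<le> 0" by (simp add: mult_le_0_iff)
      moreover have p: "0 \<le> 1 / 2 * hz z * (\<Sum>i\<in>UNIV. (uz z $ i - Uz i z)\<^sup>2)" "0 \<le> a * (hz z - Hz z)\<^sup>2"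
        using elim(2) a by (auto intro!: mult_nonneg_nonneg sum_nonneg)
      ultimately have 1: "1 / 2 * hz z * (\<Sum>i\<in>UNIV. (uz z $ i - Uz i z)\<^sup>2) = 0" and "a * (hz z - Hz z)\<^sup>2 = 0"
        unfolding e_def by linarith+
      \<comment> \<open>The height has to be settled first: it gives h = H > 0, and only with a
        positive factor does the vanishing kinetic part determine the velocity.\<close>
      then have hH: "hz z = Hz z" using a by simp
      moreover have "0 < Hz z" using Hpos[OF z(2)] by (simp add: Hz_def)
      ultimately have "(\<Sum>i\<in>UNIV. (uz z $ i - Uz i z)\<^sup>2) = 0" using 1 by simp
      then have "uz z $ i = Uz i z" for i by (simp add: sum_nonneg_eq_0_iff)
      then have "uz z = U (fst z) (snd z)" by (simp add: vec_eq_iff Uz_def)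
      with hH show "h (fst z) (snd z) = H (fst z) (snd z) \<and> u (fst z) (snd z) = U (fst z) (snd z)"
        by (simp add: hz_def Hz_def uz_def)
    qed
  qed
qed

theorem theorem3p1:
  fixes T a :: real
    and \<gamma> :: "real^2 \<Rightarrow> real" and f :: "real^2 \<Rightarrow> real^2"
    and h0 :: "real^2 \<Rightarrow> real" and u0 :: "real^2 \<Rightarrow> real^2"
    and h H :: "real \<Rightarrow> real^2 \<Rightarrow> real"
    and u U B\<^sub>u B\<^sub>U :: "real \<Rightarrow> real^2 \<Rightarrow> real^2"
  assumes "T > 0" and "a > 0"
    and "smooth_on_torus \<gamma>" and "\<And>x. \<gamma> x \<ge> 0"
    and "smooth_on_torus f"
    and "dissipative_weak_solution T a \<gamma> f h0 u0 h u B\<^sub>u"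
    and "strong_solution T a \<gamma> f H U B\<^sub>U"
    and "\<And>t x. t \<in> {0..T} \<Longrightarrow> H t x > 0"
    and "AE x in torus. h0 x = H 0 x"
    and "AE x in torus. u0 x = U 0 x"
  shows "AE (t, x) in cylinder T. h t x = H t x \<and> u t x = U t x"
proof -
  \<comment> \<open>The times \<open>s n\<close> tend to \<open>T\<close>, and countably many
    exceptional null sets can be united. The shift by 2 makes already s 0 = T/2 positive, and the
    midpoint \<open>T' n\<close> lies strictly between \<open>s n\<close> and
    \<open>T\<close>.\<close>
  define s where "s n = T - T / (real n + 2)" for n :: nat
  define T' where "T' n = (s n + T) / 2" for n
  have s: "0 < s n" "s n < T" for n
    using \<open>T > 0\<close> by (auto simp: s_def field_simps intro!: add_pos_nonneg)
  have T': "s n < T' n" "T' n < T" for n using s[of n] by (auto simp: T'_def)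
  have \<gamma>: "continuous_on UNIV \<gamma>" and f: "continuous_on UNIV f"
    using assms(3,5) Ck_continuous_on unfolding smooth_on_torus_def by blast+
  have "AE z in lborel. z \<in> {0<..<T' n} \<times> unit_square \<longrightarrow> fst z < s n \<longrightarrow>
      h (fst z) (snd z) = H (fst z) (snd z) \<and> u (fst z) (snd z) = U (fst z) (snd z)" for n
    using relative_energy_uniqueness[OF s(1) T'(1) T'(2) assms(2) \<gamma> assms(4) f assms(6,7,8,9,10), of n]
    unfolding cylinder_def by (simp only: AE_lebesgue_on_iff cylinder_sets)
  then have "AE z in lborel. \<forall>n. z \<in> {0<..<T' n} \<times> unit_square \<longrightarrow> fst z < s n \<longrightarrow>
      h (fst z) (snd z) = H (fst z) (snd z) \<and> u (fst z) (snd z) = U (fst z) (snd z)"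
    unfolding AE_all_countable by blast
  then have "AE z in lborel. z \<in> {0<..<T} \<times> unit_square \<longrightarrow>
      h (fst z) (snd z) = H (fst z) (snd z) \<and> u (fst z) (snd z) = U (fst z) (snd z)"
  proof eventually_elim
    case (elim z)
    show ?case
    proof
      assume z: "z \<in> {0<..<T} \<times> unit_square"
      then have t: "0 < fst z" "fst z < T" by auto
      \<comment> \<open>With t the time of \<open>z\<close>, this choice gives T/(n+2) < T - t, that
        is, t < s n.\<close>
      obtain n where "T / (T - fst z) < real n" using reals_Archimedean2 by blast
      then have "fst z < s n" using t by (simp add: s_def field_simps)
      moreover from this have "z \<in> {0<..<T' n} \<times> unit_square"
        using z T'(1)[of n] by auto
      ultimately show "h (fst z) (snd z) = H (fst z) (snd z) \<and> u (fst z) (snd z) = U (fst z) (snd z)"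
        using elim by blast
    qed
  qed
  then show ?thesis
    by (simp only: cylinder_def AE_lebesgue_on_iff cylinder_sets split_beta)
qed

end
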